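(* Let $\Omega=(0,1)^d$. There is a universal constant $c>0$ such that for every real-valued $f\in\mathcal{B}^2(\Omega)$ and every integer $m\ge 1$ there exists a two-layer ReLU neural network $f_m\in\mathcal{F}_{m,1}(5\|f\|_{\mathcal{B}^2(\Omega)})$ with $$\|f-f_m\|_{H^1(\Omega)}\le c\,\|f\|_{\mathcal{B}^2(\Omega)}\,m^{-\left(\frac12+\frac1{3d}\right)} .$$
   Context: For $x\in\mathbb{R}^d$, $|x|_1$ is the $\ell^1$-norm. $\sigma(z)=\max(0,z)$ is the ReLU function. Barron space: for $s\ge 0$, $\mathcal{B}^s(\Omega)=\{f:\Omega\to\mathbb{C}:\ \|f\|_{\mathcal{B}^s(\Omega)}<\infty\}$ with $\|f\|_{\mathcal{B}^s(\Omega)}:=\inf_{f_e|_\Omega=f}\int_{\mathbb{R}^d}(1+|\omega|_1)^s|\hat f_e(\omega)|\,d\omega$, where the infimum is over extensions $f_e\in L^1(\mathbb{R}^d)$ of $f$ and $\hat f_e$ is the Fourier transform, normalized so that $f_e(x)=\int_{\mathbb{R}^d} e^{i\omega\cdot x}\hat f_e(\omega)\,d\omega$. For $B>0$, $\mathcal{F}_{m,1}(B):=\{\sum_{i=1}^m\gamma_i\sigma(\omega_i\cdot x+t_i):\ |\omega_i|_1=1,\ t_i\in[-1,1),\ \sum_{i=1}^m|\gamma_i|\le B\}$, with $\gamma_i\in\mathbb{R}$, $\omega_i\in\mathbb{R}^d$. "Universal constant" means independent of $d$, $m$, $f$. *)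

theory Defs
  imports "HOL-Analysis.Analysis"
begin

text \<open>
  The constant of the theorem is uniform in the dimension \<open>d\<close>, so \<open>d\<close> has to be a quantifiable
  natural number rather than a type.  Points of \<open>\<real>\<^sup>d\<close> are the functions \<open>nat \<Rightarrow> real\<close> that are
  \<open>undefined\<close> outside \<open>{..<d}\<close>, with the Lebesgue measure (completed product measure) and the
  product topology inherited from \<open>nat \<Rightarrow> real\<close>, which is the usual topology of \<open>\<real>\<^sup>d\<close>.
\<close>

type_synonym point = "nat \<Rightarrow> real"

definition Rn :: "nat \<Rightarrow> point set" where
  "Rn d = (\<Pi>\<^sub>E i\<in>{..<d}. UNIV)"

definition leb :: "nat \<Rightarrow> point measure" where
  "leb d = completion (\<Pi>\<^sub>M i\<in>{..<d}. lborel)"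

definition unit_cube :: "nat \<Rightarrow> point set" where
  "unit_cube d = (\<Pi>\<^sub>E i\<in>{..<d}. {0<..<1})"

definition dot :: "nat \<Rightarrow> point \<Rightarrow> point \<Rightarrow> real" where
  "dot d x y = (\<Sum>i<d. x i * y i)"

definition norm1 :: "nat \<Rightarrow> point \<Rightarrow> real" where
  "norm1 d x = (\<Sum>i<d. \<bar>x i\<bar>)"


section \<open>Barron spaces\<close>

text \<open>
  The factor \<open>(2 * pi) ^ d\<close> is the one for which Fourier inversion reads
  \<open>f x = \<integral> exp (\<i> * (\<omega> \<bullet> x)) * fourier d f \<omega> d\<omega>\<close>.
\<close>

definition fourier :: "nat \<Rightarrow> (point \<Rightarrow> complex) \<Rightarrow> point \<Rightarrow> complex" where
  "fourier d f \<omega> =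
     (LINT x|leb d. f x * exp (- \<i> * complex_of_real (dot d \<omega> x))) / complex_of_real ((2 * pi) ^ d)"

text \<open>
  Since \<open>leb d\<close> is complete, asking an extension to agree with \<open>f\<close> everywhere on \<open>\<Omega>\<close> is the same as
  asking it to agree almost everywhere.  The values of \<open>f\<close> outside \<open>\<Omega>\<close> are irrelevant.
\<close>

definition L1_extensions ::
    "nat \<Rightarrow> point set \<Rightarrow> (point \<Rightarrow> complex) \<Rightarrow> (point \<Rightarrow> complex) set" where
  "L1_extensions d \<Omega> f = {fe. integrable (leb d) fe \<and> (\<forall>x\<in>\<Omega>. fe x = f x)}"

definition barron_norm :: "nat \<Rightarrow> real \<Rightarrow> point set \<Rightarrow> (point \<Rightarrow> complex) \<Rightarrow> ennreal" where
  "barron_norm d s \<Omega> f =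
     (INF fe\<in>L1_extensions d \<Omega> f.
        \<integral>\<^sup>+ \<omega>. ennreal ((1 + norm1 d \<omega>) powr s * cmod (fourier d fe \<omega>)) \<partial>leb d)"

definition barron_space :: "nat \<Rightarrow> real \<Rightarrow> point set \<Rightarrow> (point \<Rightarrow> complex) set" where
  "barron_space d s \<Omega> = {f. barron_norm d s \<Omega> f < \<infinity>}"


section \<open>The Sobolev norm of \<open>H\<^sup>1\<close>\<close>

definition partial_deriv :: "nat \<Rightarrow> (point \<Rightarrow> real) \<Rightarrow> point \<Rightarrow> real" where
  "partial_deriv i \<phi> x = deriv (\<lambda>t. \<phi> (x(i := t))) (x i)"

definition smooth :: "nat \<Rightarrow> (point \<Rightarrow> real) \<Rightarrow> bool" where
  "smooth d \<phi> \<longleftrightarrow>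
     (\<forall>js. set js \<subseteq> {..<d} \<longrightarrow>
        continuous_on (Rn d) (foldr partial_deriv js \<phi>) \<and>
        (\<forall>i<d. \<forall>x\<in>Rn d. (\<lambda>t. foldr partial_deriv js \<phi> (x(i := t))) field_differentiable at (x i)))"

definition test_functions :: "nat \<Rightarrow> point set \<Rightarrow> (point \<Rightarrow> real) set" where
  "test_functions d \<Omega> =
     {\<phi>. smooth d \<phi> \<and> (\<exists>K. compact K \<and> K \<subseteq> \<Omega> \<and> (\<forall>x\<in>Rn d - K. \<phi> x = 0))}"

definition L2 :: "nat \<Rightarrow> point set \<Rightarrow> (point \<Rightarrow> real) set" where
  "L2 d \<Omega> = {u. set_borel_measurable (leb d) \<Omega> u \<and> set_integrable (leb d) \<Omega> (\<lambda>x. (u x)\<^sup>2)}"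

definition weak_partial :: "nat \<Rightarrow> point set \<Rightarrow> nat \<Rightarrow> (point \<Rightarrow> real) \<Rightarrow> (point \<Rightarrow> real) \<Rightarrow> bool" where
  "weak_partial d \<Omega> i u v \<longleftrightarrow>
     (\<forall>\<phi>\<in>test_functions d \<Omega>.
        (LINT x:\<Omega>|leb d. u x * partial_deriv i \<phi> x) = - (LINT x:\<Omega>|leb d. v x * \<phi> x))"

definition L2_weak_gradients ::
    "nat \<Rightarrow> point set \<Rightarrow> (point \<Rightarrow> real) \<Rightarrow> (nat \<Rightarrow> point \<Rightarrow> real) set" where
  "L2_weak_gradients d \<Omega> u = {g. \<forall>i<d. g i \<in> L2 d \<Omega> \<and> weak_partial d \<Omega> i u (g i)}"

definition H1 :: "nat \<Rightarrow> point set \<Rightarrow> (point \<Rightarrow> real) set" where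
  "H1 d \<Omega> = {u. u \<in> L2 d \<Omega> \<and> L2_weak_gradients d \<Omega> u \<noteq> {}}"

text \<open>
  On an open set the weak gradient is unique up to null sets, so all the values over which the
  infimum ranges coincide; the infimum merely avoids choosing a representative.
\<close>

definition H1_norm :: "nat \<Rightarrow> point set \<Rightarrow> (point \<Rightarrow> real) \<Rightarrow> real" where
  "H1_norm d \<Omega> u =
     (INF g\<in>L2_weak_gradients d \<Omega> u.
        sqrt ((LINT x:\<Omega>|leb d. (u x)\<^sup>2) + (\<Sum>i<d. LINT x:\<Omega>|leb d. (g i x)\<^sup>2)))"


section \<open>Two-layer ReLU networks\<close>

definition relu :: "real \<Rightarrow> real" where
  "relu z = max 0 z"

definition relu_networks :: "nat \<Rightarrow> nat \<Rightarrow> real \<Rightarrow> (point \<Rightarrow> real) set" where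
  "relu_networks d m B =
     {\<lambda>x. \<Sum>i<m. \<gamma> i * relu (dot d (\<omega> i) x + t i) | \<gamma> \<omega> t.
        (\<forall>i<m. \<omega> i \<in> Rn d \<and> norm1 d (\<omega> i) = 1 \<and> t i \<in> {-1..<1}) \<and> (\<Sum>i<m. \<bar>\<gamma> i\<bar>) \<le> B}"

end

theory Submission
  imports Defs "HOL-Probability.Probability"
begin

text \<open>
  Fourier inversion and Taylor's formula with integral remainder write \<open>f\<close>, on the cube, as an affine
  function plus a mixture of ReLU units \<open>relu (w \<bullet> x + t)\<close> with \<open>\<bar>w\<bar>\<^sub>1 = 1\<close> and \<open>-1 \<le> t \<le> 0\<close>; the affine
  part is reproduced exactly by four units.  The mixture is approximated by stratified sampling:
  when the parameters are split into at most \<open>m / 4\<close> cells of \<open>H\<^sup>1\<close> diameter \<open>D\<close>, some choice of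
  \<open>O(m)\<close> units has an error of order \<open>D / sqrt m\<close>.

  It remains to find such cells with \<open>D = O(m powr (- 1 / (3 * d)))\<close>, uniformly in \<open>d\<close>.  Quantizing the
  partial sums of \<open>\<bar>w i\<bar>\<close> with step \<open>\<delta> / d\<close> costs at most \<open>(C / \<delta>) ^ d\<close> cells, and two parameters in a cell
  are at Euclidean distance \<open>O(\<delta> / sqrt d) = O(\<delta> * \<bar>w\<bar>\<^sub>2)\<close>.  The gradients of two units differ
  essentially where their arguments have opposite signs.  That event has probability
  \<open>O(\<eta> / \<bar>w\<bar>\<^sub>2)\<close> for the slab \<open>\<bar>w \<bullet> x + t\<bar> \<le> \<eta>\<close>, because the density of a marginal of the uniform
  distribution on the cube is bounded independently of \<open>d\<close>, plus a Chebyshev term; the optimal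
  \<open>\<eta> = \<bar>w\<bar>\<^sub>2 * \<delta> powr (2 / 3)\<close> gives \<open>D\<^sup>2 = O(\<delta> powr (2 / 3))\<close>.
\<close>

section \<open>Stratified sampling\<close>

text \<open>Uniformity in \<open>d\<close> decides every construction. A factor \<open>C ^ d\<close>
  in the number of cells is harmless, because only its \<open>d\<close>-th root enters the
  admissible \<open>\<delta>\<close>; a factor \<open>d ^ d\<close> would put a power of
  \<open>d\<close> into the rate. Quantizing each coordinate separately with step
  \<open>\<delta> / d\<close> allows about \<open>(d / \<delta>) ^ d\<close> values, and it is the
  ordering of the partial sums that supplies a factor of the size of \<open>1 / fact d\<close> and
  removes \<open>d ^ d\<close>. The bounded marginal density comes from a dichotomy: either one
  coordinate of the unit normal dominates and integrating along it suffices, or the characteristic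
  function decays like \<open>1 / \<xi>\<^sup>2\<close> and is integrable with a constant free of
  \<open>d\<close>. The constant 5 of the network class is 4 from the representation times 5/4: the
  infimum in the Barron norm need not be attained, so an extension within the factor 5/4 is used.
  That extension is merely integrable, so inversion is proved almost everywhere, by integrating over
  boxes.\<close>

lemma (in prob_space) square_expectation_le:
  fixes X :: "'a \<Rightarrow> real"
  assumes "integrable M X" "integrable M (\<lambda>x. (X x)\<^sup>2)"
  shows "(expectation X)\<^sup>2 \<le> expectation (\<lambda>x. (X x)\<^sup>2)"
  using variance_eq[OF assms] variance_positive[of X] by linarith

text \<open>One sample is appended to the error \<open>R\<close> already made. When the square is
  expanded, the cross term has mean zero over \<pi>, so some admissible parameter makes it
  nonpositive, and the remaining quadratic term is controlled by the diameter of \<open>S\<close>.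
  Choosing the samples one at a time in this way replaces a probability space that carries all of
  them.\<close>

lemma maurey_step:
  fixes K :: "'i \<Rightarrow> 't \<Rightarrow> 'x \<Rightarrow> real"
  assumes "prob_space \<pi>" "finite_measure M" "finite I"
    and K[measurable]: "\<And>i. (\<lambda>(\<theta>, x). K i \<theta> x) \<in> borel_measurable (\<pi> \<Otimes>\<^sub>M M)"
    and KB: "\<And>i \<theta> x. \<bar>K i \<theta> x\<bar> \<le> B"
    and S: "AE \<theta> in \<pi>. \<theta> \<in> S"
    and diam: "\<And>\<theta> \<theta>'. \<theta> \<in> S \<Longrightarrow> \<theta>' \<in> S \<Longrightarrow> (\<Sum>i\<in>I. LINT x|M. (K i \<theta> x - K i \<theta>' x)\<^sup>2) \<le> D"
    and R[measurable]: "\<And>i. R i \<in> borel_measurable M" and RB: "\<And>i x. \<bar>R i x\<bar> \<le> C"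
    and a: "a \<ge> 0"
  shows "\<exists>\<theta>\<in>S \<inter> space \<pi>. (\<Sum>i\<in>I. LINT x|M. (R i x + a * ((LINT \<theta>'|\<pi>. K i \<theta>' x) - K i \<theta> x))\<^sup>2)
           \<le> (\<Sum>i\<in>I. LINT x|M. (R i x)\<^sup>2) + a\<^sup>2 * D"
proof -
  interpret \<pi>: prob_space \<pi> by fact
  interpret M: finite_measure M by fact
  interpret PM: pair_sigma_finite \<pi> M ..
  interpret PM': finite_measure "\<pi> \<Otimes>\<^sub>M M"
    by (rule finite_measure_pair_measure) unfold_locales
  define h where "h i x = (LINT \<theta>'|\<pi>. K i \<theta>' x)" for i x
  have K1[measurable]: "(\<lambda>x. K i \<theta> x) \<in> borel_measurable M" if "\<theta> \<in> space \<pi>" for i \<theta>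
    using measurable_compose[OF measurable_Pair1'[OF that] K] by simp
  have K2[measurable]: "(\<lambda>\<theta>. K i \<theta> x) \<in> borel_measurable \<pi>" if "x \<in> space M" for i x
    using measurable_compose[OF measurable_Pair2'[OF that] K] by simp
  have Ksw[measurable]: "(\<lambda>(x, \<theta>). K i \<theta> x) \<in> borel_measurable (M \<Otimes>\<^sub>M \<pi>)" for i
    by measurable
  have h[measurable]: "h i \<in> borel_measurable M" for i
    unfolding h_def by measurable
  have B0: "0 \<le> B" using KB order_trans abs_ge_zero by meson
  have iK: "integrable \<pi> (\<lambda>\<theta>. K i \<theta> x)" if "x \<in> space M" for i x
    by (rule \<pi>.integrable_const_bound[where B=B]) (use KB that in auto)
  have hB: "\<bar>h i x\<bar> \<le> B" if "x \<in> space M" for i x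
  proof -
    have "\<bar>h i x\<bar> \<le> (LINT \<theta>|\<pi>. \<bar>K i \<theta> x\<bar>)" unfolding h_def by (rule integral_abs_bound)
    also have "\<dots> \<le> B" by (rule \<pi>.integral_le_const) (use iK[OF that] KB in auto)
    finally show ?thesis .
  qed
  \<comment> \<open>The cross term, integrated over \<open>M\<close> and summed over
    \<open>I\<close>: a single parameter has to serve all components at once.\<close>
  define \<Phi> where "\<Phi> \<theta> = (\<Sum>i\<in>I. LINT x|M. R i x * (h i x - K i \<theta> x))" for \<theta>
  have iRK: "integrable (\<pi> \<Otimes>\<^sub>M M) (\<lambda>(\<theta>, x). R i x * (h i x - K i \<theta> x))" for i
  proof (rule PM'.integrable_const_bound[where B="C * (B + B)"])
    show "AE x in \<pi> \<Otimes>\<^sub>M M. norm (case x of (\<theta>, x) \<Rightarrow> R i x * (h i x - K i \<theta> x)) \<le> C * (B + B)"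
    proof (rule AE_I2)
      fix z assume "z \<in> space (\<pi> \<Otimes>\<^sub>M M)"
      then obtain \<theta> x where z: "z = (\<theta>, x)" "x \<in> space M" by (auto simp: space_pair_measure)
      have "\<bar>h i x - K i \<theta> x\<bar> \<le> B + B"
        using hB[OF z(2), of i] KB[of i \<theta> x] by linarith
      then show "norm (case z of (\<theta>, x) \<Rightarrow> R i x * (h i x - K i \<theta> x)) \<le> C * (B + B)"
        using RB[of i x] by (auto simp: z abs_mult intro!: mult_mono)
    qed
  qed measurable
  have i\<Phi>: "integrable \<pi> \<Phi>"
    unfolding \<Phi>_def using PM.integrable_fst[OF iRK] by (intro Bochner_Integration.integrable_sum) simp
  have "(LINT \<theta>|\<pi>. \<Phi> \<theta>) = (\<Sum>i\<in>I. LINT \<theta>|\<pi>. LINT x|M. R i x * (h i x - K i \<theta> x))"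
    unfolding \<Phi>_def using PM.integrable_fst[OF iRK] by (intro Bochner_Integration.integral_sum) simp
  also have "\<dots> = (\<Sum>i\<in>I. LINT x|M. LINT \<theta>|\<pi>. R i x * (h i x - K i \<theta> x))"
    using PM.Fubini_integral[of "\<lambda>\<theta> x. R _ x * (h _ x - K _ \<theta> x)"] iRK by (intro sum.cong refl) (simp add: split_beta')
  also have "\<dots> = (\<Sum>i\<in>I. LINT x|M. 0)"
    using iK by (intro sum.cong refl Bochner_Integration.integral_cong) (auto simp: h_def \<pi>.prob_space)
  finally have z: "(LINT \<theta>|\<pi>. \<Phi> \<theta>) = 0" by simp
  \<comment> \<open>A function of mean zero that is positive almost everywhere would also vanish
    almost everywhere; \<open>S\<close> has full measure, so positivity on \<open>S\<close> is
    enough for the contradiction.\<close>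
  have "\<exists>\<theta>\<in>S \<inter> space \<pi>. \<Phi> \<theta> \<le> 0"
  proof (rule ccontr)
    assume "\<not> ?thesis"
    then have p: "\<And>\<theta>. \<theta> \<in> S \<Longrightarrow> \<theta> \<in> space \<pi> \<Longrightarrow> \<Phi> \<theta> > 0" by force
    have "AE \<theta> in \<pi>. \<Phi> \<theta> > 0" using S AE_space by eventually_elim (use p in auto)
    moreover from this have "AE \<theta> in \<pi>. \<Phi> \<theta> = 0"
      by (subst integral_nonneg_eq_0_iff_AE[OF i\<Phi>, symmetric]) (use z in auto)
    ultimately have "AE \<theta> in \<pi>. False" by eventually_elim simp
    then show False by simp
  qed
  then obtain \<theta> where \<theta>: "\<theta> \<in> S" "\<theta> \<in> space \<pi>" "\<Phi> \<theta> \<le> 0" by auto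
  have iM: "integrable M f" if "f \<in> borel_measurable M" "\<And>x. x \<in> space M \<Longrightarrow> \<bar>f x\<bar> \<le> c" for f :: "'x \<Rightarrow> real" and c
    by (rule M.integrable_const_bound[where B=c]) (use that in auto)
  have mb: "\<bar>u * v\<bar> \<le> p * q" if "\<bar>u\<bar> \<le> p" "\<bar>v\<bar> \<le> q" for u v p q :: real
    using that by (auto simp: abs_mult intro!: mult_mono)
  have sqb: "\<bar>u\<^sup>2\<bar> \<le> p * p" if "\<bar>u\<bar> \<le> p" for u p :: real
    unfolding power2_eq_square using that by (intro mb)
  have hKB: "\<bar>h i x - K i \<theta> x\<bar> \<le> B + B" if "x \<in> space M" for i x \<theta>
    using hB[OF that, of i] KB[of i \<theta> x] by linarith
  have KKB: "\<bar>K i \<theta>' x - K i \<theta> x\<bar> \<le> B + B" for i x \<theta> \<theta>'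
    using KB[of i \<theta>' x] KB[of i \<theta> x] by linarith
  have i1: "integrable M (\<lambda>x. (R i x)\<^sup>2)" for i
    by (rule iM[of _ "C * C"]) (use RB in \<open>auto intro!: sqb[unfolded abs_power2] AE_I2\<close>)
  have i2: "integrable M (\<lambda>x. R i x * (h i x - K i \<theta> x))" for i
    by (rule iM[of _ "C * (B + B)"]) (use RB hKB \<theta> in \<open>auto intro!: mb\<close>)
  have i3: "integrable M (\<lambda>x. (h i x - K i \<theta> x)\<^sup>2)" for i
  proof (rule iM)
    show "(\<lambda>x. (h i x - K i \<theta> x)\<^sup>2) \<in> borel_measurable M" using \<theta> by measurable
    show "\<bar>(h i x - K i \<theta> x)\<^sup>2\<bar> \<le> (B + B) * (B + B)" if "x \<in> space M" for x
      using that by (intro sqb hKB)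
  qed
  have iKK: "integrable (\<pi> \<Otimes>\<^sub>M M) (\<lambda>(\<theta>', x). (K i \<theta>' x - K i \<theta> x)\<^sup>2)" for i
  proof (rule PM'.integrable_const_bound[where B="(B + B) * (B + B)"])
    have [measurable]: "(\<lambda>z. K i \<theta> (snd z)) \<in> borel_measurable (\<pi> \<Otimes>\<^sub>M M)"
      by (rule measurable_compose[OF measurable_snd K1[OF \<theta>(2)]])
    show "(\<lambda>(\<theta>', x). (K i \<theta>' x - K i \<theta> x)\<^sup>2) \<in> borel_measurable (\<pi> \<Otimes>\<^sub>M M)"
      unfolding split_beta' by measurable
    show "AE z in \<pi> \<Otimes>\<^sub>M M. norm (case z of (\<theta>', x) \<Rightarrow> (K i \<theta>' x - K i \<theta> x)\<^sup>2) \<le> (B + B) * (B + B)"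
      unfolding split_beta' real_norm_def by (intro AE_I2 sqb KKB)
  qed
  \<comment> \<open>Jensen's inequality bounds the centred square by the mean of the pairwise
    squares, and \<open>diam\<close> speaks of pairwise differences.\<close>
  have pt: "(h i x - K i \<theta> x)\<^sup>2 \<le> (LINT \<theta>'|\<pi>. (K i \<theta>' x - K i \<theta> x)\<^sup>2)" if x: "x \<in> space M" for i x
  proof -
    have "h i x - K i \<theta> x = (LINT \<theta>'|\<pi>. K i \<theta>' x - K i \<theta> x)"
      using iK[OF x] by (simp add: h_def \<pi>.prob_space)
    moreover have "integrable \<pi> (\<lambda>\<theta>'. (K i \<theta>' x - K i \<theta> x)\<^sup>2)"
    proof (rule \<pi>.integrable_const_bound)
      show "AE \<theta>' in \<pi>. norm ((K i \<theta>' x - K i \<theta> x)\<^sup>2) \<le> (B + B) * (B + B)"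
        unfolding real_norm_def by (intro AE_I2 sqb KKB)
    qed (use x in measurable)
    ultimately show ?thesis
      using \<pi>.square_expectation_le[of "\<lambda>\<theta>'. K i \<theta>' x - K i \<theta> x"] iK[OF x] by simp
  qed
  have "(\<Sum>i\<in>I. LINT x|M. (h i x - K i \<theta> x)\<^sup>2) \<le> (\<Sum>i\<in>I. LINT x|M. LINT \<theta>'|\<pi>. (K i \<theta>' x - K i \<theta> x)\<^sup>2)"
    using pt i3 PM.integrable_snd[OF iKK] by (intro sum_mono integral_mono) auto
  also have "\<dots> = (\<Sum>i\<in>I. LINT \<theta>'|\<pi>. LINT x|M. (K i \<theta>' x - K i \<theta> x)\<^sup>2)"
    using PM.Fubini_integral[OF iKK] by simp
  also have "\<dots> = (LINT \<theta>'|\<pi>. (\<Sum>i\<in>I. LINT x|M. (K i \<theta>' x - K i \<theta> x)\<^sup>2))"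
    using PM.integrable_fst[OF iKK] by (intro Bochner_Integration.integral_sum[symmetric]) simp
  also have "\<dots> \<le> D"
  proof (rule \<pi>.integral_le_const)
    show "integrable \<pi> (\<lambda>\<theta>'. \<Sum>i\<in>I. LINT x|M. (K i \<theta>' x - K i \<theta> x)\<^sup>2)"
      using PM.integrable_fst[OF iKK] by (intro Bochner_Integration.integrable_sum) simp
    show "AE \<theta>' in \<pi>. (\<Sum>i\<in>I. LINT x|M. (K i \<theta>' x - K i \<theta> x)\<^sup>2) \<le> D"
      using S by eventually_elim (use diam \<theta> in auto)
  qed
  finally have v: "(\<Sum>i\<in>I. LINT x|M. (h i x - K i \<theta> x)\<^sup>2) \<le> D" .
  have "(\<Sum>i\<in>I. LINT x|M. (R i x + a * (h i x - K i \<theta> x))\<^sup>2)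
     = (\<Sum>i\<in>I. (LINT x|M. (R i x)\<^sup>2) + 2 * a * (LINT x|M. R i x * (h i x - K i \<theta> x))
          + a\<^sup>2 * (LINT x|M. (h i x - K i \<theta> x)\<^sup>2))"
  proof (rule sum.cong[OF refl])
    fix i
    have "(LINT x|M. (R i x + a * (h i x - K i \<theta> x))\<^sup>2)
      = (LINT x|M. (R i x)\<^sup>2 + 2 * a * (R i x * (h i x - K i \<theta> x)) + a\<^sup>2 * (h i x - K i \<theta> x)\<^sup>2)"
      by (rule Bochner_Integration.integral_cong) (auto simp: power2_eq_square algebra_simps)
    also have "\<dots> = (LINT x|M. (R i x)\<^sup>2) + 2 * a * (LINT x|M. R i x * (h i x - K i \<theta> x))
          + a\<^sup>2 * (LINT x|M. (h i x - K i \<theta> x)\<^sup>2)"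
      using i1[of i] i2[of i] i3[of i] by simp
    finally show "(LINT x|M. (R i x + a * (h i x - K i \<theta> x))\<^sup>2) = \<dots>" .
  qed
  also have "\<dots> = (\<Sum>i\<in>I. LINT x|M. (R i x)\<^sup>2) + 2 * a * \<Phi> \<theta> + a\<^sup>2 * (\<Sum>i\<in>I. LINT x|M. (h i x - K i \<theta> x)\<^sup>2)"
    by (simp add: sum.distrib sum_distrib_left \<Phi>_def)
  also have "\<dots> \<le> (\<Sum>i\<in>I. LINT x|M. (R i x)\<^sup>2) + 0 + a\<^sup>2 * D"
    using \<theta> v a by (intro add_mono mult_left_mono) (auto simp: mult_nonneg_nonpos)
  finally show ?thesis using \<theta> by (intro bexI[of _ \<theta>]) (auto simp: h_def)
qed

text \<open>Induction on \<open>T\<close>, with the error of the earlier indices as the residual.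
  Since the cross terms are removed one after the other, the variances simply add, as they would for
  independent samples; the distribution may change from index to index.\<close>

lemma maurey_independent:
  fixes K :: "'i \<Rightarrow> 't \<Rightarrow> 'x \<Rightarrow> real"
  assumes "finite_measure M" "finite I" "finite T"
    and \<pi>: "\<And>t. t \<in> T \<Longrightarrow> prob_space (\<pi> t)"
    and K: "\<And>i t. t \<in> T \<Longrightarrow> (\<lambda>(\<theta>, x). K i \<theta> x) \<in> borel_measurable (\<pi> t \<Otimes>\<^sub>M M)"
    and KB: "\<And>i \<theta> x. \<bar>K i \<theta> x\<bar> \<le> B"
    and S: "\<And>t. t \<in> T \<Longrightarrow> AE \<theta> in \<pi> t. \<theta> \<in> S t"
    and diam: "\<And>t \<theta> \<theta>'. t \<in> T \<Longrightarrow> \<theta> \<in> S t \<Longrightarrow> \<theta>' \<in> S t \<Longrightarrow> (\<Sum>i\<in>I. LINT x|M. (K i \<theta> x - K i \<theta>' x)\<^sup>2) \<le> D"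
    and a: "\<And>t. a t \<ge> 0"
  shows "\<exists>\<theta>. (\<forall>t\<in>T. \<theta> t \<in> S t \<inter> space (\<pi> t)) \<and>
     (\<Sum>i\<in>I. LINT x|M. (\<Sum>t\<in>T. a t * ((LINT \<theta>'|\<pi> t. K i \<theta>' x) - K i (\<theta> t) x))\<^sup>2) \<le> (\<Sum>t\<in>T. (a t)\<^sup>2 * D)"
  using assms(3) \<pi> K S diam
proof (induction T rule: finite_induct)
  case empty
  then show ?case by simp
next
  case (insert t T)
  have "\<exists>\<theta>. (\<forall>t\<in>T. \<theta> t \<in> S t \<inter> space (\<pi> t)) \<and>
     (\<Sum>i\<in>I. LINT x|M. (\<Sum>t\<in>T. a t * ((LINT \<theta>'|\<pi> t. K i \<theta>' x) - K i (\<theta> t) x))\<^sup>2) \<le> (\<Sum>t\<in>T. (a t)\<^sup>2 * D)"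
    by (rule insert.IH; (rule insert.prems)?) (use insert.prems(2-4) in \<open>auto\<close>)
  then obtain \<theta> where \<theta>: "\<forall>s\<in>T. \<theta> s \<in> S s \<inter> space (\<pi> s)"
     "(\<Sum>i\<in>I. LINT x|M. (\<Sum>t\<in>T. a t * ((LINT \<theta>'|\<pi> t. K i \<theta>' x) - K i (\<theta> t) x))\<^sup>2) \<le> (\<Sum>t\<in>T. (a t)\<^sup>2 * D)"
    by (elim exE conjE)
  define R where "R i x = (\<Sum>t\<in>T. a t * ((LINT \<theta>'|\<pi> t. K i \<theta>' x) - K i (\<theta> t) x))" for i x
  interpret prob_space "\<pi> t" using insert by simp
  have Rm: "R i \<in> borel_measurable M" for i
    unfolding R_def
  proof (intro borel_measurable_sum borel_measurable_times borel_measurable_diff borel_measurable_const)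
    fix s assume s: "s \<in> T"
    then interpret s: prob_space "\<pi> s" using insert by simp
    have [measurable]: "(\<lambda>(\<theta>, x). K i \<theta> x) \<in> borel_measurable (\<pi> s \<Otimes>\<^sub>M M)" using insert s by simp
    show "(\<lambda>x. LINT \<theta>'|\<pi> s. K i \<theta>' x) \<in> borel_measurable M" by measurable
    have "\<theta> s \<in> space (\<pi> s)" using \<theta> s by auto
    from measurable_compose[OF measurable_Pair1'[OF this] insert.prems(2)[of s i]] s
    show "K i (\<theta> s) \<in> borel_measurable M" by simp
  qed
  have B0: "0 \<le> B" using KB order_trans abs_ge_zero by meson
  have RB: "\<bar>R i x\<bar> \<le> (\<Sum>t\<in>T. a t * (B + B))" for i x
    unfolding R_def
  proof (rule order_trans[OF sum_abs sum_mono])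
    fix s assume s: "s \<in> T"
    then interpret s: prob_space "\<pi> s" using insert by simp
    \<comment> \<open>\<open>maurey_step\<close> asks for a bound at every \<open>x\<close>, also
      outside \<open>space M\<close>, where measurability in the parameter is unknown; there the
      integral may take its default value 0.\<close>
    have "\<bar>LINT \<theta>'|\<pi> s. K i \<theta>' x\<bar> \<le> B"
    proof (cases "integrable (\<pi> s) (\<lambda>\<theta>'. K i \<theta>' x)")
      case True
      have "\<bar>LINT \<theta>'|\<pi> s. K i \<theta>' x\<bar> \<le> (LINT \<theta>'|\<pi> s. \<bar>K i \<theta>' x\<bar>)" by (rule integral_abs_bound)
      also have "\<dots> \<le> B" using True KB by (intro s.integral_le_const) auto
      finally show ?thesis .
    qed (use B0 in \<open>simp add: not_integrable_integral_eq\<close>)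
    then have "\<bar>(LINT \<theta>'|\<pi> s. K i \<theta>' x) - K i (\<theta> s) x\<bar> \<le> B + B" using KB[of i "\<theta> s" x] by linarith
    then show "\<bar>a s * ((LINT \<theta>'|\<pi> s. K i \<theta>' x) - K i (\<theta> s) x)\<bar> \<le> a s * (B + B)"
      using a[of s] by (auto simp: abs_mult intro!: mult_mono)
  qed
  have "\<exists>\<theta>\<in>S t \<inter> space (\<pi> t). (\<Sum>i\<in>I. LINT x|M. (R i x + a t * ((LINT \<theta>'|\<pi> t. K i \<theta>' x) - K i \<theta> x))\<^sup>2)
           \<le> (\<Sum>i\<in>I. LINT x|M. (R i x)\<^sup>2) + (a t)\<^sup>2 * D"
  proof (rule maurey_step[OF prob_space_axioms assms(1,2) _ KB _ _ Rm RB a])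
    show "\<And>i. (\<lambda>(\<theta>, x). K i \<theta> x) \<in> borel_measurable (\<pi> t \<Otimes>\<^sub>M M)" using insert.prems(2)[of t] by simp
    show "AE \<theta> in \<pi> t. \<theta> \<in> S t" using insert.prems(3)[of t] by simp
    show "\<And>\<theta> \<theta>'. \<theta> \<in> S t \<Longrightarrow> \<theta>' \<in> S t \<Longrightarrow> (\<Sum>i\<in>I. LINT x|M. (K i \<theta> x - K i \<theta>' x)\<^sup>2) \<le> D"
      using insert.prems(4)[of t] by simp
  qed
  then obtain \<theta>t where t: "\<theta>t \<in> S t \<inter> space (\<pi> t)"
    "(\<Sum>i\<in>I. LINT x|M. (R i x + a t * ((LINT \<theta>'|\<pi> t. K i \<theta>' x) - K i \<theta>t x))\<^sup>2)
           \<le> (\<Sum>i\<in>I. LINT x|M. (R i x)\<^sup>2) + (a t)\<^sup>2 * D" ..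
  have eq: "(\<Sum>s\<in>insert t T. a s * ((LINT \<theta>'|\<pi> s. K i \<theta>' x) - K i ((\<theta>(t := \<theta>t)) s) x))
      = R i x + a t * ((LINT \<theta>'|\<pi> t. K i \<theta>' x) - K i \<theta>t x)" for i x
  proof -
    have "(\<Sum>s\<in>T. a s * ((LINT \<theta>'|\<pi> s. K i \<theta>' x) - K i ((\<theta>(t := \<theta>t)) s) x)) = R i x"
      unfolding R_def using insert by (intro sum.cong) auto
    then show ?thesis using insert by (simp add: add.commute)
  qed
  show ?case
  proof (intro exI[of _ "\<theta>(t := \<theta>t)"] conjI)
    show "\<forall>s\<in>insert t T. (\<theta>(t := \<theta>t)) s \<in> S s \<inter> space (\<pi> s)" using \<theta> t by auto
    show "(\<Sum>i\<in>I. LINT x|M. (\<Sum>s\<in>insert t T. a s * ((LINT \<theta>'|\<pi> s. K i \<theta>' x) - K i ((\<theta>(t := \<theta>t)) s) x))\<^sup>2)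
       \<le> (\<Sum>s\<in>insert t T. (a s)\<^sup>2 * D)"
      unfolding eq using t(2) \<theta>(2) insert by (simp add: R_def)
  qed
qed

text \<open>Proportional allocation: a cell of mass \<open>p c\<close> receives about
  \<open>n * p c / W\<close> samples, each of weight \<open>p c / m c\<close>. Only the variation
  inside a cell contributes, so the error carries the cell diameter \<open>D\<close> in place of a
  second moment of the whole mixture. Rounding up costs at most one sample per cell, hence
  \<open>n + card C\<close>.\<close>

lemma stratified_maurey:
  fixes K :: "'i \<Rightarrow> 't \<Rightarrow> 'x \<Rightarrow> real"
  assumes "finite_measure \<nu>" "finite_measure M" "finite I"
    and K[measurable]: "\<And>i. (\<lambda>(\<theta>, x). K i \<theta> x) \<in> borel_measurable (\<nu> \<Otimes>\<^sub>M M)"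
    and KB: "\<And>i \<theta> x. \<bar>K i \<theta> x\<bar> \<le> B"
    and C: "finite C" "\<And>c. c \<in> C \<Longrightarrow> A c \<in> sets \<nu>" "disjoint_family_on A C" "(\<Union>c\<in>C. A c) = space \<nu>"
    and diam: "\<And>c \<theta> \<theta>'. c \<in> C \<Longrightarrow> \<theta> \<in> A c \<Longrightarrow> \<theta>' \<in> A c \<Longrightarrow>
                 (\<Sum>i\<in>I. LINT x|M. (K i \<theta> x - K i \<theta>' x)\<^sup>2) \<le> D"
    and n: "n \<ge> 1" and D: "D \<ge> 0"
  defines "W \<equiv> measure \<nu> (space \<nu>)"
  shows "\<exists>N \<theta> w. N \<le> n + card C \<and> (\<forall>k<N. w k \<ge> 0 \<and> \<theta> k \<in> space \<nu>) \<and> (\<Sum>k<N. w k) = W \<and>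
     (\<Sum>i\<in>I. LINT x|M. ((LINT \<theta>|\<nu>. K i \<theta> x) - (\<Sum>k<N. w k * K i (\<theta> k) x))\<^sup>2) \<le> W\<^sup>2 * D / n"
proof -
  interpret \<nu>: finite_measure \<nu> by fact
  interpret M: finite_measure M by fact
  define p where "p c = measure \<nu> (A c)" for c
  \<comment> \<open>Cells of mass zero are dropped: they have no conditional distribution and
    contribute nothing to the mixture. If \<open>W = 0\<close>, no cell is left.\<close>
  define C' where "C' = {c\<in>C. p c > 0}"
  have fC': "finite C'" using C by (simp add: C'_def)
  have p0: "p c \<ge> 0" for c by (simp add: p_def)
  have pW: "(\<Sum>c\<in>C'. p c) = W"
  proof -
    have "(\<Sum>c\<in>C'. p c) = (\<Sum>c\<in>C. p c)"
      unfolding C'_def using C p0 by (intro sum.mono_neutral_left) (auto simp: not_less antisym)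
    also have "\<dots> = measure \<nu> (\<Union>c\<in>C. A c)"
      unfolding p_def using C by (intro \<nu>.finite_measure_finite_Union[symmetric]) auto
    finally show ?thesis using C by (simp add: W_def)
  qed
  have Wpos: "W > 0" if "c \<in> C'" for c
  proof -
    have "0 < p c" using that by (simp add: C'_def)
    also have "p c \<le> W" unfolding pW[symmetric] using that fC' p0 by (intro member_le_sum) auto
    finally show ?thesis .
  qed
  \<comment> \<open>Rounding up ensures \<open>p c / m c \<le> W / n\<close>, the bound on the
    weights from which the error estimate follows.\<close>
  define m where "m c = nat \<lceil>real n * p c / W\<rceil>" for c
  have m_ge: "real (m c) \<ge> real n * p c / W" for c unfolding m_def by linarith
  have m_le: "real (m c) \<le> real n * p c / W + 1" if "c \<in> C'" for c
  proof -
    have "real n * p c / W \<ge> 0" using p0[of c] Wpos[OF that] by simp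
    then show ?thesis unfolding m_def by linarith
  qed
  have m_pos: "m c > 0" if "c \<in> C'" for c
  proof -
    have "real n * p c / W > 0" using that n Wpos[OF that] by (simp add: C'_def)
    with m_ge[of c] show ?thesis by linarith
  qed
  define T where "T = (SIGMA c:C'. {..<m c})"
  have fT: "finite T" using fC' by (simp add: T_def)
  have cT: "card T \<le> n + card C"
  proof -
    have "real (card T) = (\<Sum>c\<in>C'. real (m c))" using fC' by (simp add: T_def card_SigmaI)
    also have "\<dots> \<le> (\<Sum>c\<in>C'. real n * p c / W + 1)" using m_le by (intro sum_mono) auto
    \<comment> \<open>\<open>W / W\<close> stays unsimplified because it is 0 for
      \<open>W = 0\<close>; in both cases it is at most 1.\<close>
    also have "\<dots> = real n * (W / W) + card C'"
      by (simp add: sum.distrib pW sum_divide_distrib[symmetric] sum_distrib_left[symmetric])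
    also have "\<dots> \<le> real n + card C"
    proof -
      have "card C' \<le> card C" using C by (intro card_mono) (auto simp: C'_def)
      moreover have "real n * (W / W) \<le> n" by simp
      ultimately show ?thesis by linarith
    qed
    finally show ?thesis by linarith
  qed
  \<comment> \<open>The distribution conditioned on a cell. An index \<open>t\<close> is a cell
    together with the number of a sample in it, so all samples of one cell share a
    distribution.\<close>
  define \<pi> where "\<pi> t = density \<nu> (\<lambda>\<theta>. ennreal (indicator (A (fst t)) \<theta> / p (fst t)))" for t :: "'a \<times> nat"
  have Am[measurable]: "A c \<in> sets \<nu>" if "c \<in> C'" for c using that C by (simp add: C'_def)
  have \<pi>s[measurable_cong]: "sets (\<pi> t) = sets \<nu>" and \<pi>sp: "space (\<pi> t) = space \<nu>" for t
    by (auto simp: \<pi>_def)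
  have ints: "(LINT \<theta>|\<pi> t. f \<theta>) = (LINT \<theta>|\<nu>. indicator (A (fst t)) \<theta> * f \<theta>) / p (fst t)"
    if "fst t \<in> C'" "f \<in> borel_measurable \<nu>" for t and f :: "'t \<Rightarrow> real"
  proof -
    note [measurable] = Am[OF that(1)] that(2)
    have "(LINT \<theta>|\<pi> t. f \<theta>) = (LINT \<theta>|\<nu>. indicator (A (fst t)) \<theta> / p (fst t) * f \<theta>)"
      unfolding \<pi>_def using p0 by (subst integral_density) auto
    then show ?thesis by simp
  qed
  have prob: "prob_space (\<pi> t)" if "t \<in> T" for t
  proof
    obtain c k where t: "t = (c, k)" "c \<in> C'" using \<open>t \<in> T\<close> by (auto simp: T_def)
    have pc: "p c > 0" using t by (simp add: C'_def)
    have "emeasure (\<pi> t) (space (\<pi> t)) = (\<integral>\<^sup>+\<theta>. ennreal (indicator (A c) \<theta> / p c) \<partial>\<nu>)"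
      unfolding \<pi>_def using Am[OF t(2)] by (subst emeasure_density) (auto simp: t intro!: nn_integral_cong)
    also have "\<dots> = (\<integral>\<^sup>+\<theta>. ennreal (1 / p c) * indicator (A c) \<theta> \<partial>\<nu>)"
      by (intro nn_integral_cong) (auto simp: indicator_def)
    also have "\<dots> = ennreal (1 / p c) * emeasure \<nu> (A c)"
      using Am[OF t(2)] by (subst nn_integral_cmult_indicator) auto
    also have "\<dots> = 1" using pc by (simp add: \<nu>.emeasure_eq_measure flip: p_def ennreal_mult)
    finally show "emeasure (\<pi> t) (space (\<pi> t)) = 1" .
  qed
  define a where "a t = p (fst t) / real (m (fst t))" for t :: "'a \<times> nat"
  have "\<exists>\<theta>. (\<forall>t\<in>T. \<theta> t \<in> A (fst t) \<inter> space (\<pi> t)) \<and>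
     (\<Sum>i\<in>I. LINT x|M. (\<Sum>t\<in>T. a t * ((LINT \<theta>'|\<pi> t. K i \<theta>' x) - K i (\<theta> t) x))\<^sup>2) \<le> (\<Sum>t\<in>T. (a t)\<^sup>2 * D)"
  proof (rule maurey_independent[OF assms(2,3) fT prob _ KB])
    show "(\<lambda>(\<theta>, x). K i \<theta> x) \<in> borel_measurable (\<pi> t \<Otimes>\<^sub>M M)" for i t by measurable
    show "AE \<theta> in \<pi> t. \<theta> \<in> A (fst t)" if "t \<in> T" for t
    proof -
      have [measurable]: "A (fst t) \<in> sets \<nu>" using that Am by (auto simp: T_def)
      show ?thesis unfolding \<pi>_def by (subst AE_density) (auto simp: indicator_def)
    qed
    show "(\<Sum>i\<in>I. LINT x|M. (K i \<theta> x - K i \<theta>' x)\<^sup>2) \<le> D"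
      if "t \<in> T" "\<theta> \<in> A (fst t)" "\<theta>' \<in> A (fst t)" for t \<theta> \<theta>'
      using that by (intro diam[of "fst t"]) (auto simp: T_def C'_def)
    show "a t \<ge> 0" for t using p0 by (simp add: a_def)
  qed
  then obtain \<theta> where \<theta>: "\<forall>t\<in>T. \<theta> t \<in> A (fst t) \<inter> space (\<pi> t)"
     "(\<Sum>i\<in>I. LINT x|M. (\<Sum>t\<in>T. a t * ((LINT \<theta>'|\<pi> t. K i \<theta>' x) - K i (\<theta> t) x))\<^sup>2) \<le> (\<Sum>t\<in>T. (a t)\<^sup>2 * D)"
    by (elim exE conjE)
  have sumT: "(\<Sum>t\<in>T. a t * f (fst t)) = (\<Sum>c\<in>C'. p c * f c)" for f :: "'a \<Rightarrow> real"
  proof -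
    have "(\<Sum>t\<in>T. a t * f (fst t)) = (\<Sum>c\<in>C'. \<Sum>k<m c. p c / m c * f c)"
      unfolding T_def a_def using fC' by (subst sum.Sigma) (auto intro!: sum.cong)
    also have "\<dots> = (\<Sum>c\<in>C'. p c * f c)"
      using m_pos by (intro sum.cong) auto
    finally show ?thesis .
  qed
  have mean: "(\<Sum>t\<in>T. a t * (LINT \<theta>'|\<pi> t. K i \<theta>' x)) = (LINT \<theta>|\<nu>. K i \<theta> x)" if x: "x \<in> space M" for i x
  proof -
    have Kx[measurable]: "(\<lambda>\<theta>. K i \<theta> x) \<in> borel_measurable \<nu>"
      using measurable_compose[OF measurable_Pair2'[OF x] K] by simp
    have iK: "integrable \<nu> (\<lambda>\<theta>. indicator (A c) \<theta> * K i \<theta> x)" if "c \<in> C" for c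
    proof (rule \<nu>.integrable_const_bound)
      have [measurable]: "A c \<in> sets \<nu>" using C that by auto
      show "(\<lambda>\<theta>. indicator (A c) \<theta> * K i \<theta> x) \<in> borel_measurable \<nu>" by measurable
      show "AE \<theta> in \<nu>. norm (indicator (A c) \<theta> * K i \<theta> x) \<le> B"
        using KB order_trans[OF abs_ge_zero KB] by (intro AE_I2) (auto simp: indicator_def)
    qed
    have "(\<Sum>t\<in>T. a t * (LINT \<theta>'|\<pi> t. K i \<theta>' x))
        = (\<Sum>t\<in>T. a t * ((LINT \<theta>|\<nu>. indicator (A (fst t)) \<theta> * K i \<theta> x) / p (fst t)))"
      by (intro sum.cong refl) (subst ints, auto simp: T_def)
    also have "\<dots> = (\<Sum>c\<in>C'. LINT \<theta>|\<nu>. indicator (A c) \<theta> * K i \<theta> x)"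
      unfolding sumT[of "\<lambda>c. (LINT \<theta>|\<nu>. indicator (A c) \<theta> * K i \<theta> x) / p c"]
      by (intro sum.cong) (auto simp: C'_def)
    also have "\<dots> = (\<Sum>c\<in>C. LINT \<theta>|\<nu>. indicator (A c) \<theta> * K i \<theta> x)"
    proof (rule sum.mono_neutral_left)
      show "\<forall>c\<in>C - C'. (LINT \<theta>|\<nu>. indicator (A c) \<theta> * K i \<theta> x) = 0"
      proof
        fix c assume c: "c \<in> C - C'"
        then have "p c = 0" using p0[of c] by (auto simp: C'_def)
        then have "emeasure \<nu> (A c) = 0" by (simp add: p_def \<nu>.emeasure_eq_measure)
        then have "A c \<in> null_sets \<nu>" using c C by (auto simp: null_sets_def)
        then have "AE \<theta> in \<nu>. indicator (A c) \<theta> * K i \<theta> x = 0"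
          by (rule AE_mp[OF AE_not_in]) (auto simp: indicator_def)
        then show "(LINT \<theta>|\<nu>. indicator (A c) \<theta> * K i \<theta> x) = 0" by (rule integral_eq_zero_AE)
      qed
    qed (use C in \<open>auto simp: C'_def\<close>)
    also have "\<dots> = (LINT \<theta>|\<nu>. (\<Sum>c\<in>C. indicator (A c) \<theta> * K i \<theta> x))"
      using iK by (intro Bochner_Integration.integral_sum[symmetric]) auto
    also have "\<dots> = (LINT \<theta>|\<nu>. K i \<theta> x)"
    proof (rule Bochner_Integration.integral_cong[OF refl])
      fix \<theta> assume "\<theta> \<in> space \<nu>"
      have "(\<Sum>c\<in>C. indicator (A c) \<theta> * K i \<theta> x) = indicator (\<Union>c\<in>C. A c) \<theta> * K i \<theta> x"
        using C by (subst indicator_UN_disjoint) (auto simp: sum_distrib_right)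
      then show "(\<Sum>c\<in>C. indicator (A c) \<theta> * K i \<theta> x) = K i \<theta> x"
        using C \<open>\<theta> \<in> space \<nu>\<close> by simp
    qed
    finally show ?thesis .
  qed
  have err: "(\<Sum>t\<in>T. (a t)\<^sup>2 * D) \<le> W\<^sup>2 * D / n"
  proof -
    have "(\<Sum>t\<in>T. (a t)\<^sup>2 * D) = (\<Sum>t\<in>T. a t * (p (fst t) / m (fst t) * D))"
      by (simp add: a_def power2_eq_square mult.assoc)
    also have "\<dots> = (\<Sum>c\<in>C'. p c * (p c / m c * D))" by (rule sumT)
    also have "\<dots> \<le> (\<Sum>c\<in>C'. p c * (W / n * D))"
    proof (intro sum_mono mult_left_mono mult_right_mono)
      fix c assume c: "c \<in> C'"
      have "real n * p c \<le> m c * W" using m_ge[of c] Wpos[OF c] by (simp add: field_simps)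
      then show "p c / m c \<le> W / n" using m_pos[OF c] n by (simp add: field_simps)
    qed (use D p0 in auto)
    also have "\<dots> = (\<Sum>c\<in>C'. p c) * (W / n * D)" by (rule sum_distrib_right[symmetric])
    also have "\<dots> = W\<^sup>2 * D / n" by (simp add: pW power2_eq_square)
    finally show ?thesis .
  qed
  obtain e where e: "bij_betw e {..<card T} T"
    using fT ex_bij_betw_nat_finite atLeast0LessThan by metis
  show ?thesis
  proof (intro exI conjI)
    show "card T \<le> n + card C" by (rule cT)
    show "\<forall>k<card T. a (e k) \<ge> 0 \<and> \<theta> (e k) \<in> space \<nu>"
      using \<theta>(1) bij_betwE[OF e] p0 by (auto simp: a_def \<pi>sp)
    have re: "(\<Sum>k<card T. f (e k)) = (\<Sum>t\<in>T. f t)" for f :: "'a \<times> nat \<Rightarrow> real"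
      using sum.reindex_bij_betw[OF e] .
    show "(\<Sum>k<card T. a (e k)) = W"
      using sumT[of "\<lambda>_. 1"] by (simp add: re pW)
    have "(\<Sum>i\<in>I. LINT x|M. ((LINT \<theta>|\<nu>. K i \<theta> x) - (\<Sum>k<card T. a (e k) * K i (\<theta> (e k)) x))\<^sup>2)
      = (\<Sum>i\<in>I. LINT x|M. (\<Sum>t\<in>T. a t * ((LINT \<theta>'|\<pi> t. K i \<theta>' x) - K i (\<theta> t) x))\<^sup>2)"
    proof (intro sum.cong refl Bochner_Integration.integral_cong)
      fix i x assume "x \<in> space M"
      then show "((LINT \<theta>|\<nu>. K i \<theta> x) - (\<Sum>k<card T. a (e k) * K i (\<theta> (e k)) x))\<^sup>2
          = (\<Sum>t\<in>T. a t * ((LINT \<theta>'|\<pi> t. K i \<theta>' x) - K i (\<theta> t) x))\<^sup>2"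
        unfolding re[of "\<lambda>t. a t * K i (\<theta> t) x"]
        by (subst mean[symmetric]) (auto simp: right_diff_distrib sum_subtractf)
    qed
    also have "\<dots> \<le> W\<^sup>2 * D / n" using \<theta>(2) err by linarith
    finally show "(\<Sum>i\<in>I. LINT x|M. ((LINT \<theta>|\<nu>. K i \<theta> x) - (\<Sum>k<card T. a (e k) * K i (\<theta> (e k)) x))\<^sup>2) \<le> W\<^sup>2 * D / n" .
  qed
qed

section \<open>The uniform distribution on the cube\<close>

abbreviation lborel_pow :: "nat \<Rightarrow> point measure" where
  "lborel_pow d \<equiv> \<Pi>\<^sub>M i\<in>{..<d}. (lborel :: real measure)"

definition unif :: "real measure" where
  "unif = density lborel (indicator {0<..<1})"

text \<open>Built without completion, because Fubini and joint measurability are used throughout.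
  The completed measure \<open>leb d\<close> enters only at the two ends, in the Barron norm and in
  the Sobolev norm.\<close>

definition unif_cube :: "nat \<Rightarrow> point measure" where
  "unif_cube d = (\<Pi>\<^sub>M i\<in>{..<d}. unif)"

interpretation lbp: product_sigma_finite "\<lambda>_::nat. lborel :: real measure" ..

lemma lborel_pow_component: "i \<in> {..<d} \<Longrightarrow> (\<lambda>x. x i) \<in> borel_measurable (lborel_pow d)"
  using measurable_component_singleton[of i "{..<d}" "\<lambda>_. lborel :: real measure"] by simp

lemma sets_unif[measurable_cong, simp]: "sets unif = sets borel"
  and space_unif[simp]: "space unif = UNIV"
  by (auto simp: unif_def)

lemma prob_space_unif: "prob_space unif"
  by standard (simp add: unif_def emeasure_density)

interpretation unif: prob_space unif by (rule prob_space_unif)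
lemma prob_unif_UNIV[simp]: "unif.prob UNIV = 1"
  using unif.prob_space by simp

interpretation unifs: product_sigma_finite "\<lambda>_::nat. unif" ..

lemma sets_unif_cube: "sets (unif_cube d) = sets (lborel_pow d)"
  unfolding unif_cube_def by (rule sets_PiM_cong) auto

declare sets_unif_cube[measurable_cong, simp]

lemma space_unif_cube[simp]: "space (unif_cube d) = Rn d"
  by (simp add: unif_cube_def Rn_def space_PiM)

lemma space_lborel_pow[simp]: "space (lborel_pow d) = Rn d"
  by (simp add: Rn_def space_PiM)

lemma prob_space_unif_cube: "prob_space (unif_cube d)"
  unfolding unif_cube_def by (rule prob_space_PiM) (rule prob_space_unif)

interpretation unif_cube: prob_space "unif_cube d" for d by (rule prob_space_unif_cube)

lemma prob_unif_cube_Rn[simp]: "unif_cube.prob d (Rn d) = 1"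
  using unif_cube.prob_space[of d] by simp

lemma unit_cube_sets[measurable]: "unit_cube d \<in> sets (lborel_pow d)"
  unfolding unit_cube_def by (rule sets_PiM_I_finite) auto

lemma unit_cube_subset_Rn: "unit_cube d \<subseteq> Rn d"
  by (auto simp: unit_cube_def Rn_def)

lemma unif_cube_eq_density: "unif_cube d = density (lborel_pow d) (indicator (unit_cube d))"
  unfolding unif_cube_def
proof (rule unifs.PiM_eqI[symmetric])
  fix A :: "nat \<Rightarrow> real set" assume "\<And>i. i \<in> {..<d} \<Longrightarrow> A i \<in> sets unif"
  then have A: "\<And>i. i < d \<Longrightarrow> A i \<in> sets borel" by simp
  have "emeasure (density (lborel_pow d) (indicator (unit_cube d))) (Pi\<^sub>E {..<d} A)
      = (\<integral>\<^sup>+x. indicator (unit_cube d) x * indicator (Pi\<^sub>E {..<d} A) x \<partial>lborel_pow d)"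
    using A by (intro emeasure_density) (auto intro!: sets_PiM_I_finite)
  also have "\<dots> = (\<integral>\<^sup>+x. indicator (\<Pi>\<^sub>E i\<in>{..<d}. A i \<inter> {0<..<1}) x \<partial>lborel_pow d)"
    by (intro nn_integral_cong) (auto simp: unit_cube_def indicator_def PiE_iff)
  also have "\<dots> = (\<Prod>i<d. emeasure lborel (A i \<inter> {0<..<1}))"
    using A by (subst nn_integral_indicator) (auto intro!: sets_PiM_I_finite lbp.emeasure_PiM)
  also have "\<dots> = (\<Prod>i<d. emeasure unif (A i))"
    using A by (intro prod.cong refl) (auto simp: unif_def emeasure_density indicator_inter_arith[symmetric] Int_commute)
  finally show "emeasure (density (lborel_pow d) (indicator (unit_cube d))) (Pi\<^sub>E {..<d} A)
      = (\<Prod>i<d. emeasure unif (A i))" .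
next
  show "sets (density (lborel_pow d) (indicator (unit_cube d))) = sets (Pi\<^sub>M {..<d} (\<lambda>i. unif))"
    using sets_unif_cube[of d] by (simp add: unif_cube_def)
qed simp

lemma AE_unif_cube: "AE x in unif_cube d. x \<in> unit_cube d"
  unfolding unif_cube_eq_density by (subst AE_density) (auto simp: indicator_def)

lemma AE_unif: "AE x in unif. x \<in> {0<..<1}"
  unfolding unif_def by (subst AE_density) (auto simp: indicator_def)

lemma integral_unif_cube:
  fixes f :: "point \<Rightarrow> 'b::{banach, second_countable_topology}"
  assumes [measurable]: "f \<in> borel_measurable (lborel_pow d)"
  shows "(LINT x|unif_cube d. f x) = (LINT x:unit_cube d|lborel_pow d. f x)"
proof -
  have "unif_cube d = density (lborel_pow d) (\<lambda>x. ennreal (indicator (unit_cube d) x))"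
    unfolding unif_cube_eq_density by (simp add: ennreal_indicator)
  then show ?thesis
    unfolding set_lebesgue_integral_def by (simp add: integral_density)
qed

text \<open>The end points are null, and the closed interval is the form in which the fundamental
  theorem of calculus is applied below.\<close>

lemma integral_unif:
  fixes f :: "real \<Rightarrow> 'b::{banach, second_countable_topology}"
  assumes [measurable]: "f \<in> borel_measurable borel"
  shows "(LINT x|unif. f x) = (LINT x:{0..1}|lborel. f x)"
proof -
  have "unif = density lborel (\<lambda>x. ennreal (indicator {0<..<1} x))"
    unfolding unif_def by (simp add: ennreal_indicator)
  then have "(LINT x|unif. f x) = (LINT x|density lborel (\<lambda>x. ennreal (indicator {0<..<1} x)). f x)"
    by simp
  also have "\<dots> = (LINT x:{0<..<1}|lborel. f x)"
    unfolding set_lebesgue_integral_def by (subst integral_density) auto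
  also have "\<dots> = (LINT x:{0..1}|lborel. f x)"
    unfolding set_lebesgue_integral_def
  proof (rule integral_cong_AE)
    have "AE x in lborel. x \<noteq> (0::real) \<and> x \<noteq> 1"
      using AE_lborel_singleton[of 0] AE_lborel_singleton[of 1] by eventually_elim auto
    then show "AE x in lborel. indicator {0<..<1} x *\<^sub>R f x = indicator {0..1} x *\<^sub>R f x"
      by eventually_elim (auto simp: indicator_def)
  qed auto
  finally show ?thesis .
qed

lemma integrable_unif_cube_bounded:
  fixes f :: "point \<Rightarrow> 'b::{banach, second_countable_topology}"
  assumes [measurable]: "f \<in> borel_measurable (lborel_pow d)"
    and "\<And>x. x \<in> unit_cube d \<Longrightarrow> norm (f x) \<le> B"
  shows "integrable (unif_cube d) f"
  by (rule unif_cube.integrable_const_bound[where B=B])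
     (use AE_unif_cube[of d] assms(2) in auto)

lemma unit_cube_fun_upd: "x \<in> unit_cube d \<Longrightarrow> i < d \<Longrightarrow> t \<in> {0<..<1} \<Longrightarrow> x(i := t) \<in> unit_cube d"
  by (auto simp: unit_cube_def PiE_iff extensional_def)

lemma measurable_upd[measurable]:
  assumes "i < d"
  shows "(\<lambda>(x, t). x(i := t)) \<in> lborel_pow d \<Otimes>\<^sub>M borel \<rightarrow>\<^sub>M lborel_pow d"
  unfolding split_beta'
  using assms by (intro measurable_fun_upd[where J="{..<d}"]) (auto simp: insert_absorb)

text \<open>The value of \<open>x i\<close> is irrelevant on the right-hand side, which spares a product over
  \<open>{..<d} - {i}\<close>.\<close>

lemma unif_cube_average_coordinate:
  fixes f :: "point \<Rightarrow> real"
  assumes f[measurable]: "f \<in> borel_measurable (lborel_pow d)" and i: "i < d"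
    and B: "\<And>x. x \<in> unit_cube d \<Longrightarrow> \<bar>f x\<bar> \<le> B"
  shows "integrable (unif_cube d) (\<lambda>x. LINT t|unif. f (x(i := t)))"
    and "(LINT x|unif_cube d. f x) = (LINT x|unif_cube d. LINT t|unif. f (x(i := t)))"
proof -
  let ?I = "{..<d} - {i}"
  have ins: "insert i ?I = {..<d}" using i by auto
  let ?g = "\<lambda>x. LINT t|unif. f (x(i := t))"
  have m[measurable]: "(\<lambda>(x, t). f (x(i := t))) \<in> borel_measurable (lborel_pow d \<Otimes>\<^sub>M unif)"
    using measurable_compose[OF measurable_upd[OF i] f] by (simp add: split_beta')
  have g[measurable]: "?g \<in> borel_measurable (lborel_pow d)"
    by measurable
  have gB: "\<bar>?g x\<bar> \<le> B" if x: "x \<in> unit_cube d" for x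
  proof -
    have *: "AE t in unif. \<bar>f (x(i := t))\<bar> \<le> B"
      using AE_unif by eventually_elim (use B unit_cube_fun_upd[OF x i] in auto)
    have xs: "x \<in> space (lborel_pow d)" using x unit_cube_subset_Rn by auto
    have [measurable]: "(\<lambda>t. f (x(i := t))) \<in> borel_measurable borel"
      using measurable_compose[OF measurable_Pair1'[OF xs] m] by simp
    have int: "integrable unif (\<lambda>t. f (x(i := t)))"
      using * by (intro unif.integrable_const_bound[where B=B]) auto
    have "\<bar>?g x\<bar> \<le> (LINT t|unif. \<bar>f (x(i := t))\<bar>)" by (rule integral_abs_bound)
    also have "\<dots> \<le> B" using int * by (intro unif.integral_le_const) auto
    finally show ?thesis .
  qed
  show ig: "integrable (unif_cube d) ?g"
    by (rule integrable_unif_cube_bounded[where B=B]) (use gB in auto)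
  \<comment> \<open>Both integrals reduce to the same iterated integral over the other coordinates:
    the inner update in \<open>?g\<close> overwrites the outer one, so the additional average over
    \<open>y\<close> is that of a constant.\<close>
  have "(LINT x|unif_cube d. ?g x) = (LINT x|Pi\<^sub>M ?I (\<lambda>_. unif). LINT y|unif. ?g (x(i := y)))"
    using unifs.product_integral_insert[of ?I i ?g, unfolded ins] ig by (simp add: unif_cube_def)
  also have "\<dots> = (LINT x|Pi\<^sub>M ?I (\<lambda>_. unif). ?g x)"
    by simp
  also have "\<dots> = (LINT x|unif_cube d. f x)"
    using unifs.product_integral_insert[of ?I i f, unfolded ins] integrable_unif_cube_bounded[of f d B] B
    by (simp add: unif_cube_def)
  finally show "(LINT x|unif_cube d. f x) = (LINT x|unif_cube d. ?g x)" ..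
qed

lemma dot_measurable[measurable]: "(\<lambda>x. dot d w x) \<in> borel_measurable (lborel_pow d)"
  unfolding dot_def by measurable

lemma integral_unif_id: "(LINT t|unif. t - 1/2) = 0"
proof -
  have "(LINT t|unif. t - 1/2) = (LINT t:{0..1}|lborel. t - 1/2)" by (rule integral_unif) simp
  also have "\<dots> = (1\<^sup>2/2 - 1/2) - (0\<^sup>2/2 - 0/2)"
    unfolding set_lebesgue_integral_def
    by (rule integral_FTC_Icc[where F="\<lambda>t. t\<^sup>2/2 - t/2"])
       (auto intro!: derivative_eq_intros continuous_intros simp flip: has_real_derivative_iff_has_vector_derivative)
  finally show ?thesis by simp
qed

text \<open>The centred coordinates are independent with mean zero, so the mixed terms and the term
  linear in \<open>c\<close> vanish. The variance of a coordinate is bounded crudely by 1 instead of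
  its value 1/12.\<close>

lemma unif_cube_second_moment:
  "(LINT x|unif_cube d. ((\<Sum>i<d. v i * (x i - 1/2)) + c)\<^sup>2) \<le> (\<Sum>i<d. (v i)\<^sup>2) + c\<^sup>2"
proof -
  have cb: "\<bar>x i - 1/2\<bar> \<le> 1" if "x \<in> unit_cube d" "i < d" for x i
    using that by (auto simp: unit_cube_def PiE_iff abs_le_iff; force)
  have [measurable]: "(\<lambda>x. x i) \<in> borel_measurable (lborel_pow d)" if "i < d" for i
    using lborel_pow_component[of i d] that by simp
  have i1: "integrable (unif_cube d) (\<lambda>x. x i - 1/2)" if "i < d" for i
    by (rule integrable_unif_cube_bounded[where B=1]) (use that cb in auto)
  have cb2: "\<bar>(x i - 1/2) * (x j - 1/2)\<bar> \<le> 1" if "x \<in> unit_cube d" "i < d" "j < d" for x i j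
    unfolding abs_mult using cb[OF that(1,2)] cb[OF that(1,3)] mult_le_one[OF cb[OF that(1,2)] _ cb[OF that(1,3)]] by auto
  have i2: "integrable (unif_cube d) (\<lambda>x. (x i - 1/2) * (x j - 1/2))" if "i < d" "j < d" for i j
    by (rule integrable_unif_cube_bounded[where B=1]) (use that cb2 in auto)
  have e1: "(LINT x|unif_cube d. x i - 1/2) = 0" if "i < d" for i
    by (subst unif_cube_average_coordinate(2)[where i=i and B=1]) (use that cb integral_unif_id in auto)
  have e2: "(LINT x|unif_cube d. (x i - 1/2) * (x j - 1/2)) = 0" if "i < d" "j < d" "i \<noteq> j" for i j
    by (subst unif_cube_average_coordinate(2)[where i=i and B=1]) (use that cb2 integral_unif_id in auto)
  have e3: "(LINT x|unif_cube d. (x i - 1/2) * (x i - 1/2)) \<le> 1" if "i < d" for i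
  proof (rule unif_cube.integral_le_const[OF i2[OF that that]])
    show "AE x in unif_cube d. (x i - 1/2) * (x i - 1/2) \<le> 1"
      using AE_unif_cube[of d] by eventually_elim (use cb2[OF _ that that] in fastforce)
  qed
  have "(LINT x|unif_cube d. ((\<Sum>i<d. v i * (x i - 1/2)) + c)\<^sup>2)
    = (LINT x|unif_cube d. (\<Sum>i<d. \<Sum>j<d. v i * v j * ((x i - 1/2) * (x j - 1/2))) + 2 * c * (\<Sum>i<d. v i * (x i - 1/2)) + c\<^sup>2)"
    by (intro Bochner_Integration.integral_cong refl)
       (simp add: power2_eq_square algebra_simps sum_distrib_left sum_distrib_right sum.distrib sum_product)
  also have "\<dots> = (\<Sum>i<d. \<Sum>j<d. v i * v j * (LINT x|unif_cube d. (x i - 1/2) * (x j - 1/2)))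
       + 2 * c * (\<Sum>i<d. v i * (LINT x|unif_cube d. x i - 1/2)) + (LINT x|unif_cube d. c\<^sup>2)"
    by (intro has_bochner_integral_integral_eq has_bochner_integral_add has_bochner_integral_sum
          has_bochner_integral_mult_right has_bochner_integral_integrable i1 i2) auto
  also have "(LINT x|unif_cube d. c\<^sup>2) = c\<^sup>2" by simp
  finally have "(LINT x|unif_cube d. ((\<Sum>i<d. v i * (x i - 1/2)) + c)\<^sup>2) = (\<Sum>i<d. \<Sum>j<d. v i * v j * (LINT x|unif_cube d. (x i - 1/2) * (x j - 1/2)))
       + 2 * c * (\<Sum>i<d. v i * (LINT x|unif_cube d. x i - 1/2)) + c\<^sup>2" .
  also have "\<dots> = (\<Sum>i<d. \<Sum>j<d. if i = j then (v i)\<^sup>2 * (LINT x|unif_cube d. (x i - 1/2) * (x i - 1/2)) else 0) + c\<^sup>2"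
  proof -
    have "(\<Sum>i<d. v i * (LINT x|unif_cube d. x i - 1/2)) = 0" by (simp add: e1)
    moreover have "(\<Sum>i<d. \<Sum>j<d. v i * v j * (LINT x|unif_cube d. (x i - 1/2) * (x j - 1/2)))
      = (\<Sum>i<d. \<Sum>j<d. if i = j then (v i)\<^sup>2 * (LINT x|unif_cube d. (x i - 1/2) * (x i - 1/2)) else 0)"
      by (intro sum.cong refl) (use e2 in \<open>auto simp: power2_eq_square\<close>)
    ultimately show ?thesis by simp
  qed
  also have "\<dots> \<le> (\<Sum>i<d. (v i)\<^sup>2) + c\<^sup>2"
    using e3 by (auto simp: sum.delta intro!: sum_mono mult_left_le)
  finally show ?thesis .
qed

section \<open>Slabs of the cube\<close>

text \<open>This gives a rational majorant for the squared modulus of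
  \<open>(iexp a - 1) / (\<i> * a)\<close>, a form in which the product over all coordinates can be
  expanded in powers of the frequency. Up to \<open>a\<^sup>2 = 6\<close> the Taylor polynomial of
  the cosine decides; beyond, \<open>2 - 2 * cos a \<le> 4\<close> is enough, and it would be from
  \<open>a\<^sup>2 = 16/3\<close> on.\<close>

lemma two_minus_two_cos_le: "(2 - 2 * cos a) * (1 + a\<^sup>2 / 16) \<le> a\<^sup>2" for a :: real
proof (cases "a\<^sup>2 \<le> 6")
  case True
  obtain t where t: "cos a = (\<Sum>m<6. cos_coeff m * a ^ m) + cos (t + 1/2 * real 6 * pi) / fact 6 * a ^ 6"
    using Maclaurin_cos_expansion[of a 6] by auto
  define r where "r = cos (t + 1/2 * real 6 * pi)"
  have "r * a ^ 6 \<ge> - 1 * a ^ 6"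
    unfolding r_def by (intro mult_right_mono) auto
  then have "- (a ^ 6 / 720) \<le> r / 720 * a ^ 6" by simp
  moreover have "cos a = 1 - a\<^sup>2 / 2 + a ^ 4 / 24 + r / 720 * a ^ 6"
  proof -
    have "{..<6::nat} = {0,1,2,3,4,5}" by auto
    then have "(\<Sum>m<6. cos_coeff m * a ^ m) = 1 - a\<^sup>2 / 2 + a ^ 4 / 24"
      by (simp add: cos_coeff_def fact_numeral)
    moreover have "(fact 6 :: real) = 720" by (simp add: fact_numeral)
    ultimately show ?thesis using t by (simp only: r_def)
  qed
  ultimately have "cos a \<ge> 1 - a\<^sup>2 / 2 + a ^ 4 / 24 - a ^ 6 / 720" by linarith
  moreover define y where "y = a\<^sup>2"
  have "a ^ 4 = y\<^sup>2" "a ^ 6 = y ^ 3" by (simp_all add: y_def flip: power_mult)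
  ultimately have c: "2 - 2 * cos a \<le> y - y\<^sup>2 / 12 + y ^ 3 / 360" by (simp flip: y_def)
  have y: "0 \<le> y" "y \<le> 6" using True by (auto simp: y_def)
  have "(2 - 2 * cos a) * (1 + y / 16) \<le> (y - y\<^sup>2 / 12 + y ^ 3 / 360) * (1 + y / 16)"
    using c y by (intro mult_right_mono) auto
  also have "\<dots> = y - y\<^sup>2 * (1 / 48 + y * (1 / 192 - 1 / 360) - y\<^sup>2 / 5760)"
    by (simp add: field_simps power2_eq_square power3_eq_cube)
  also have "\<dots> \<le> y"
  proof -
    have "y\<^sup>2 \<le> 6 * 6" unfolding power2_eq_square using y by (intro mult_mono) auto
    then have "0 \<le> 1 / 48 + y * (1 / 192 - 1 / 360) - y\<^sup>2 / 5760" using y by (simp add: field_simps)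
    then show ?thesis by simp
  qed
  finally show ?thesis by (simp add: y_def)
next
  case False
  have "(2 - 2 * cos a) * (1 + a\<^sup>2 / 16) \<le> 4 * (1 + a\<^sup>2 / 16)"
  proof (rule mult_right_mono)
    show "2 - 2 * cos a \<le> 4" using cos_ge_minus_one[of a] by linarith
  qed simp
  with False show ?thesis by simp
qed

lemma norm_char_unif: "(cmod (LINT s|unif. iexp (a * s)))\<^sup>2 \<le> 1 / (1 + a\<^sup>2 / 16)"
proof (cases "a = 0")
  case False
  have "(LINT s|unif. iexp (a * s)) = (LINT s:{0..1}|lborel. iexp (a * s))"
    by (rule integral_unif) simp
  also have "\<dots> = iexp (a * 1) / (\<i> * a) - iexp (a * 0) / (\<i> * a)"
    unfolding set_lebesgue_integral_def
  proof (rule integral_FTC_Icc)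
    fix s :: real
    show "((\<lambda>s. iexp (a * s) / (\<i> * a)) has_vector_derivative iexp (a * s)) (at s within {0..1})"
    proof -
      have "((\<lambda>z. exp (\<i> * (a * z)) / (\<i> * a)) has_field_derivative exp (\<i> * (a * s))) (at (complex_of_real s))"
      proof -
        have "((\<lambda>z. exp (\<i> * (a * z))) has_field_derivative exp (\<i> * (a * s)) * (\<i> * a)) (at (complex_of_real s))"
          by (rule derivative_eq_intros refl | simp)+
        from DERIV_cdivide[OF this, of "\<i> * a"] False show ?thesis by simp
      qed
      from has_vector_derivative_real_field[OF this] show ?thesis
        by (simp add: has_vector_derivative_at_within)
    qed
  qed (auto intro!: continuous_intros)
  finally have "(LINT s|unif. iexp (a * s)) = (iexp a - 1) / (\<i> * a)" by (simp add: diff_divide_distrib)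
  then have "(cmod (LINT s|unif. iexp (a * s)))\<^sup>2 = (cmod (iexp a - 1))\<^sup>2 / a\<^sup>2"
    by (simp add: norm_divide norm_mult power_divide)
  also have "(cmod (iexp a - 1))\<^sup>2 = 2 - 2 * cos a"
  proof -
    have "(cos a)\<^sup>2 + (sin a)\<^sup>2 = 1" by simp
    then show ?thesis
      by (simp add: cmod_power2 Re_exp Im_exp power2_diff)
  qed
  also have "\<dots> / a\<^sup>2 \<le> 1 / (1 + a\<^sup>2 / 16)"
    using two_minus_two_cos_le[of a] False
    by (simp add: pos_divide_le_eq pos_le_divide_eq add_pos_nonneg)
  finally show ?thesis .
qed simp

text \<open>The product is cut off after the elementary symmetric polynomials of degree 1 and 2, the
  second written through power sums. Its nonnegativity is proved in the same induction because the
  cubic term dropped in each step has it as a factor.\<close>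

lemma prod_one_plus_ge:
  fixes a :: "'i \<Rightarrow> real"
  assumes "finite I" "\<And>i. i \<in> I \<Longrightarrow> a i \<ge> 0" "y \<ge> 0"
  shows "(\<Prod>i\<in>I. 1 + a i * y) \<ge> 1 + y * (\<Sum>i\<in>I. a i) + y\<^sup>2 * (((\<Sum>i\<in>I. a i)\<^sup>2 - (\<Sum>i\<in>I. (a i)\<^sup>2)) / 2)
    \<and> (\<Sum>i\<in>I. a i)\<^sup>2 \<ge> (\<Sum>i\<in>I. (a i)\<^sup>2)"
  using assms(1,2)
proof (induction I rule: finite_induct)
  case (insert i I)
  define S1 where "S1 = (\<Sum>i\<in>I. a i)"
  define S2 where "S2 = (\<Sum>i\<in>I. (a i)\<^sup>2)"
  have S1: "S1 \<ge> 0" unfolding S1_def using insert by (intro sum_nonneg) auto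
  have ai: "a i \<ge> 0" using insert by auto
  have IH: "(\<Prod>i\<in>I. 1 + a i * y) \<ge> 1 + y * S1 + y\<^sup>2 * ((S1\<^sup>2 - S2) / 2)" "S1\<^sup>2 \<ge> S2"
    using insert by (auto simp: S1_def S2_def)
  have "1 + y * (a i + S1) + y\<^sup>2 * (((a i + S1)\<^sup>2 - ((a i)\<^sup>2 + S2)) / 2)
      \<le> 1 + y * (a i + S1) + y\<^sup>2 * (((a i + S1)\<^sup>2 - ((a i)\<^sup>2 + S2)) / 2) + y ^ 3 * (a i * ((S1\<^sup>2 - S2) / 2))"
    using assms(3) ai IH by simp
  also have "\<dots> = (1 + a i * y) * (1 + y * S1 + y\<^sup>2 * ((S1\<^sup>2 - S2) / 2))"
    by (simp add: field_simps power2_eq_square power3_eq_cube)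
  also have "\<dots> \<le> (1 + a i * y) * (\<Prod>i\<in>I. 1 + a i * y)"
    using IH ai assms(3) by (intro mult_left_mono) auto
  finally show ?case
    using insert ai S1 IH add_increasing2[of "2 * a i * S1" S2 "S1\<^sup>2"]
    by (simp add: S1_def[symmetric] S2_def[symmetric] power2_sum algebra_simps)
qed simp

text \<open>If no squared coordinate of the unit vector exceeds 1/2, the second symmetric polynomial
  of the \<open>(u i)\<^sup>2\<close> is at least 1/4, and the product of the majorants is at least
  \<open>(1 + y / 2)\<^sup>2\<close>. The quadratic term is what matters: after the square root it
  leaves the decay \<open>1 / \<xi>\<^sup>2\<close>, integrable on the line, whereas one dominating
  coordinate may give only \<open>1 / \<bar>\<xi>\<bar>\<close>.\<close>

lemma norm_char_unif_cube:
  assumes u1: "(\<Sum>i<d. (u i)\<^sup>2) = 1" and u2: "\<And>i. i < d \<Longrightarrow> (u i)\<^sup>2 \<le> 1/2"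
  shows "cmod (LINT x|unif_cube d. iexp (\<xi> * dot d u x)) \<le> 1 / (1 + \<xi>\<^sup>2 / 32)"
proof -
  define y where "y = \<xi>\<^sup>2 / 16"
  have y: "y \<ge> 0" by (simp add: y_def)
  have "(LINT x|unif_cube d. iexp (\<xi> * dot d u x)) = (LINT x|unif_cube d. (\<Prod>i<d. iexp (\<xi> * u i * x i)))"
    by (intro Bochner_Integration.integral_cong refl)
       (simp add: dot_def sum_distrib_left exp_sum mult.assoc)
  also have "\<dots> = (\<Prod>i<d. LINT s|unif. iexp (\<xi> * u i * s))"
    unfolding unif_cube_def
    by (rule unifs.product_integral_prod) (auto intro!: unif.integrable_const_bound[where B=1])
  finally have "(cmod (LINT x|unif_cube d. iexp (\<xi> * dot d u x)))\<^sup>2 = (\<Prod>i<d. (cmod (LINT s|unif. iexp (\<xi> * u i * s)))\<^sup>2)"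
    by (simp add: prod_norm[symmetric] prod_power_distrib)
  also have "\<dots> \<le> (\<Prod>i<d. 1 / (1 + (u i)\<^sup>2 * y))"
    using norm_char_unif[of "\<xi> * u _"] by (intro prod_mono) (auto simp: y_def power_mult_distrib mult.commute)
  also have "\<dots> = 1 / (\<Prod>i<d. 1 + (u i)\<^sup>2 * y)" by (simp add: prod_dividef)
  also have "\<dots> \<le> 1 / (1 + y / 2)\<^sup>2"
  proof (rule divide_left_mono)
    have "(\<Sum>i<d. ((u i)\<^sup>2)\<^sup>2) \<le> (\<Sum>i<d. (u i)\<^sup>2 * (1/2))"
      unfolding power2_eq_square[of "(u _)\<^sup>2"] using u2 by (intro sum_mono mult_left_mono) auto
    also have "\<dots> = 1/2" unfolding sum_distrib_right[symmetric] u1 by simp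
    finally have "(\<Sum>i<d. ((u i)\<^sup>2)\<^sup>2) \<le> 1/2" .
    then have "y\<^sup>2 * (1/4) \<le> y\<^sup>2 * ((1 - (\<Sum>i<d. ((u i)\<^sup>2)\<^sup>2)) / 2)"
      by (intro mult_left_mono) auto
    then have "(1 + y / 2)\<^sup>2 \<le> 1 + y * (\<Sum>i<d. (u i)\<^sup>2) + y\<^sup>2 * (((\<Sum>i<d. (u i)\<^sup>2)\<^sup>2 - (\<Sum>i<d. ((u i)\<^sup>2)\<^sup>2)) / 2)"
      unfolding u1 by (simp add: power2_eq_square field_simps)
    also have "\<dots> \<le> (\<Prod>i<d. 1 + (u i)\<^sup>2 * y)"
      using prod_one_plus_ge[of "{..<d}" "\<lambda>i. (u i)\<^sup>2" y] y by auto
    finally show "(1 + y / 2)\<^sup>2 \<le> (\<Prod>i<d. 1 + (u i)\<^sup>2 * y)" .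
  qed (use y in \<open>auto intro!: mult_pos_pos prod_pos add_pos_nonneg zero_less_power\<close>)
  also have "\<dots> = (1 / (1 + \<xi>\<^sup>2 / 32))\<^sup>2" by (simp add: y_def power_divide)
  finally show ?thesis
    by (rule power2_le_imp_le) simp
qed

section \<open>Probability of a slab\<close>

lemma unif_slab: "(LINT s|unif. indicator {s. \<bar>a * s + c\<bar> \<le> \<eta>} s) \<le> (2 * \<eta> / \<bar>a\<bar> :: real)" if "a \<noteq> 0" "\<eta> > 0"
proof -
  have eq: "{s. \<bar>a * s + c\<bar> \<le> \<eta>} = {- c / a - \<eta> / \<bar>a\<bar> .. - c / a + \<eta> / \<bar>a\<bar>}" (is "_ = ?J")
  proof (rule set_eqI)
    fix s
    have "\<bar>a * s + c\<bar> = \<bar>a\<bar> * \<bar>s + c / a\<bar>" using that by (simp add: abs_mult[symmetric] field_simps)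
    then have "\<bar>a * s + c\<bar> \<le> \<eta> \<longleftrightarrow> \<bar>s + c / a\<bar> \<le> \<eta> / \<bar>a\<bar>" using that by (simp add: field_simps)
    then show "s \<in> {s. \<bar>a * s + c\<bar> \<le> \<eta>} \<longleftrightarrow> s \<in> ?J" by (auto simp: abs_le_iff)
  qed
  have "(LINT s|unif. indicator ?J s :: real) = (LINT s|lborel. indicator {0..1} s *\<^sub>R indicator ?J s)"
    by (subst integral_unif) (auto simp: set_lebesgue_integral_def)
  also have "\<dots> \<le> (LINT s|lborel. indicator ?J s)"
  proof (rule integral_mono)
    show i: "integrable lborel (\<lambda>s. indicator ?J s :: real)"
      by (rule integrable_real_indicator) (auto simp: emeasure_lborel_Icc_eq)
    show "integrable lborel (\<lambda>s. indicator {0..1} s *\<^sub>R (indicator ?J s :: real))"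
      by (rule integrable_mult_indicator[OF _ i]) simp
  qed (simp add: indicator_def)
  also have "\<dots> = 2 * \<eta> / \<bar>a\<bar>" using that by simp
  finally show ?thesis unfolding eq .
qed


text \<open>The factor 2 suffices because \<open>exp (- 1/2) \<ge> 1/2\<close>, an instance of
  \<open>1 + x \<le> exp x\<close>.\<close>

lemma indicator_le_gaussian: "indicator {-\<eta>..\<eta>} y \<le> 2 * exp (- (y / \<eta>)\<^sup>2 / 2)" if "\<eta> > 0" for y \<eta> :: real
proof (cases "y \<in> {-\<eta>..\<eta>}")
  case True
  then have "\<bar>y / \<eta>\<bar> \<le> 1" using that by (auto simp: abs_le_iff field_simps)
  then have "(y / \<eta>)\<^sup>2 \<le> 1" by (simp add: abs_square_le_1)
  then have "1 + - (1/2) \<le> 1 + - (y / \<eta>)\<^sup>2 / 2" by simp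
  also have "\<dots> \<le> exp (- (y / \<eta>)\<^sup>2 / 2)" by (rule exp_ge_add_one_self)
  finally show ?thesis using True by simp
qed simp

text \<open>The Gaussian weight is itself the characteristic function of a standard normal, so by
  Fubini the expectation becomes an average of the characteristic function of the cube. Bounding the
  normal density by \<open>1 / sqrt (2 * pi)\<close> leaves the integral of
  \<open>inverse (1 + (z / c)\<^sup>2)\<close>, which is \<open>c * pi\<close> with \<open>c\<close>
  proportional to \<eta>: this is the gain linear in the width.\<close>

lemma unif_cube_gaussian_slab:
  assumes u1: "(\<Sum>i<d. (u i)\<^sup>2) = 1" and u2: "\<And>i. i < d \<Longrightarrow> (u i)\<^sup>2 \<le> 1/2" and \<eta>: "\<eta> > 0"
  shows "(LINT x|unif_cube d. exp (- ((dot d u x + t) / \<eta>)\<^sup>2 / 2)) \<le> 8 * \<eta>"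
proof -
  let ?N = "std_normal_distribution"
  interpret N: real_distribution ?N by (rule real_dist_normal_dist)
  interpret pair_sigma_finite "unif_cube d" ?N ..
  interpret QN: finite_measure "unif_cube d \<Otimes>\<^sub>M ?N"
    by (rule finite_measure_pair_measure) unfold_locales
  define A where "A x = (dot d u x + t) / \<eta>" for x
  have [measurable]: "A \<in> borel_measurable (lborel_pow d)" unfolding A_def by measurable
  have iexpA: "complex_of_real (exp (- (A x)\<^sup>2 / 2)) = (LINT z|?N. iexp (A x * z))" for x
    using char_std_normal_distribution by (simp add: char_def fun_eq_iff)
  have int: "integrable (unif_cube d \<Otimes>\<^sub>M ?N) (\<lambda>(x, z). iexp (A x * z))"
    by (rule QN.integrable_const_bound[where B=1]) (auto simp: split_beta')
  have "complex_of_real (LINT x|unif_cube d. exp (- (A x)\<^sup>2 / 2)) = (LINT x|unif_cube d. complex_of_real (exp (- (A x)\<^sup>2 / 2)))"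
    by (rule integral_complex_of_real[symmetric])
  also have "\<dots> = (LINT x|unif_cube d. LINT z|?N. iexp (A x * z))"
    by (simp only: iexpA)
  also have "\<dots> = (LINT z|?N. LINT x|unif_cube d. iexp (A x * z))"
    by (rule Fubini_integral[OF int, symmetric])
  finally have eq: "complex_of_real (LINT x|unif_cube d. exp (- (A x)\<^sup>2 / 2)) = \<dots>" .
  have inner: "cmod (LINT x|unif_cube d. iexp (A x * z)) \<le> inverse (1 + (z / (sqrt 32 * \<eta>))\<^sup>2)" for z
  proof -
    have "(LINT x|unif_cube d. iexp (A x * z)) = (LINT x|unif_cube d. iexp (t * z / \<eta>) * iexp (z / \<eta> * dot d u x))"
      by (intro Bochner_Integration.integral_cong refl)
         (simp add: A_def add_divide_distrib ring_distribs mult_ac add.commute flip: exp_add)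
    also have "\<dots> = iexp (t * z / \<eta>) * (LINT x|unif_cube d. iexp (z / \<eta> * dot d u x))" by simp
    finally have "cmod (LINT x|unif_cube d. iexp (A x * z)) = cmod (LINT x|unif_cube d. iexp (z / \<eta> * dot d u x))"
      by (simp add: norm_mult)
    also have "\<dots> \<le> 1 / (1 + (z / \<eta>)\<^sup>2 / 32)"
      by (rule norm_char_unif_cube[OF u1 u2])
    also have "(z / \<eta>)\<^sup>2 / 32 = (z / (sqrt 32 * \<eta>))\<^sup>2" by (simp add: power_divide power_mult_distrib)
    finally show ?thesis by (simp add: inverse_eq_divide)
  qed
  define c where "c = sqrt 32 * \<eta>"
  have c: "c > 0" using \<eta> by (simp add: c_def)
  have hb: "has_bochner_integral lborel (\<lambda>x::real. inverse (1 + x\<^sup>2)) pi"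
    using integrable_inverse_1_plus_square LBINT_inverse_1_plus_square
    by (simp add: has_bochner_integral_iff set_integrable_def interval_lebesgue_integral_def set_lebesgue_integral_def)
  have hb2: "has_bochner_integral lborel (\<lambda>z::real. inverse (1 + (z / c)\<^sup>2)) (c * pi)"
    using lborel_has_bochner_integral_real_affine_iff[of "1 / c" "\<lambda>x. inverse (1 + x\<^sup>2)" pi 0] hb c
    by (simp add: mult.commute)
  have "(LINT x|unif_cube d. exp (- (A x)\<^sup>2 / 2)) = cmod (LINT z|?N. LINT x|unif_cube d. iexp (A x * z))"
    unfolding eq[symmetric] by (simp add: integral_nonneg)
  also have "\<dots> \<le> (LINT z|?N. inverse (1 + (z / c)\<^sup>2))"
  proof (rule Bochner_Integration.integral_norm_bound_integral)
    show "integrable ?N (\<lambda>z. LINT x|unif_cube d. iexp (A x * z))" by (rule integrable_snd[OF int])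
    show "integrable ?N (\<lambda>z. inverse (1 + (z / c)\<^sup>2))"
      by (rule N.integrable_const_bound[where B=1]) (auto simp: inverse_le_1_iff)
  qed (use inner in \<open>simp add: c_def\<close>)
  also have "\<dots> = (LINT z|lborel. std_normal_density z * inverse (1 + (z / c)\<^sup>2))"
    by (subst integral_density) auto
  also have "\<dots> \<le> (LINT z|lborel. 1 / sqrt (2 * pi) * inverse (1 + (z / c)\<^sup>2))"
  proof (rule integral_mono)
    show i: "integrable lborel (\<lambda>z. 1 / sqrt (2 * pi) * inverse (1 + (z / c)\<^sup>2))"
      using hb2 by (intro integrable_mult_right) (simp add: has_bochner_integral_iff)
    show le: "std_normal_density z * inverse (1 + (z / c)\<^sup>2) \<le> 1 / sqrt (2 * pi) * inverse (1 + (z / c)\<^sup>2)" for z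
      by (rule mult_right_mono) (auto simp: std_normal_density_def divide_right_mono)
    show "integrable lborel (\<lambda>z. std_normal_density z * inverse (1 + (z / c)\<^sup>2))"
    proof (rule Bochner_Integration.integrable_bound[OF i])
      have "norm (std_normal_density z * inverse (1 + (z / c)\<^sup>2)) \<le> norm (1 / sqrt (2 * pi) * inverse (1 + (z / c)\<^sup>2))" for z
        unfolding real_norm_def using le[of z]
        by (subst (1 2) abs_of_nonneg) (simp_all only: mult_nonneg_nonneg normal_density_nonneg inverse_nonnegative_iff_nonnegative
             add_nonneg_nonneg zero_le_one zero_le_power2 divide_nonneg_nonneg real_sqrt_ge_zero pi_ge_zero mult_nonneg_nonneg zero_le_numeral)
      then show "AE z in lborel. norm (std_normal_density z * inverse (1 + (z / c)\<^sup>2)) \<le> norm (1 / sqrt (2 * pi) * inverse (1 + (z / c)\<^sup>2))"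
        by (intro AE_I2)
    qed measurable
  qed
  also have "\<dots> = c * pi / sqrt (2 * pi)"
    using hb2 by (simp add: has_bochner_integral_iff)
  also have "\<dots> = 4 * sqrt pi * \<eta>"
  proof -
    have "sqrt 32 = 4 * sqrt 2" using real_sqrt_mult[of 16 2] by simp
    then have "c * pi / sqrt (2 * pi) = 4 * \<eta> * (pi / sqrt pi)"
      by (simp add: c_def real_sqrt_mult)
    also have "pi / sqrt pi = sqrt pi" by (rule real_div_sqrt) simp
    finally show ?thesis by simp
  qed
  also have "\<dots> \<le> 8 * \<eta>"
  proof -
    have "sqrt pi \<le> sqrt 4" using pi_less_4 by (intro real_sqrt_le_mono) simp
    then show ?thesis using \<eta> by simp
  qed
  finally show ?thesis by (simp add: A_def)
qed

text \<open>The two cases call for different tools: a dominating coordinate spoils the decay of the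
  characteristic function, but then the slab is thin along the lines of that coordinate, uniformly
  in all the others.\<close>

lemma unif_cube_slab_normalized:
  assumes u1: "(\<Sum>i<d. (u i)\<^sup>2) = 1" and \<eta>: "\<eta> > 0"
  shows "(LINT x|unif_cube d. indicator {-\<eta>..\<eta>} (dot d u x + t)) \<le> 16 * \<eta>"
proof (cases "\<exists>j<d. (u j)\<^sup>2 > 1/2")
  case True
  then obtain j where j: "j < d" "(u j)\<^sup>2 > 1/2" by auto
  have uj: "\<bar>u j\<bar> > 1/2"
  proof (rule ccontr)
    assume "\<not> ?thesis"
    then have "\<bar>u j\<bar>\<^sup>2 \<le> (1/2)\<^sup>2" by (intro power_mono) auto
    with j show False by (simp add: power2_eq_square)
  qed
  let ?f = "\<lambda>x. indicator {-\<eta>..\<eta>} (dot d u x + t) :: real"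
  have dots: "dot d u (x(j := s)) + t = u j * s + (dot d u (x(j := 0)) + t)" for x s
    using j by (simp add: dot_def sum.remove[of "{..<d}" j])
  have "(LINT x|unif_cube d. ?f x) = (LINT x|unif_cube d. LINT s|unif. ?f (x(j := s)))"
    by (rule unif_cube_average_coordinate(2)[where B=1]) (use j in auto)
  also have "\<dots> \<le> 4 * \<eta>"
  proof (rule unif_cube.integral_le_const)
    show "integrable (unif_cube d) (\<lambda>x. LINT s|unif. ?f (x(j := s)))"
      by (rule unif_cube_average_coordinate(1)[where B=1]) (use j in auto)
    show "AE x in unif_cube d. (LINT s|unif. ?f (x(j := s))) \<le> 4 * \<eta>"
    proof (rule AE_I2)
      fix x
      have "(LINT s|unif. ?f (x(j := s))) = (LINT s|unif. indicator {s. \<bar>u j * s + (dot d u (x(j := 0)) + t)\<bar> \<le> \<eta>} s)"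
      proof (rule Bochner_Integration.integral_cong[OF refl])
        show "?f (x(j := s)) = indicator {s. \<bar>u j * s + (dot d u (x(j := 0)) + t)\<bar> \<le> \<eta>} s" for s
          unfolding dots[of x s] by (auto simp: indicator_def abs_le_iff)
      qed
      also have "\<dots> \<le> 2 * \<eta> / \<bar>u j\<bar>" using uj by (intro unif_slab \<eta>) auto
      also have "\<dots> \<le> 4 * \<eta>" using uj \<eta> by (simp add: field_simps)
      finally show "(LINT s|unif. ?f (x(j := s))) \<le> 4 * \<eta>" .
    qed
  qed
  finally show ?thesis using \<eta> by simp
next
  case False
  have "(LINT x|unif_cube d. indicator {-\<eta>..\<eta>} (dot d u x + t)) \<le> (LINT x|unif_cube d. 2 * exp (- ((dot d u x + t) / \<eta>)\<^sup>2 / 2))"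
    by (intro integral_mono integrable_unif_cube_bounded[where B=1] integrable_unif_cube_bounded[where B=2] indicator_le_gaussian \<eta>) auto
  also have "\<dots> \<le> 2 * (8 * \<eta>)"
  proof -
    have "(u i)\<^sup>2 \<le> 1/2" if "i < d" for i using False that by (meson not_less)
    from unif_cube_gaussian_slab[OF u1 this \<eta>, of t] show ?thesis by simp
  qed
  finally show ?thesis by simp
qed

lemma unif_cube_slab:
  assumes r: "r = sqrt (\<Sum>i<d. (w i)\<^sup>2)" "r > 0" and \<eta>: "\<eta> > 0"
  shows "(LINT x|unif_cube d. indicator {-\<eta>..\<eta>} (dot d w x + t)) \<le> 16 * \<eta> / r"
proof -
  have "(\<Sum>i<d. (w i / r)\<^sup>2) = 1"
    using r by (simp add: power_divide flip: sum_divide_distrib)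
  from unif_cube_slab_normalized[OF this, of "\<eta> / r" "t / r"]
  have "(LINT x|unif_cube d. indicator {-(\<eta> / r)..\<eta> / r} (dot d (\<lambda>i. w i / r) x + t / r)) \<le> 16 * \<eta> / r"
    using r \<eta> by simp
  moreover have "indicator {-(\<eta> / r)..\<eta> / r} (dot d (\<lambda>i. w i / r) x + t / r) = (indicator {-\<eta>..\<eta>} (dot d w x + t) :: real)" for x
  proof -
    have "dot d (\<lambda>i. w i / r) x + t / r = (dot d w x + t) / r"
      by (simp add: dot_def add_divide_distrib sum_divide_distrib)
    moreover have "- (\<eta> / r) \<le> y / r \<longleftrightarrow> - \<eta> \<le> y" "y / r \<le> \<eta> / r \<longleftrightarrow> y \<le> \<eta>" for y
      using r(2) divide_le_cancel[of "- \<eta>" r y] divide_le_cancel[of y r \<eta>] by auto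
    ultimately show ?thesis by (simp add: indicator_def)
  qed
  ultimately show ?thesis by simp
qed

section \<open>ReLU units and their distance in the Sobolev norm\<close>

text \<open>Component \<open>0\<close> is a ReLU unit, component \<open>Suc i\<close> its \<open>i\<close>-th partial derivative; cutting off
  outside the cube keeps them bounded.\<close>

definition unit_jet :: "nat \<Rightarrow> nat \<Rightarrow> point \<times> real \<Rightarrow> point \<Rightarrow> real" where
  "unit_jet d j p x = indicator (unit_cube d) x *
     (case j of 0 \<Rightarrow> relu (dot d (fst p) x + snd p)
      | Suc i \<Rightarrow> fst p i * indicator {0<..} (dot d (fst p) x + snd p))"

definition norm2 :: "nat \<Rightarrow> point \<Rightarrow> real" where
  "norm2 d w = sqrt (\<Sum>i<d. (w i)\<^sup>2)"

lemma norm2_sq: "(norm2 d w)\<^sup>2 = (\<Sum>i<d. (w i)\<^sup>2)"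
  by (simp add: norm2_def sum_nonneg)

lemma norm2_nonneg: "0 \<le> norm2 d w" by (simp add: norm2_def sum_nonneg)

lemma norm2_le_norm1: "norm2 d w \<le> norm1 d w"
  unfolding norm2_def norm1_def using L2_set_le_sum_abs[of w "{..<d}"] by (simp add: L2_set_def)

lemma norm1_le_norm2: "(norm1 d w)\<^sup>2 \<le> real d * (norm2 d w)\<^sup>2"
  using Cauchy_Schwarz_ineq_sum[of "\<lambda>_. 1" "\<lambda>i. \<bar>w i\<bar>" "{..<d}"]
  by (simp add: norm1_def norm2_sq)

lemma abs_dot_le: "x \<in> unit_cube d \<Longrightarrow> \<bar>dot d w x\<bar> \<le> norm1 d w"
proof -
  assume x: "x \<in> unit_cube d"
  have "\<bar>dot d w x\<bar> \<le> (\<Sum>i<d. \<bar>w i * x i\<bar>)" unfolding dot_def by (rule sum_abs)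
  also have "\<dots> \<le> (\<Sum>i<d. \<bar>w i\<bar> * 1)"
    unfolding abs_mult
  proof (intro sum_mono mult_left_mono)
    fix i assume "i \<in> {..<d}"
    with x have "x i \<in> {0<..<1}" unfolding unit_cube_def by (rule PiE_mem)
    then show "\<bar>x i\<bar> \<le> 1" by auto
  qed auto
  finally show ?thesis by (simp add: norm1_def)
qed

lemma dot_measurable_pair[measurable]:
  "(\<lambda>(w, x). dot d w x) \<in> borel_measurable (lborel_pow d \<Otimes>\<^sub>M lborel_pow d)"
  unfolding dot_def split_beta' by measurable

lemma relu_measurable[measurable]: "relu \<in> borel_measurable borel"
  unfolding relu_def by measurable

lemma unit_jet_measurable[measurable]:
  assumes "j \<le> d"
  shows "(\<lambda>(p, x). unit_jet d j p x) \<in> borel_measurable ((lborel_pow d \<Otimes>\<^sub>M borel) \<Otimes>\<^sub>M lborel_pow d)"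
proof -
  have D[measurable]: "(\<lambda>z. dot d (fst (fst z)) (snd z) + snd (fst z)) \<in> borel_measurable ((lborel_pow d \<Otimes>\<^sub>M borel) \<Otimes>\<^sub>M lborel_pow d)"
    unfolding dot_def by measurable
  show ?thesis
  proof (cases j)
    case 0
    then show ?thesis unfolding unit_jet_def split_beta' by simp
  next
    case (Suc i)
    then have i: "i < d" using assms by simp
    have [measurable]: "(\<lambda>w. w i) \<in> borel_measurable (lborel_pow d)"
      using lborel_pow_component[of i d] i by simp
    show ?thesis unfolding unit_jet_def split_beta' Suc by simp
  qed
qed

lemma relu_lipschitz: "\<bar>relu a - relu b\<bar> \<le> \<bar>a - b\<bar>" by (auto simp: relu_def)

lemma unit_jet_bound:
  assumes "norm1 d w = 1" "\<bar>t\<bar> \<le> 1" "j \<le> d"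
  shows "\<bar>unit_jet d j (w, t) x\<bar> \<le> 2"
proof (cases "x \<in> unit_cube d")
  case True
  have w: "\<bar>w i\<bar> \<le> 1" if "i < d" for i
    unfolding assms(1)[symmetric] norm1_def using that by (intro member_le_sum) auto
  show ?thesis
  proof (cases j)
    case 0
    then show ?thesis
      using abs_dot_le[OF True, of w] assms True by (auto simp: unit_jet_def relu_def)
  next
    case (Suc i)
    then show ?thesis using w[of i] assms True by (auto simp: unit_jet_def indicator_def)
  qed
qed (simp add: unit_jet_def)

text \<open>If the signs disagree while the first argument exceeds \<eta> in modulus, the two
  arguments are at least \<eta> apart. So the squared difference of the indicators is dominated
  pointwise by the indicator of a slab, that of \<open>w\<close> alone, plus a Chebyshev
  quotient.\<close>

lemma sign_change_prob:
  assumes w: "norm2 d w > 0" and \<eta>: "\<eta> > 0"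
  shows "(LINT x|unif_cube d. (indicator {0<..} (dot d w x + t) - indicator {0<..} (dot d w' x + t'))\<^sup>2)
    \<le> 16 * \<eta> / norm2 d w + (LINT x|unif_cube d. (dot d w x + t - (dot d w' x + t'))\<^sup>2) / \<eta>\<^sup>2"
proof -
  let ?A = "\<lambda>x. dot d w x + t" and ?A' = "\<lambda>x. dot d w' x + t'"
  have b: "\<bar>?A x - ?A' x\<bar> \<le> norm1 d w + \<bar>t\<bar> + norm1 d w' + \<bar>t'\<bar>" if "x \<in> unit_cube d" for x
    using abs_dot_le[OF that, of w] abs_dot_le[OF that, of w'] by linarith
  have i2: "integrable (unif_cube d) (\<lambda>x. (?A x - ?A' x)\<^sup>2)"
  proof (rule integrable_unif_cube_bounded[where B="(norm1 d w + \<bar>t\<bar> + norm1 d w' + \<bar>t'\<bar>)\<^sup>2"])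
    show "norm ((?A x - ?A' x)\<^sup>2) \<le> (norm1 d w + \<bar>t\<bar> + norm1 d w' + \<bar>t'\<bar>)\<^sup>2" if "x \<in> unit_cube d" for x
      using power_mono[OF b[OF that], of 2] by simp
  qed simp
  have ib: "integrable (unif_cube d) (\<lambda>x. indicator {-\<eta>..\<eta>} (?A x) :: real)"
    by (rule integrable_unif_cube_bounded[where B=1]) (auto simp: indicator_def)
  have "(LINT x|unif_cube d. (indicator {0<..} (?A x) - indicator {0<..} (?A' x))\<^sup>2)
    \<le> (LINT x|unif_cube d. indicator {-\<eta>..\<eta>} (?A x) + (?A x - ?A' x)\<^sup>2 / \<eta>\<^sup>2)"
  proof (rule integral_mono)
    show "integrable (unif_cube d) (\<lambda>x. (indicator {0<..} (?A x) - indicator {0<..} (?A' x) :: real)\<^sup>2)"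
      by (rule integrable_unif_cube_bounded[where B=1]) (auto simp: indicator_def)
    show "integrable (unif_cube d) (\<lambda>x. indicator {-\<eta>..\<eta>} (?A x) + (?A x - ?A' x)\<^sup>2 / \<eta>\<^sup>2)"
      using i2 by (intro Bochner_Integration.integrable_add integrable_divide ib) auto
    fix x
    show "(indicator {0<..} (?A x) - indicator {0<..} (?A' x))\<^sup>2 \<le> indicator {-\<eta>..\<eta>} (?A x) + (?A x - ?A' x)\<^sup>2 / \<eta>\<^sup>2"
    proof (cases "(?A x > 0) = (?A' x > 0) \<or> \<bar>?A x\<bar> \<le> \<eta>")
      case True
      then show ?thesis by (auto simp: indicator_def abs_le_iff intro: add_increasing2)
    next
      case False
      then have "\<eta> \<le> \<bar>?A x - ?A' x\<bar>" by (auto simp: not_less)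
      then have "\<eta>\<^sup>2 \<le> (?A x - ?A' x)\<^sup>2" using \<eta> power_mono[of \<eta> "\<bar>?A x - ?A' x\<bar>" 2] by simp
      then have "1 \<le> (?A x - ?A' x)\<^sup>2 / \<eta>\<^sup>2" using \<eta> by simp
      then show ?thesis by (auto simp: indicator_def)
    qed
  qed
  also have "\<dots> = (LINT x|unif_cube d. indicator {-\<eta>..\<eta>} (?A x)) + (LINT x|unif_cube d. (?A x - ?A' x)\<^sup>2) / \<eta>\<^sup>2"
    using i2 ib by simp
  also have "(LINT x|unif_cube d. indicator {-\<eta>..\<eta>} (?A x)) \<le> 16 * \<eta> / norm2 d w"
    using unif_cube_slab[where r="norm2 d w" and d=d and w=w and \<eta>=\<eta> and t=t] w \<eta> by (simp add: norm2_def)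
  finally show ?thesis by simp
qed

text \<open>The offsets are compared after recentring at the midpoint of the cube: there \<open>w \<bullet> x\<close> only
  fluctuates at the scale of the Euclidean norm of \<open>w\<close>, which is what makes the estimate free of
  the dimension.\<close>

lemma unit_jet_dist:
  assumes d: "d \<ge> 1" and \<delta>: "0 < \<delta>" "\<delta> \<le> 1"
    and w: "norm1 d w = 1"
    and close: "\<And>i. i < d \<Longrightarrow> \<bar>w i - w' i\<bar> \<le> 2 * \<delta> / d"
    and s: "\<bar>(t + (\<Sum>i<d. w i) / 2) - (t' + (\<Sum>i<d. w' i) / 2)\<bar> \<le> \<delta> / sqrt d"
  shows "(\<Sum>j\<in>{..d}. LINT x|unif_cube d. (unit_jet d j (w, t) x - unit_jet d j (w', t') x)\<^sup>2)
     \<le> 60 * \<delta> powr (2/3)"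
proof -
  let ?A = "\<lambda>x. dot d w x + t" and ?A' = "\<lambda>x. dot d w' x + t'"
  let ?H = "\<lambda>y. indicator {0<..} y :: real"
  define r where "r = norm2 d w"
  have d0: "real d > 0" using d by simp
  have r2: "1 / d \<le> r\<^sup>2" using norm1_le_norm2[of d w] w d0 by (simp add: r_def field_simps)
  then have r0: "r > 0" using d0 norm2_nonneg[of d w] unfolding r_def
    by (metis less_eq_real_def not_le power_zero_numeral zero_less_divide_1_iff)
  have r1: "r \<le> 1" using norm2_le_norm1[of d w] w by (simp add: r_def)
  have v2: "(\<Sum>i<d. (w i - w' i)\<^sup>2) \<le> 4 * \<delta>\<^sup>2 / d"
  proof -
    have "(\<Sum>i<d. (w i - w' i)\<^sup>2) \<le> (\<Sum>i<d. (2 * \<delta> / d)\<^sup>2)"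
      using close power_mono[of "\<bar>w _ - w' _\<bar>" "2 * \<delta> / d" 2] by (intro sum_mono) auto
    also have "\<dots> = 4 * \<delta>\<^sup>2 / d" using d0 by (simp add: power2_eq_square field_simps)
    finally show ?thesis .
  qed
  define q where "q = (LINT x|unif_cube d. (?A x - ?A' x)\<^sup>2)"
  have q: "q \<le> 5 * \<delta>\<^sup>2 / d"
  proof -
    let ?c = "(t + (\<Sum>i<d. w i) / 2) - (t' + (\<Sum>i<d. w' i) / 2)"
    have "q = (LINT x|unif_cube d. ((\<Sum>i<d. (w i - w' i) * (x i - 1/2)) + ?c)\<^sup>2)"
      unfolding q_def
      by (intro Bochner_Integration.integral_cong refl arg_cong[where f="\<lambda>x. x\<^sup>2"])
         (simp add: dot_def algebra_simps sum_subtractf sum.distrib sum_divide_distrib diff_divide_distrib)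
    also have "\<dots> \<le> (\<Sum>i<d. (w i - w' i)\<^sup>2) + ?c\<^sup>2" by (rule unif_cube_second_moment)
    also have "\<dots> \<le> 4 * \<delta>\<^sup>2 / d + (\<delta> / sqrt d)\<^sup>2"
      using v2 power_mono[OF s, of 2] by simp
    also have "\<dots> = 5 * \<delta>\<^sup>2 / d" using d0 by (simp add: power_divide field_simps)
    finally show ?thesis .
  qed
  have q0: "q \<ge> 0" by (simp add: q_def)
  have jb: "\<bar>?A x - ?A' x\<bar> \<le> norm1 d w + \<bar>t\<bar> + norm1 d w' + \<bar>t'\<bar>" if "x \<in> unit_cube d" for x
    using abs_dot_le[OF that, of w] abs_dot_le[OF that, of w'] by linarith
  have i2: "integrable (unif_cube d) (\<lambda>x. (?A x - ?A' x)\<^sup>2)"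
  proof (rule integrable_unif_cube_bounded[where B="(norm1 d w + \<bar>t\<bar> + norm1 d w' + \<bar>t'\<bar>)\<^sup>2"])
    show "norm ((?A x - ?A' x)\<^sup>2) \<le> (norm1 d w + \<bar>t\<bar> + norm1 d w' + \<bar>t'\<bar>)\<^sup>2" if "x \<in> unit_cube d" for x
      using power_mono[OF jb[OF that], of 2] by simp
  qed simp
  have j0: "(LINT x|unif_cube d. (unit_jet d 0 (w, t) x - unit_jet d 0 (w', t') x)\<^sup>2) \<le> q"
    unfolding q_def
  proof (rule integral_mono_AE[OF _ i2])
    have "(relu (?A x) - relu (?A' x))\<^sup>2 \<le> (?A x - ?A' x)\<^sup>2" for x
      using power_mono[OF relu_lipschitz[of "?A x" "?A' x"], of 2] by simp
    then show le: "AE x in unif_cube d. (unit_jet d 0 (w, t) x - unit_jet d 0 (w', t') x)\<^sup>2 \<le> (?A x - ?A' x)\<^sup>2"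
      by (intro AE_I2) (auto simp: unit_jet_def indicator_def)
    show "integrable (unif_cube d) (\<lambda>x. (unit_jet d 0 (w, t) x - unit_jet d 0 (w', t') x)\<^sup>2)"
      using le by (intro Bochner_Integration.integrable_bound[OF i2]) (auto simp: unit_jet_def)
  qed
  define p where "p = (LINT x|unif_cube d. (?H (?A x) - ?H (?A' x))\<^sup>2)"
  have ip: "integrable (unif_cube d) (\<lambda>x. (?H (?A x) - ?H (?A' x))\<^sup>2)"
    by (rule integrable_unif_cube_bounded[where B=1]) (auto simp: indicator_def)
  have ji: "(LINT x|unif_cube d. (unit_jet d (Suc i) (w, t) x - unit_jet d (Suc i) (w', t') x)\<^sup>2)
      \<le> 2 * (w i)\<^sup>2 * p + 2 * (w i - w' i)\<^sup>2" if "i < d" for i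
  proof -
    let ?R = "\<lambda>x. 2 * (w i)\<^sup>2 * (?H (?A x) - ?H (?A' x))\<^sup>2 + 2 * (w i - w' i)\<^sup>2"
    have iR: "integrable (unif_cube d) ?R" using ip by simp
    have "(unit_jet d (Suc i) (w, t) x - unit_jet d (Suc i) (w', t') x)\<^sup>2 \<le> ?R x" for x
    proof -
      \<comment> \<open>The difference of the two derivatives is \<open>w i\<close> times the change
        of the indicator plus \<open>w i - w' i\<close> times the indicator of the second
        unit.\<close>
      have sq: "(a + b)\<^sup>2 \<le> 2 * a\<^sup>2 + 2 * b\<^sup>2" for a b :: real
        using sum_squares_bound[of a b] by (simp add: power2_sum)
      show ?thesis
        using sq[of "w i * (?H (?A x) - ?H (?A' x))" "(w i - w' i) * ?H (?A' x)"]
        by (auto simp: unit_jet_def indicator_def split: if_splits)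
    qed
    then have le: "AE x in unif_cube d. (unit_jet d (Suc i) (w, t) x - unit_jet d (Suc i) (w', t') x)\<^sup>2 \<le> ?R x"
      by simp
    have "(LINT x|unif_cube d. (unit_jet d (Suc i) (w, t) x - unit_jet d (Suc i) (w', t') x)\<^sup>2) \<le> (LINT x|unif_cube d. ?R x)"
    proof (rule integral_mono_AE[OF _ iR le])
      show "integrable (unif_cube d) (\<lambda>x. (unit_jet d (Suc i) (w, t) x - unit_jet d (Suc i) (w', t') x)\<^sup>2)"
        using le by (intro Bochner_Integration.integrable_bound[OF iR]) (auto simp: unit_jet_def elim!: eventually_mono)
    qed
    also have "\<dots> = 2 * (w i)\<^sup>2 * p + 2 * (w i - w' i)\<^sup>2"
      using ip by (simp add: p_def)
    finally show ?thesis .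
  qed
  \<comment> \<open>\<open>e\<close> balances the slab term, of order \<open>e\<close>, against the
    Chebyshev term, of order \<open>\<delta>\<^sup>2 / e\<^sup>2\<close>. With slab half-width
    \<open>r * e\<close> the slab probability is free of \<open>r\<close>, and the factor
    \<open>r\<^sup>2\<close> with which a sign change enters the gradient cancels the
    \<open>r\<^sup>2\<close> in the Chebyshev denominator.\<close>
  define e where "e = \<delta> powr (2/3)"
  have e0: "e > 0" using \<delta> by (simp add: e_def)
  have e3: "e * e * e = \<delta>\<^sup>2"
  proof -
    have "e * e * e = \<delta> powr 2" unfolding e_def by (simp add: powr_add[symmetric])
    then show ?thesis using \<delta> by simp
  qed
  have e\<delta>: "\<delta>\<^sup>2 \<le> e"
  proof -
    have "\<delta> powr 2 \<le> \<delta> powr (2/3)" using \<delta> by (intro powr_mono') auto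
    then show ?thesis using \<delta> by (simp add: e_def)
  qed
  have "p \<le> 16 * (r * e) / r + q / (r * e)\<^sup>2"
    unfolding p_def q_def r_def using r0 e0 by (intro sign_change_prob) (auto simp: r_def)
  also have "\<dots> = 16 * e + q / (r * e)\<^sup>2" using r0 by simp
  finally have "r\<^sup>2 * p \<le> r\<^sup>2 * (16 * e + q / (r * e)\<^sup>2)" by (intro mult_left_mono) auto
  also have "\<dots> = r\<^sup>2 * (16 * e) + q / e\<^sup>2" using r0 e0 by (simp add: field_simps)
  also have "\<dots> \<le> 1 * (16 * e) + 5 * \<delta>\<^sup>2 / e\<^sup>2"
  proof (intro add_mono mult_right_mono divide_right_mono)
    show "r\<^sup>2 \<le> 1" using r0 r1 by (simp add: power_le_one)
    have "5 * \<delta>\<^sup>2 / d \<le> 5 * \<delta>\<^sup>2 / 1" using d by (intro divide_left_mono) auto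
    then show "q \<le> 5 * \<delta>\<^sup>2" using q by simp
  qed (use e0 in auto)
  also have "\<dots> = 21 * e" using e0 e3 by (simp add: field_simps power2_eq_square)
  finally have rp: "r\<^sup>2 * p \<le> 21 * e" .
  have "(\<Sum>j\<in>{..d}. LINT x|unif_cube d. (unit_jet d j (w, t) x - unit_jet d j (w', t') x)\<^sup>2)
     = (LINT x|unif_cube d. (unit_jet d 0 (w, t) x - unit_jet d 0 (w', t') x)\<^sup>2)
       + (\<Sum>i<d. LINT x|unif_cube d. (unit_jet d (Suc i) (w, t) x - unit_jet d (Suc i) (w', t') x)\<^sup>2)"
    by (rule sum.atMost_shift)
  also have "\<dots> \<le> q + (\<Sum>i<d. 2 * (w i)\<^sup>2 * p + 2 * (w i - w' i)\<^sup>2)"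
    using j0 ji by (intro add_mono sum_mono) auto
  also have "\<dots> = q + 2 * (r\<^sup>2 * p) + 2 * (\<Sum>i<d. (w i - w' i)\<^sup>2)"
    by (simp add: sum.distrib sum_distrib_left sum_distrib_right r_def norm2_sq mult.assoc)
  also have "\<dots> \<le> 5 * \<delta>\<^sup>2 + 2 * (21 * e) + 2 * (4 * \<delta>\<^sup>2)"
  proof -
    have "a * \<delta>\<^sup>2 / d \<le> a * \<delta>\<^sup>2 / 1" if "a \<ge> 0" for a using d that by (intro divide_left_mono) auto
    from this[of 5] this[of 4] show ?thesis using q v2 rp by simp
  qed
  \<comment> \<open>With \<open>\<delta>\<^sup>2 \<le> e\<close> the coefficients add up to 5 + 42 +
    8 = 55.\<close>
  also have "\<dots> \<le> 60 * e" using e\<delta> e0 by simp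
  finally show ?thesis by (simp add: e_def)
qed

section \<open>Quantizing the parameters\<close>

definition partial_norm1 :: "nat \<Rightarrow> point \<Rightarrow> real" where
  "partial_norm1 k w = (\<Sum>j<k. \<bar>w j\<bar>)"

definition quant :: "nat \<Rightarrow> real \<Rightarrow> point \<Rightarrow> nat \<Rightarrow> nat" where
  "quant d \<delta> w k = nat \<lfloor>partial_norm1 k w * d / \<delta>\<rfloor> + k"

text \<open>Quantizing the partial sums of \<open>\<bar>w i\<bar>\<close>, whose final value is known to be \<open>1\<close>, needs only
  \<open>d - 1\<close> values, and these form an increasing sequence once \<open>k\<close> is added: a \<open>(d - 1)\<close>-subset of
  an initial segment of the naturals.\<close>

definition cell_key :: "nat \<Rightarrow> real \<Rightarrow> point \<times> real \<Rightarrow> nat set \<times> nat set \<times> int" where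
  "cell_key d \<delta> p = ({i\<in>{..<d}. fst p i < 0}, quant d \<delta> (fst p) ` {1..<d},
      \<lfloor>(snd p + (\<Sum>i<d. fst p i) / 2) * sqrt d / \<delta>\<rfloor>)"

lemma partial_norm1_mono: "j \<le> k \<Longrightarrow> partial_norm1 j w \<le> partial_norm1 k w"
  unfolding partial_norm1_def by (rule sum_mono2) auto

lemma partial_norm1_nonneg: "0 \<le> partial_norm1 j w"
  unfolding partial_norm1_def by (rule sum_nonneg) auto

lemma quant_strict_mono: "\<delta> > 0 \<Longrightarrow> j < k \<Longrightarrow> quant d \<delta> w j < quant d \<delta> w k"
  unfolding quant_def
  by (intro add_le_less_mono nat_mono floor_mono divide_right_mono mult_right_mono partial_norm1_mono) auto

lemma floor_eq_dist: "\<lfloor>x\<rfloor> = \<lfloor>y\<rfloor> \<Longrightarrow> \<bar>x - y\<bar> < (1::real)"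
  by linarith

text \<open>The key stores only the set of values. A strictly increasing sequence is recovered from
  its range, as the sorted list of that set.\<close>

lemma quant_determined:
  assumes \<delta>: "\<delta> > 0" and eq: "quant d \<delta> w ` {1..<d} = quant d \<delta> w' ` {1..<d}" and k: "1 \<le> k" "k < d"
  shows "quant d \<delta> w k = quant d \<delta> w' k"
proof -
  let ?l = "\<lambda>w. map (quant d \<delta> w) [1..<d]"
  have s: "sorted_wrt (<) (?l v)" for v
    using quant_strict_mono[OF \<delta>] by (auto simp: sorted_wrt_map intro!: sorted_wrt_mono_rel[OF _ sorted_wrt_upt])
  have "?l w = ?l w'"
    by (rule strict_sorted_equal[OF s s]) (use eq in auto)
  then show ?thesis using k by simp
qed

text \<open>Equal signs turn the distance of two coordinates into that of their moduli, and a
  modulus is the difference of two consecutive partial sums, each known up to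
  \<open>\<delta> / d\<close>; hence the factor 2.\<close>

lemma cell_key_close:
  assumes \<delta>: "\<delta> > 0" and d: "d \<ge> 1" and w: "norm1 d w = 1" "norm1 d w' = 1"
    and key: "cell_key d \<delta> (w, t) = cell_key d \<delta> (w', t')"
  shows "\<And>i. i < d \<Longrightarrow> \<bar>w i - w' i\<bar> \<le> 2 * \<delta> / d"
    and "\<bar>(t + (\<Sum>i<d. w i) / 2) - (t' + (\<Sum>i<d. w' i) / 2)\<bar> \<le> \<delta> / sqrt d"
proof -
  have d0: "real d > 0" using d by simp
  have P: "\<bar>partial_norm1 k w - partial_norm1 k w'\<bar> \<le> \<delta> / d" if kd: "k \<le> d" for k
  proof -
    \<comment> \<open>At the two ends the partial sums are exactly 0 and 1, which is why the key can
      omit them.\<close>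
    consider "k = 0" | "k = d" | "1 \<le> k" "k < d" using kd by linarith
    then show ?thesis
    proof cases
      case 3
      have "quant d \<delta> w k = quant d \<delta> w' k"
        using key by (intro quant_determined[OF \<delta> _ 3]) (simp add: cell_key_def)
      moreover have "partial_norm1 k v * d / \<delta> \<ge> 0" for v using \<delta> partial_norm1_nonneg by simp
      ultimately have "\<lfloor>partial_norm1 k w * d / \<delta>\<rfloor> = \<lfloor>partial_norm1 k w' * d / \<delta>\<rfloor>"
        unfolding quant_def using nat_eq_iff2 by (metis add_right_cancel eq_nat_nat_iff floor_mono of_int_0_le_iff zero_le_floor)
      from floor_eq_dist[OF this] have "\<bar>(partial_norm1 k w - partial_norm1 k w') * (d / \<delta>)\<bar> < 1"
        by (simp only: left_diff_distrib times_divide_eq_right diff_divide_distrib)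
      then have "\<bar>partial_norm1 k w - partial_norm1 k w'\<bar> * (d / \<delta>) < 1"
        using d0 \<delta> by (simp add: abs_mult)
      then show ?thesis using d0 \<delta> by (simp add: field_simps)
    qed (use w \<delta> in \<open>auto simp: partial_norm1_def norm1_def\<close>)
  qed
  fix i assume i: "i < d"
  have "(w i < 0) = (w' i < 0)" using key i by (auto simp: cell_key_def)
  then have "\<bar>w i - w' i\<bar> = \<bar>\<bar>w i\<bar> - \<bar>w' i\<bar>\<bar>" by auto
  also have "\<bar>w i\<bar> = partial_norm1 (Suc i) w - partial_norm1 i w" by (simp add: partial_norm1_def)
  also have "\<bar>w' i\<bar> = partial_norm1 (Suc i) w' - partial_norm1 i w'" by (simp add: partial_norm1_def)
  finally show "\<bar>w i - w' i\<bar> \<le> 2 * \<delta> / d" using P[of i] P[of "Suc i"] i by simp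
next
  have d0: "real d > 0" using d by simp
  let ?s = "\<lambda>w t. t + (\<Sum>i<d. w i) / 2"
  have "\<lfloor>?s w t * sqrt d / \<delta>\<rfloor> = \<lfloor>?s w' t' * sqrt d / \<delta>\<rfloor>" using key by (simp add: cell_key_def)
  from floor_eq_dist[OF this] have "\<bar>(?s w t - ?s w' t') * (sqrt d / \<delta>)\<bar> < 1"
    by (simp only: left_diff_distrib times_divide_eq_right diff_divide_distrib)
  then have "\<bar>?s w t - ?s w' t'\<bar> * (sqrt d / \<delta>) < 1"
    using d0 \<delta> by (simp add: abs_mult)
  then show "\<bar>?s w t - ?s w' t'\<bar> \<le> \<delta> / sqrt d" using d0 \<delta> by (simp add: field_simps)
qed

section \<open>Counting the cells\<close>

lemma power_self_le: "real d ^ d \<le> 3 ^ d * fact d"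
proof -
  have "real d ^ d / fact d \<le> (\<Sum>n. real d ^ n / fact n)"
    using sum_le_suminf[of "\<lambda>n. real d ^ n / fact n" "{d}"] summable_exp[of "real d"]
    by (simp add: divide_inverse mult.commute)
  also have "\<dots> = exp (real d)" by (simp add: exp_def divide_inverse mult.commute)
  also have "\<dots> = exp 1 ^ d" by (simp add: exp_of_nat_mult[symmetric])
  also have "\<dots> \<le> 3 ^ d" using exp_le by (intro power_mono) auto
  finally show ?thesis by (simp add: field_simps)
qed

text \<open>The factorial in the binomial coefficient absorbs \<open>d ^ (d - 1)\<close> up to the
  factor \<open>3 ^ d\<close>, because a single term of the exponential series at \<open>d\<close>
  is at most \<open>exp (real d)\<close>. What remains is exponential in \<open>d\<close>.\<close>

lemma binomial_bound:
  assumes "d \<ge> 1" "0 < \<delta>" "\<delta> \<le> 1" "real n \<le> 2 * real d / \<delta>"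
  shows "real (n choose (d - 1)) \<le> 3 ^ d * (2 / \<delta>) ^ (d - 1)"
proof -
  obtain e where d: "d = Suc e" using assms(1) by (cases d) auto
  have "real (n choose e) * fact e \<le> real n ^ e"
    using binomial_fact_pow[of n e] by (metis of_nat_fact of_nat_le_iff of_nat_mult of_nat_power)
  also have "\<dots> \<le> (2 * d / \<delta>) ^ e" using assms by (intro power_mono) auto
  also have "\<dots> = real d ^ e * (2 / \<delta>) ^ e" by (simp add: power_divide power_mult_distrib)
  also have "\<dots> \<le> (3 ^ d * fact e) * (2 / \<delta>) ^ e"
  proof (rule mult_right_mono)
    \<comment> \<open>The estimate for \<open>d ^ d\<close> is divided by \<open>d\<close>, the
      exponent here being one less.\<close>
    have "real d * real d ^ e \<le> 3 ^ d * (real d * fact e)" using power_self_le[of d] by (simp add: d)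
    then have "real d * real d ^ e \<le> real d * (3 ^ d * fact e)" by (simp add: mult_ac)
    then show "real d ^ e \<le> 3 ^ d * fact e" by (rule mult_left_le_imp_le) (simp add: d)
  qed (use assms in auto)
  finally have "real (n choose e) * fact e \<le> (3 ^ d * (2 / \<delta>) ^ e) * fact e" by (simp add: mult_ac)
  then have "real (n choose e) \<le> 3 ^ d * (2 / \<delta>) ^ e" by (rule mult_right_le_imp_le) simp
  then show ?thesis by (simp add: d)
qed

lemma cell_keys_finite:
  assumes d: "d \<ge> 1" and \<delta>: "0 < \<delta>" "\<delta> \<le> 1"
  shows "\<exists>G. finite G \<and> real (card G) \<le> (48 / \<delta>) ^ d \<and>
     (\<forall>w t. norm1 d w = 1 \<longrightarrow> - 1 \<le> t \<longrightarrow> t \<le> 0 \<longrightarrow> cell_key d \<delta> (w, t) \<in> G)"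
proof -
  \<comment> \<open>For \<open>k < d\<close> the floor in \<open>quant\<close> is at most
    \<open>\<lfloor>d / \<delta>\<rfloor>\<close>, since partial sums are at most 1, and the shift
    adds at most \<open>d - 1\<close>; so all values stay below \<open>n\<close>.\<close>
  define n where "n = nat \<lfloor>d / \<delta>\<rfloor> + d"
  define G2 where "G2 = {S. S \<subseteq> {..<n} \<and> card S = d - 1}"
  \<comment> \<open>For \<open>-1 \<le> t \<le> 0\<close> the recentred offset lies between -3/2 and
    1/2, because the sum of the \<open>w i\<close> has modulus at most 1.\<close>
  define G3 where "G3 = {\<lfloor>- 3/2 * sqrt d / \<delta>\<rfloor>..\<lfloor>1/2 * sqrt d / \<delta>\<rfloor>}"
  define G where "G = Pow {..<d} \<times> G2 \<times> G3"
  have d0: "real d \<ge> 1" using d by simp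
  have n: "real n \<le> 2 * real d / \<delta>"
  proof -
    have "real d \<le> d / \<delta>" using \<delta> d0 by (simp add: field_simps)
    moreover have "real n \<le> d / \<delta> + d" unfolding n_def using \<delta> by simp
    ultimately show ?thesis by simp
  qed
  have fG: "finite G" by (simp add: G_def G2_def G3_def)
  have sd: "1 \<le> sqrt d / \<delta>" using d0 \<delta> by (simp add: field_simps order_trans[of \<delta> 1])
  have "real (card G3) \<le> 4 * (sqrt d / \<delta>)"
    unfolding G3_def using sd by (simp add: of_nat_diff) linarith
  moreover have "sqrt d \<le> 2 ^ d"
  proof -
    have "real d \<le> 2 ^ d" using of_nat_less_two_power[of d] by (simp add: less_imp_le)
    also have "\<dots> \<le> (2 ^ d)\<^sup>2" by (simp add: power2_eq_square)
    finally show ?thesis by (simp add: real_le_lsqrt)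
  qed
  ultimately have G3: "real (card G3) \<le> 4 * (2 ^ d / \<delta>)"
    using \<delta> by (meson divide_right_mono less_imp_le mult_left_mono order_trans zero_le_numeral)
  have G2: "real (card G2) \<le> 3 ^ d * (2 / \<delta>) ^ (d - 1)"
    unfolding G2_def using binomial_bound[OF d \<delta> n] n_subsets[of "{..<n}" "d - 1"] by simp
  have "real (card G) = 2 ^ d * (real (card G2) * real (card G3))"
    by (simp add: G_def card_cartesian_product card_Pow)
  also have "\<dots> \<le> 2 ^ d * ((3 ^ d * (2 / \<delta>) ^ (d - 1)) * (4 * (2 ^ d / \<delta>)))"
    using G2 G3 \<delta> by (intro mult_left_mono mult_mono) auto
  also have "\<dots> = 2 ^ d * 3 ^ d * 2 ^ d * 2 * (2 / \<delta>) ^ d"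
    using d by (cases d) (auto simp: field_simps)
  also have "\<dots> \<le> 2 ^ d * 3 ^ d * 2 ^ d * 2 ^ d * (2 / \<delta>) ^ d"
    using d \<delta> self_le_power[of "2::real" d] by (intro mult_right_mono mult_left_mono) auto
  \<comment> \<open>48 = 2 * 3 * 2 * 2 * 2: the signs, the binomial bound,
    \<open>sqrt d \<le> 2 ^ d\<close>, a left-over factor 2 raised to \<open>2 ^ d\<close>, and the
    numerator of \<open>2 / \<delta>\<close>.\<close>
  also have "\<dots> = (48 / \<delta>) ^ d"
    by (simp add: power_mult_distrib[symmetric] power_divide[symmetric])
  finally have cG: "real (card G) \<le> (48 / \<delta>) ^ d" .
  have "cell_key d \<delta> (w, t) \<in> G" if w: "norm1 d w = 1" and t: "-1 \<le> t" "t \<le> 0" for w t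
  proof -
    have "quant d \<delta> w k < n" if "k < d" for k
    proof -
      have "partial_norm1 k w \<le> 1"
        using partial_norm1_mono[of k d w] that w by (simp add: partial_norm1_def norm1_def)
      then have "partial_norm1 k w * d / \<delta> \<le> d / \<delta>"
        using d0 \<delta> by (intro divide_right_mono) (auto intro: mult_left_le_one_le partial_norm1_nonneg)
      then have "nat \<lfloor>partial_norm1 k w * d / \<delta>\<rfloor> \<le> nat \<lfloor>d / \<delta>\<rfloor>" by (intro nat_mono floor_mono)
      then show ?thesis using that by (simp add: quant_def n_def)
    qed
    moreover have "inj_on (quant d \<delta> w) {1..<d}"
      by (rule strict_mono_on_imp_inj_on, rule strict_mono_onI) (use quant_strict_mono[OF \<delta>(1)] in auto)
    then have "card (quant d \<delta> w ` {1..<d}) = d - 1" by (simp add: card_image)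
    moreover have "\<bar>\<Sum>i<d. w i\<bar> \<le> 1" using w sum_abs[of "\<lambda>i. w i" "{..<d}"] unfolding norm1_def by linarith
    then have "-3/2 \<le> t + (\<Sum>i<d. w i) / 2" "t + (\<Sum>i<d. w i) / 2 \<le> 1/2" using t by auto
    then have "-3/2 * sqrt d / \<delta> \<le> (t + (\<Sum>i<d. w i) / 2) * sqrt d / \<delta>"
       "(t + (\<Sum>i<d. w i) / 2) * sqrt d / \<delta> \<le> 1/2 * sqrt d / \<delta>"
      using \<delta> by (intro divide_right_mono mult_right_mono; simp)+
    ultimately show ?thesis
      by (auto simp: G_def G2_def G3_def cell_key_def intro!: floor_mono)
  qed
  with fG cG show ?thesis by blast
qed

lemma cell_measurable:
  "{p\<in>space (lborel_pow d \<Otimes>\<^sub>M borel). cell_key d \<delta> p = c} \<in> sets (lborel_pow d \<Otimes>\<^sub>M (borel :: real measure))"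
proof -
  obtain c1 c2 c3 where c: "c = (c1, c2, c3)" by (cases c) auto
  have w[measurable]: "(\<lambda>p. fst p i) \<in> borel_measurable (lborel_pow d \<Otimes>\<^sub>M (borel :: real measure))" if "i < d" for i
    by (rule measurable_compose[OF measurable_fst lborel_pow_component]) (use that in simp)
  have P[measurable]: "(\<lambda>p. partial_norm1 k (fst p)) \<in> borel_measurable (lborel_pow d \<Otimes>\<^sub>M (borel :: real measure))" if "k \<le> d" for k
    unfolding partial_norm1_def using that by (intro borel_measurable_sum borel_measurable_abs w) auto
  have Q[measurable]: "(\<lambda>p. quant d \<delta> (fst p) k) \<in> measurable (lborel_pow d \<Otimes>\<^sub>M (borel :: real measure)) (count_space UNIV)" if "k \<in> {1..<d}" for k
  proof -
    note [measurable] = P[of k]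
    have [simp]: "k \<le> d" using that by simp
    show ?thesis unfolding quant_def by measurable
  qed
  have S[measurable]: "(\<lambda>p. (snd p + (\<Sum>i<d. fst p i) / 2)) \<in> borel_measurable (lborel_pow d \<Otimes>\<^sub>M (borel :: real measure))"
    by (intro borel_measurable_add borel_measurable_divide borel_measurable_sum w) auto
  \<comment> \<open>The equalities of sets are spelled out as membership conditions under countable
    quantifiers, each of them measurable.\<close>
  have "cell_key d \<delta> p = c \<longleftrightarrow>
     (c1 \<subseteq> {..<d} \<and> (\<forall>i\<in>{..<d}. (fst p i < 0) = (i \<in> c1))) \<and>
     ((\<forall>k\<in>{1..<d}. quant d \<delta> (fst p) k \<in> c2) \<and> (\<forall>s\<in>c2. \<exists>k\<in>{1..<d}. quant d \<delta> (fst p) k = s)) \<and>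
     \<lfloor>(snd p + (\<Sum>i<d. fst p i) / 2) * sqrt d / \<delta>\<rfloor> = c3" for p
    unfolding c cell_key_def by auto
  then show ?thesis
    by simp
qed

section \<open>Weak derivatives\<close>

lemma test_function_line:
  assumes \<phi>: "\<phi> \<in> test_functions d (unit_cube d)" and i: "i < d" and x: "x \<in> Rn d"
  shows "((\<lambda>t. \<phi> (x(i := t))) has_real_derivative partial_deriv i \<phi> (x(i := t))) (at t)"
proof -
  have xt: "x(i := t) \<in> Rn d" using x i by (auto simp: Rn_def PiE_iff extensional_def)
  have "smooth d \<phi>" using \<phi> by (simp add: test_functions_def)
  then have "(\<lambda>t'. foldr partial_deriv [] \<phi> ((x(i := t))(i := t'))) field_differentiable at ((x(i := t)) i)"
    unfolding smooth_def using xt i by (metis empty_set empty_subsetI)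
  then have "(\<lambda>t'. \<phi> (x(i := t'))) field_differentiable at t" by simp
  then show ?thesis
    unfolding partial_deriv_def using DERIV_deriv_iff_field_differentiable by fastforce
qed

text \<open>The complement of the compact support is open and meets each coordinate line in an open
  set, so \<phi> vanishes locally along the line and its derivative vanishes with it.\<close>

lemma test_function_support:
  assumes \<phi>: "\<phi> \<in> test_functions d (unit_cube d)"
  obtains K where "compact K" "K \<subseteq> unit_cube d" "\<And>x. x \<in> Rn d - K \<Longrightarrow> \<phi> x = 0"
    "\<And>x i. x \<in> Rn d - K \<Longrightarrow> i < d \<Longrightarrow> partial_deriv i \<phi> x = 0"
proof -
  obtain K where K: "compact K" "K \<subseteq> unit_cube d" "\<And>x. x \<in> Rn d - K \<Longrightarrow> \<phi> x = 0"
    using \<phi> by (auto simp: test_functions_def)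
  have "partial_deriv i \<phi> x = 0" if x: "x \<in> Rn d - K" and i: "i < d" for x i
  proof -
    have "open (- K)" using K compact_imp_closed by auto
    moreover have "continuous_on UNIV (\<lambda>t. x(i := t))"
    proof (rule continuous_on_coordinatewise_then_product)
      show "continuous_on UNIV (\<lambda>t. (x(i := t)) j)" for j
        by (cases "j = i") auto
    qed
    ultimately have "open ((\<lambda>t. x(i := t)) -` (- K))" by (rule open_vimage)
    then have "eventually (\<lambda>t. t \<in> (\<lambda>t. x(i := t)) -` (- K)) (nhds (x i))"
      using x by (intro eventually_nhds_in_open) auto
    then have "eventually (\<lambda>t. \<phi> (x(i := t)) = 0) (nhds (x i))"
    proof (rule eventually_mono)
      fix t assume "t \<in> (\<lambda>t. x(i := t)) -` (- K)"
      moreover have "x(i := t) \<in> Rn d" using x i by (auto simp: Rn_def PiE_iff extensional_def)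
      ultimately show "\<phi> (x(i := t)) = 0" using K by auto
    qed
    then have "((\<lambda>t. \<phi> (x(i := t))) has_real_derivative 0) (at (x i))"
      using DERIV_cong_ev[OF refl _ refl, of "\<lambda>t. \<phi> (x(i := t))" "\<lambda>_. 0" "x i" 0] by simp
    then show ?thesis unfolding partial_deriv_def by (rule DERIV_imp_deriv)
  qed
  with K that show ?thesis by blast
qed

text \<open>Continuity refers to the topology of all of \<open>nat \<Rightarrow> real\<close>,
  measurability to the product over \<open>{..<d}\<close>. The inclusion is Borel because the
  remaining coordinates are constantly \<open>undefined\<close>, and \<open>Rn d\<close> is closed,
  so extension by 0 keeps the function Borel.\<close>

lemma continuous_on_Rn_measurable:
  fixes f :: "point \<Rightarrow> real"
  assumes "continuous_on (Rn d) f"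
  shows "f \<in> borel_measurable (lborel_pow d)"
proof -
  have id: "(\<lambda>x. x) \<in> borel_measurable (lborel_pow d)"
  proof (rule measurable_coordinatewise_then_product)
    fix i
    show "(\<lambda>x. x i) \<in> borel_measurable (lborel_pow d)"
    proof (cases "i < d")
      case True
      then show ?thesis using lborel_pow_component[of i d] by simp
    next
      case False
      then have "(\<lambda>x. x i) \<in> borel_measurable (lborel_pow d) \<longleftrightarrow> (\<lambda>x. undefined :: real) \<in> borel_measurable (lborel_pow d)"
        by (intro measurable_cong) (auto simp: Rn_def PiE_iff extensional_def)
      then show ?thesis by simp
    qed
  qed
  have eq: "Rn d = {x. \<forall>i. i \<notin> {..<d} \<longrightarrow> x i = undefined}"
    by (auto simp: Rn_def PiE_iff extensional_def)
  have "closed (Rn d)"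
  proof -
    have "Rn d = (\<Inter>i\<in>-{..<d}. (\<lambda>x. x i) -` {undefined})" unfolding eq by auto
    moreover have "closed ((\<lambda>x::point. x i) -` {undefined})" for i
      by (intro closed_vimage closed_singleton continuous_on_product_coordinates)
    ultimately show ?thesis by auto
  qed
  then have "Rn d \<in> sets borel" by simp
  then have "(\<lambda>x. if x \<in> Rn d then f x else 0) \<in> borel_measurable borel"
    using assms by (rule borel_measurable_continuous_on_if) auto
  from measurable_compose[OF id this]
  have "(\<lambda>x. if x \<in> Rn d then f x else 0) \<in> borel_measurable (lborel_pow d)" .
  then show ?thesis by (subst measurable_cong[where g="\<lambda>x. if x \<in> Rn d then f x else 0"]) auto
qed

lemma test_function_regular:
  assumes \<phi>: "\<phi> \<in> test_functions d (unit_cube d)"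
  shows "\<phi> \<in> borel_measurable (lborel_pow d)"
    and "i < d \<Longrightarrow> partial_deriv i \<phi> \<in> borel_measurable (lborel_pow d)"
    and "\<exists>B. \<forall>x\<in>Rn d. \<bar>\<phi> x\<bar> \<le> B"
    and "i < d \<Longrightarrow> \<exists>B. \<forall>x\<in>Rn d. \<bar>partial_deriv i \<phi> x\<bar> \<le> B"
proof -
  have sm: "\<And>js. set js \<subseteq> {..<d} \<Longrightarrow> continuous_on (Rn d) (foldr partial_deriv js \<phi>)"
    using \<phi> by (auto simp: test_functions_def smooth_def)
  have c0: "continuous_on (Rn d) \<phi>" using sm[of "[]"] by simp
  have c1: "continuous_on (Rn d) (partial_deriv i \<phi>)" if "i < d" for i using sm[of "[i]"] that by simp
  show "\<phi> \<in> borel_measurable (lborel_pow d)" "i < d \<Longrightarrow> partial_deriv i \<phi> \<in> borel_measurable (lborel_pow d)"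
    using c0 c1 continuous_on_Rn_measurable by auto
  obtain K where K: "compact K" "K \<subseteq> unit_cube d" "\<And>x. x \<in> Rn d - K \<Longrightarrow> \<phi> x = 0"
    "\<And>x i. x \<in> Rn d - K \<Longrightarrow> i < d \<Longrightarrow> partial_deriv i \<phi> x = 0"
    by (rule test_function_support[OF \<phi>]) blast
  have b: "\<exists>B. \<forall>x\<in>Rn d. \<bar>g x\<bar> \<le> B" if "continuous_on (Rn d) g" "\<And>x. x \<in> Rn d - K \<Longrightarrow> g x = 0" for g :: "point \<Rightarrow> real"
  proof -
    have "continuous_on K g" using that(1) K(2) unit_cube_subset_Rn by (meson continuous_on_subset subset_trans)
    then have "compact (g ` K)" using K(1) by (rule compact_continuous_image)
    then obtain B where "\<forall>y\<in>g ` K. norm y \<le> B" using compact_imp_bounded bounded_iff by meson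
    have "\<bar>g x\<bar> \<le> max B 0" if x: "x \<in> Rn d" for x
    proof (cases "x \<in> K")
      case True
      then have "norm (g x) \<le> B" using \<open>\<forall>y\<in>g ` K. norm y \<le> B\<close> by blast
      then show ?thesis by simp
    next
      case False
      then have "g x = 0" using x by (intro \<open>\<And>x. x \<in> Rn d - K \<Longrightarrow> g x = 0\<close>) simp
      then show ?thesis by simp
    qed
    then have "\<forall>x\<in>Rn d. \<bar>g x\<bar> \<le> max B 0" by blast
    then show ?thesis ..
  qed
  show "\<exists>B. \<forall>x\<in>Rn d. \<bar>\<phi> x\<bar> \<le> B" using b[OF c0] K by auto
  show "i < d \<Longrightarrow> \<exists>B. \<forall>x\<in>Rn d. \<bar>partial_deriv i \<phi> x\<bar> \<le> B" using b[OF c1] K by auto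
qed

lemma relu_integration_by_parts_line:
  fixes \<psi> \<psi>' :: "real \<Rightarrow> real"
  assumes \<psi>: "\<And>t. (\<psi> has_real_derivative \<psi>' t) (at t)" and z: "\<psi> 0 = 0" "\<psi> 1 = 0"
  shows "((\<lambda>s. relu (a * s + c) * \<psi>' s + a * indicator {0<..} (a * s + c) * \<psi> s) has_integral 0) {0..1}"
proof -
  \<comment> \<open>The kink of the unit on this line, where the derivative fails; for
    \<open>a = 0\<close> the unit is constant along the line.\<close>
  define S where "S = (if a = 0 then {} else {- c / a})"
  have "((\<lambda>s. relu (a * s + c) * \<psi>' s + a * indicator {0<..} (a * s + c) * \<psi> s) has_integral
      (relu (a * 1 + c) * \<psi> 1 - relu (a * 0 + c) * \<psi> 0)) {0..1}"
  proof (rule fundamental_theorem_of_calculus_interior_strong[where S=S])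
    show "finite S" by (simp add: S_def)
    have "continuous_on {0..1} \<psi>"
      by (rule continuous_at_imp_continuous_on) (use DERIV_isCont[OF \<psi>] in blast)
    then show "continuous_on {0..1} (\<lambda>s. relu (a * s + c) * \<psi> s)"
      unfolding relu_def by (intro continuous_intros)
    fix s assume s: "s \<in> {0<..<1} - S"
    have aff: "((\<lambda>s. a * s + c) has_real_derivative a) (at s)" by (auto intro!: derivative_eq_intros)
    have "((\<lambda>s. relu (a * s + c)) has_real_derivative a * indicator {0<..} (a * s + c)) (at s)"
    proof (cases "a = 0")
      case False
      then have "a * s + c \<noteq> 0" using s by (auto simp: S_def field_simps add_eq_0_iff)
      then consider "a * s + c > 0" | "a * s + c < 0" by linarith
      then show ?thesis
      proof cases
        case 1
        have "eventually (\<lambda>s. a * s + c > 0) (nhds s)"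
          using 1 by (intro order_tendstoD(1)[OF _ 1] tendsto_intros filterlim_ident)
        then have ev: "eventually (\<lambda>s. relu (a * s + c) = a * s + c) (nhds s)"
          by (rule eventually_mono) (simp add: relu_def)
        show ?thesis using aff 1 by (subst DERIV_cong_ev[OF refl ev refl]) simp
      next
        case 2
        have "eventually (\<lambda>s. a * s + c < 0) (nhds s)"
          using 2 by (intro order_tendstoD(2)[OF _ 2] tendsto_intros filterlim_ident)
        then have ev: "eventually (\<lambda>s. relu (a * s + c) = 0) (nhds s)"
          by (rule eventually_mono) (simp add: relu_def)
        show ?thesis using 2 by (subst DERIV_cong_ev[OF refl ev refl]) simp
      qed
    qed simp
    from DERIV_mult[OF this \<psi>[of s]]
    show "((\<lambda>s. relu (a * s + c) * \<psi> s) has_vector_derivative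
        relu (a * s + c) * \<psi>' s + a * indicator {0<..} (a * s + c) * \<psi> s) (at s)"
      by (simp add: has_real_derivative_iff_has_vector_derivative add_ac mult_ac)
  qed simp
  with z show ?thesis by simp
qed

lemma integral_unif_eq_0:
  fixes f :: "real \<Rightarrow> real"
  assumes f: "f \<in> borel_measurable borel" "\<And>t. \<bar>f t\<bar> \<le> B" and i: "(f has_integral 0) {0..1}"
  shows "(LINT t|unif. f t) = 0"
proof -
  have "set_integrable lborel {0..1} f"
    unfolding set_integrable_def
    by (rule integrableI_bounded_set_indicator[where B=B]) (use f in auto)
  from set_borel_integral_eq_integral(2)[OF this] i show ?thesis
    by (simp add: integral_unif[OF f(1)] integral_unique)
qed

text \<open>Averaging over coordinate \<open>i\<close> first reduces the identity to the fundamental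
  theorem on coordinate segments, where the boundary terms vanish together with \<phi>.\<close>

lemma unit_jet_integration_by_parts:
  assumes \<phi>: "\<phi> \<in> test_functions d (unit_cube d)" and i: "i < d" and w: "norm1 d w = 1" "\<bar>t\<bar> \<le> 1"
  shows "(LINT x|unif_cube d. unit_jet d 0 (w, t) x * partial_deriv i \<phi> x)
       = - (LINT x|unif_cube d. unit_jet d (Suc i) (w, t) x * \<phi> x)"
proof -
  note r = test_function_regular[OF \<phi>]
  note [measurable] = r(1) r(2)[OF i]
  obtain B0 where B0: "\<forall>x\<in>Rn d. \<bar>\<phi> x\<bar> \<le> B0" using r(3) by auto
  obtain B1 where B1: "\<forall>x\<in>Rn d. \<bar>partial_deriv i \<phi> x\<bar> \<le> B1" using r(4)[OF i] by auto
  obtain K where K: "compact K" "K \<subseteq> unit_cube d" "\<And>x. x \<in> Rn d - K \<Longrightarrow> \<phi> x = 0"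
    by (rule test_function_support[OF \<phi>]) blast
  define g where "g x = relu (dot d w x + t) * partial_deriv i \<phi> x + w i * indicator {0<..} (dot d w x + t) * \<phi> x" for x
  have Rnu: "x(i := s) \<in> Rn d" if "x \<in> Rn d" for x s using that i by (auto simp: Rn_def PiE_iff extensional_def)
  have wi: "\<bar>w i\<bar> \<le> 1" unfolding w(1)[symmetric] norm1_def using i by (intro member_le_sum) auto
  have rb: "\<bar>relu (dot d w x + t)\<bar> \<le> 2" if "x \<in> unit_cube d" for x
    using abs_dot_le[OF that, of w] w by (auto simp: relu_def)
  have gb: "\<bar>g x\<bar> \<le> 2 * B1 + B0" if x: "x \<in> unit_cube d" for x
  proof -
    have xR: "x \<in> Rn d" using x unit_cube_subset_Rn by auto
    have "\<bar>relu (dot d w x + t) * partial_deriv i \<phi> x\<bar> \<le> 2 * B1"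
      unfolding abs_mult using rb[OF x] B1 xR by (intro mult_mono) auto
    moreover have "\<bar>w i * indicator {0<..} (dot d w x + t) * \<phi> x\<bar> \<le> 1 * 1 * B0"
      unfolding abs_mult using wi B0 xR by (intro mult_mono) (auto simp: indicator_def)
    ultimately show ?thesis unfolding g_def by linarith
  qed
  have [measurable]: "g \<in> borel_measurable (lborel_pow d)" unfolding g_def by measurable
  have "(LINT x|unif_cube d. g x) = (LINT x|unif_cube d. LINT s|unif. g (x(i := s)))"
    using gb by (intro unif_cube_average_coordinate(2) i) auto
  also have "\<dots> = (LINT x|unif_cube d. 0)"
  proof (rule integral_cong_AE)
    show "AE x in unif_cube d. (LINT s|unif. g (x(i := s))) = 0"
      using AE_unif_cube
    proof eventually_elim
      fix x assume x: "x \<in> unit_cube d"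
      have xR: "x \<in> Rn d" using x unit_cube_subset_Rn by auto
      define c where "c = dot d w (x(i := 0)) + t"
      have dots: "dot d w (x(i := s)) + t = w i * s + c" for s
        using i by (simp add: dot_def sum.remove[of "{..<d}" i] c_def)
      \<comment> \<open>The end points 0 and 1 of the segment lie outside the open cube, hence
        outside the support: these are the boundary values of the one-dimensional identity.\<close>
      have nz: "x(i := s) \<in> Rn d - K" if "s \<notin> {0<..<1}" for s
      proof -
        have "x(i := s) \<notin> unit_cube d"
        proof
          assume "x(i := s) \<in> unit_cube d"
          then have "(x(i := s)) i \<in> {0<..<1}" unfolding unit_cube_def by (rule PiE_mem) (use i in simp)
          with that show False by simp
        qed
        then show ?thesis using Rnu[OF xR] K(2) by blast
      qed
      have hi: "((\<lambda>s. g (x(i := s))) has_integral 0) {0..1}"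
        using relu_integration_by_parts_line[OF test_function_line[OF \<phi> i xR], of "w i" c] K(3)[OF nz]
        by (simp add: g_def dots)
      have gm: "(\<lambda>s. g (x(i := s))) \<in> borel_measurable borel"
      proof -
        have "x \<in> space (lborel_pow d)" using xR by simp
        from measurable_compose[OF measurable_Pair1'[OF this] measurable_compose[OF measurable_upd[OF i] \<open>g \<in> _\<close>]]
        show ?thesis by simp
      qed
      \<comment> \<open>\<open>g\<close> is bounded only over the cube, whereas
        \<open>integral_unif_eq_0\<close> asks for a bound on the whole line.\<close>
      have "(LINT s|unif. g (x(i := s))) = (LINT s|unif. indicator {0<..<1} s * g (x(i := s)))"
      proof (rule integral_cong_AE)
        show "AE s in unif. g (x(i := s)) = indicator {0<..<1} s * g (x(i := s))"
          using AE_unif by eventually_elim simp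
      qed (use gm in measurable)
      also have "\<dots> = 0"
      proof (rule integral_unif_eq_0)
        show "\<bar>indicator {0<..<1} s * g (x(i := s))\<bar> \<le> \<bar>2 * B1 + B0\<bar>" for s
          using gb[OF unit_cube_fun_upd[OF x i, of s]] by (auto simp: indicator_def)
        show "((\<lambda>s. indicator {0<..<1} s * g (x(i := s))) has_integral 0) {0..1}"
          using hi by (rule has_integral_spike_finite[of "{0,1}", rotated 2]) auto
      qed (use gm in measurable)
      finally show "(LINT s|unif. g (x(i := s))) = 0" .
    qed
    show "(\<lambda>x. LINT s|unif. g (x(i := s))) \<in> borel_measurable (unif_cube d)"
      by (rule borel_measurable_integrable, rule unif_cube_average_coordinate(1)[where B="2 * B1 + B0"]) (use gb i in auto)
  qed simp
  finally have z: "(LINT x|unif_cube d. g x) = 0" by simp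
  let ?a = "\<lambda>x. unit_jet d 0 (w, t) x * partial_deriv i \<phi> x" and ?b = "\<lambda>x. unit_jet d (Suc i) (w, t) x * \<phi> x"
  have ia: "integrable (unif_cube d) ?a"
  proof (rule integrable_unif_cube_bounded[where B="2 * B1"])
    show "norm (?a x) \<le> 2 * B1" if "x \<in> unit_cube d" for x
      using that unit_cube_subset_Rn unfolding norm_mult
      by (intro mult_mono) (use B1 unit_jet_bound[OF w, of 0 x] in auto)
  qed (simp add: unit_jet_def)
  have ib: "integrable (unif_cube d) ?b"
  proof (rule integrable_unif_cube_bounded[where B="2 * B0"])
    show "norm (?b x) \<le> 2 * B0" if "x \<in> unit_cube d" for x
      using that unit_cube_subset_Rn unfolding norm_mult
      by (intro mult_mono) (use B0 unit_jet_bound[OF w, of "Suc i" x] i in auto)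
  qed (simp add: unit_jet_def)
  have "(LINT x|unif_cube d. ?a x + ?b x) = (LINT x|unif_cube d. g x)"
  proof (rule integral_cong_AE)
    show "AE x in unif_cube d. ?a x + ?b x = g x"
      using AE_unif_cube by eventually_elim (simp add: unit_jet_def g_def)
  qed (use ia ib in auto)
  then show ?thesis using ia ib z by simp
qed

text \<open>A function bundled with a chosen weak gradient, all components bounded. The identity is
  linear in \<open>E\<close>, so the class is closed under finite combinations and, by Fubini, under
  mixtures; in this way the target and the error acquire weak gradients without differentiating
  under an integral sign.\<close>

definition weak_jet :: "nat \<Rightarrow> (nat \<Rightarrow> point \<Rightarrow> real) \<Rightarrow> bool" where
  "weak_jet d E \<longleftrightarrow> (\<forall>j\<le>d. E j \<in> borel_measurable (lborel_pow d)) \<and> (\<exists>B. \<forall>j\<le>d. \<forall>x. \<bar>E j x\<bar> \<le> B) \<and>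
     (\<forall>i<d. \<forall>\<phi>\<in>test_functions d (unit_cube d).
        (LINT x|unif_cube d. E 0 x * partial_deriv i \<phi> x) = - (LINT x|unif_cube d. E (Suc i) x * \<phi> x))"

lemma unit_jet_measurable1:
  assumes "j \<le> d" "w \<in> Rn d"
  shows "unit_jet d j (w, t) \<in> borel_measurable (lborel_pow d)"
proof -
  have "(w, t) \<in> space (lborel_pow d \<Otimes>\<^sub>M borel)" using assms by (simp add: space_pair_measure)
  from measurable_compose[OF measurable_Pair1'[OF this] unit_jet_measurable[OF assms(1)]]
  show ?thesis by simp
qed

lemma weak_jet_unit:
  assumes "norm1 d w = 1" "\<bar>t\<bar> \<le> 1" "w \<in> Rn d"
  shows "weak_jet d (\<lambda>j. unit_jet d j (w, t))"
  unfolding weak_jet_def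
proof (intro conjI allI impI ballI)
  show "unit_jet d j (w, t) \<in> borel_measurable (lborel_pow d)" if "j \<le> d" for j
    using that assms by (intro unit_jet_measurable1)
  show "\<exists>B. \<forall>j\<le>d. \<forall>x. \<bar>unit_jet d j (w, t) x\<bar> \<le> B"
    using unit_jet_bound[OF assms(1,2)] by (intro exI[of _ 2]) simp
qed (rule unit_jet_integration_by_parts[OF _ _ assms(1,2)])

lemma weak_jet_product_integrable:
  assumes "weak_jet d E" "j \<le> d" "g \<in> borel_measurable (lborel_pow d)" "\<exists>B. \<forall>x\<in>Rn d. \<bar>g x\<bar> \<le> B"
  shows "integrable (unif_cube d) (\<lambda>x. E j x * g x)"
proof -
  obtain B B' where B: "\<forall>j\<le>d. \<forall>x. \<bar>E j x\<bar> \<le> B" "\<forall>x\<in>Rn d. \<bar>g x\<bar> \<le> B'"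
    using assms by (auto simp: weak_jet_def)
  have [measurable]: "E j \<in> borel_measurable (lborel_pow d)" using assms by (auto simp: weak_jet_def)
  note [measurable] = assms(3)
  show ?thesis
  proof (rule integrable_unif_cube_bounded[where B="B * B'"])
    show "norm (E j x * g x) \<le> B * B'" if "x \<in> unit_cube d" for x
    proof -
      have "x \<in> Rn d" using that unit_cube_subset_Rn by blast
      then have "\<bar>E j x\<bar> \<le> B" "\<bar>g x\<bar> \<le> B'" using B assms(2) by auto
      then show ?thesis unfolding norm_mult by (intro mult_mono) auto
    qed
  qed simp
qed

lemma weak_jet_add:
  assumes E: "weak_jet d E" and F: "weak_jet d F"
  shows "weak_jet d (\<lambda>j x. E j x + F j x)"
  unfolding weak_jet_def
proof (intro conjI allI impI ballI)
  show "(\<lambda>x. E j x + F j x) \<in> borel_measurable (lborel_pow d)" if "j \<le> d" for j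
    using E F that unfolding weak_jet_def by (intro borel_measurable_add) auto
  obtain B B' where "\<forall>j\<le>d. \<forall>x. \<bar>E j x\<bar> \<le> B" "\<forall>j\<le>d. \<forall>x. \<bar>F j x\<bar> \<le> B'"
    using E F by (auto simp: weak_jet_def)
  then show "\<exists>B. \<forall>j\<le>d. \<forall>x. \<bar>E j x + F j x\<bar> \<le> B"
    by (intro exI[of _ "B + B'"]) (meson abs_triangle_ineq add_mono order_trans)
  fix i \<phi> assume i: "i < d" and \<phi>: "\<phi> \<in> test_functions d (unit_cube d)"
  note r = test_function_regular[OF \<phi>]
  note a = weak_jet_product_integrable[OF E _ r(2)[OF i] r(4)[OF i]] weak_jet_product_integrable[OF F _ r(2)[OF i] r(4)[OF i]]
  note b = weak_jet_product_integrable[OF E _ r(1) r(3)] weak_jet_product_integrable[OF F _ r(1) r(3)]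
  show "(LINT x|unif_cube d. (E 0 x + F 0 x) * partial_deriv i \<phi> x) = - (LINT x|unif_cube d. (E (Suc i) x + F (Suc i) x) * \<phi> x)"
    using a[of 0] b[of "Suc i"] E F i \<phi> by (simp add: ring_distribs weak_jet_def)
qed

lemma weak_jet_cmult:
  assumes E: "weak_jet d E"
  shows "weak_jet d (\<lambda>j x. c * E j x)"
  unfolding weak_jet_def
proof (intro conjI allI impI ballI)
  show "(\<lambda>x. c * E j x) \<in> borel_measurable (lborel_pow d)" if "j \<le> d" for j
    using E that unfolding weak_jet_def by (intro borel_measurable_times) auto
  obtain B where "\<forall>j\<le>d. \<forall>x. \<bar>E j x\<bar> \<le> B" using E by (auto simp: weak_jet_def)
  then show "\<exists>B. \<forall>j\<le>d. \<forall>x. \<bar>c * E j x\<bar> \<le> B"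
    by (intro exI[of _ "\<bar>c\<bar> * B"]) (auto simp: abs_mult intro!: mult_left_mono)
  show "(LINT x|unif_cube d. c * E 0 x * partial_deriv i \<phi> x) = - (LINT x|unif_cube d. c * E (Suc i) x * \<phi> x)"
    if "i < d" "\<phi> \<in> test_functions d (unit_cube d)" for i \<phi>
    using E that by (simp add: weak_jet_def mult.assoc)
qed

lemma weak_jet_0: "weak_jet d (\<lambda>j x. 0)"
  by (auto simp: weak_jet_def)

lemma weak_jet_sum:
  assumes "\<And>k. k \<in> I \<Longrightarrow> weak_jet d (E k)"
  shows "weak_jet d (\<lambda>j x. \<Sum>k\<in>I. c k * E k j x)"
  using assms by (induction I rule: infinite_finite_induct) (auto intro!: weak_jet_0 weak_jet_add weak_jet_cmult)

lemma weak_jet_integral: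
  assumes "finite_measure \<nu>"
    and K[measurable]: "\<And>j. j \<le> d \<Longrightarrow> (\<lambda>(\<theta>, x). K j \<theta> x) \<in> borel_measurable (\<nu> \<Otimes>\<^sub>M lborel_pow d)"
    and B: "\<And>j \<theta> x. j \<le> d \<Longrightarrow> \<bar>K j \<theta> x\<bar> \<le> B"
    and E: "\<And>\<theta>. \<theta> \<in> space \<nu> \<Longrightarrow> weak_jet d (\<lambda>j. K j \<theta>)"
  shows "weak_jet d (\<lambda>j x. LINT \<theta>|\<nu>. K j \<theta> x)"
proof -
  interpret \<nu>: finite_measure \<nu> by fact
  interpret PM: pair_sigma_finite \<nu> "unif_cube d" ..
  interpret PM': finite_measure "\<nu> \<Otimes>\<^sub>M unif_cube d"
    by (rule finite_measure_pair_measure) unfold_locales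
  have Km[measurable]: "(\<lambda>(\<theta>, x). K j \<theta> x) \<in> borel_measurable (\<nu> \<Otimes>\<^sub>M unif_cube d)" if "j \<le> d" for j
    using K[OF that] by simp
  have B0: "0 \<le> B" using B[of 0] order_trans[OF abs_ge_zero] by blast
  have fub: "(LINT x|unif_cube d. (LINT \<theta>|\<nu>. K j \<theta> x) * g x) = (LINT \<theta>|\<nu>. LINT x|unif_cube d. K j \<theta> x * g x)"
    if j: "j \<le> d" and g: "g \<in> borel_measurable (lborel_pow d)" "\<exists>C. \<forall>x\<in>Rn d. \<bar>g x\<bar> \<le> C" for j g
  proof -
    obtain C where C: "\<forall>x\<in>Rn d. \<bar>g x\<bar> \<le> C" using g(2) by auto
    note [measurable] = g(1) Km[OF j]
    have "integrable (\<nu> \<Otimes>\<^sub>M unif_cube d) (\<lambda>(\<theta>, x). K j \<theta> x * g x)"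
    proof (rule PM'.integrable_const_bound[where B="B * C"])
      show "AE z in \<nu> \<Otimes>\<^sub>M unif_cube d. norm (case z of (\<theta>, x) \<Rightarrow> K j \<theta> x * g x) \<le> B * C"
        using B[OF j] C B0 by (intro AE_I2) (auto simp: space_pair_measure abs_mult intro!: mult_mono)
    qed measurable
    from PM.Fubini_integral[OF this] show ?thesis by simp
  qed
  show ?thesis
    unfolding weak_jet_def
  proof (intro conjI allI impI ballI)
    show "(\<lambda>x. LINT \<theta>|\<nu>. K j \<theta> x) \<in> borel_measurable (lborel_pow d)" if "j \<le> d" for j
    proof -
      note [measurable] = K[OF that]
      have "(\<lambda>(x, \<theta>). K j \<theta> x) \<in> borel_measurable (lborel_pow d \<Otimes>\<^sub>M \<nu>)" by measurable
      then show ?thesis by (rule \<nu>.borel_measurable_lebesgue_integral)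
    qed
    have "\<bar>LINT \<theta>|\<nu>. K j \<theta> x\<bar> \<le> B * measure \<nu> (space \<nu>)" if "j \<le> d" for j x
    proof (cases "integrable \<nu> (\<lambda>\<theta>. K j \<theta> x)")
      case True
      have "\<bar>LINT \<theta>|\<nu>. K j \<theta> x\<bar> \<le> (LINT \<theta>|\<nu>. \<bar>K j \<theta> x\<bar>)" by (rule integral_abs_bound)
      also have "\<dots> \<le> (LINT \<theta>|\<nu>. B)" using True B[OF that] by (intro integral_mono) auto
      finally show ?thesis by (simp add: mult.commute)
    qed (use B0 in \<open>simp add: not_integrable_integral_eq\<close>)
    then show "\<exists>B. \<forall>j\<le>d. \<forall>x. \<bar>LINT \<theta>|\<nu>. K j \<theta> x\<bar> \<le> B" by blast
    fix i \<phi> assume i: "i < d" and \<phi>: "\<phi> \<in> test_functions d (unit_cube d)"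
    note r = test_function_regular[OF \<phi>]
    have "(LINT x|unif_cube d. (LINT \<theta>|\<nu>. K 0 \<theta> x) * partial_deriv i \<phi> x)
        = (LINT \<theta>|\<nu>. LINT x|unif_cube d. K 0 \<theta> x * partial_deriv i \<phi> x)"
      using r i by (intro fub) auto
    also have "\<dots> = (LINT \<theta>|\<nu>. - (LINT x|unif_cube d. K (Suc i) \<theta> x * \<phi> x))"
      using E i \<phi> by (intro Bochner_Integration.integral_cong) (auto simp: weak_jet_def)
    also have "\<dots> = - (LINT x|unif_cube d. (LINT \<theta>|\<nu>. K (Suc i) \<theta> x) * \<phi> x)"
      using r i by (subst fub) auto
    finally show "(LINT x|unif_cube d. (LINT \<theta>|\<nu>. K 0 \<theta> x) * partial_deriv i \<phi> x)
        = - (LINT x|unif_cube d. (LINT \<theta>|\<nu>. K (Suc i) \<theta> x) * \<phi> x)" .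
  qed
qed

text \<open>Passage from the completed measure of the Sobolev norm to \<open>unif_cube d\<close>.
  The function \<open>f\<close> is only almost everywhere equal to a Borel function, and
  completeness turns this into measurability; the target is represented by units only up to a null
  set.\<close>

lemma set_integral_leb_unit_cube:
  fixes g :: "point \<Rightarrow> real"
  assumes g[measurable]: "g \<in> borel_measurable (lborel_pow d)"
    and f: "AE x in lborel_pow d. x \<in> unit_cube d \<longrightarrow> f x = g x"
  shows "set_borel_measurable (leb d) (unit_cube d) f"
    and "(LINT x:unit_cube d|leb d. f x) = (LINT x|unif_cube d. g x)"
    and "integrable (unif_cube d) g \<Longrightarrow> set_integrable (leb d) (unit_cube d) f"
proof -
  let ?F = "\<lambda>x. indicator (unit_cube d) x *\<^sub>R f x" and ?G = "\<lambda>x. indicator (unit_cube d) x *\<^sub>R g x"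
  have G[measurable]: "?G \<in> borel_measurable (lborel_pow d)" by simp
  have Gc: "?G \<in> borel_measurable (leb d)"
    unfolding leb_def by (rule measurable_completion) (rule G)
  have ae: "AE x in leb d. ?F x = ?G x"
    unfolding leb_def by (rule AE_completion) (use f in eventually_elim, auto simp: indicator_def)
  interpret complete_measure "leb d" unfolding leb_def ..
  have F: "?F \<in> borel_measurable (leb d)"
  proof (rule measurableI)
    fix A :: "real set" assume A: "A \<in> sets borel"
    show "?F -` A \<inter> space (leb d) \<in> sets (leb d)"
    proof (rule in_sets_AE)
      show "AE x in leb d. (x \<in> ?G -` A \<inter> space (leb d)) = (x \<in> ?F -` A \<inter> space (leb d))"
        using ae by eventually_elim auto
      show "?G -` A \<inter> space (leb d) \<in> sets (leb d)" by (rule measurable_sets[OF Gc A])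
    qed auto
  qed simp
  show "set_borel_measurable (leb d) (unit_cube d) f" using F by (simp add: set_borel_measurable_def)
  have "(LINT x|leb d. ?F x) = (LINT x|leb d. ?G x)" by (rule integral_cong_AE[OF F Gc ae])
  also have "\<dots> = (LINT x|lborel_pow d. ?G x)" unfolding leb_def by (rule integral_completion[OF G])
  finally show "(LINT x:unit_cube d|leb d. f x) = (LINT x|unif_cube d. g x)"
    unfolding integral_unif_cube[OF g] by (simp add: set_lebesgue_integral_def)
  assume "integrable (unif_cube d) g"
  moreover have "unif_cube d = density (lborel_pow d) (\<lambda>x. ennreal (indicator (unit_cube d) x))"
    unfolding unif_cube_eq_density by (simp add: ennreal_indicator)
  ultimately have "integrable (lborel_pow d) ?G"
    by (simp add: integrable_density)
  then have "integrable (leb d) ?G" unfolding leb_def using integrable_completion[OF G] by simp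
  then show "set_integrable (leb d) (unit_cube d) f"
    unfolding set_integrable_def using integrable_cong_AE[OF F Gc ae] by simp
qed

text \<open>\<open>H1_norm\<close> is an infimum over weak gradients, so exhibiting the one formed
  by the \<open>E (Suc i)\<close> bounds it from above; nonnegativity of all values is the lower
  bound that the infimum over reals requires.\<close>

lemma H1_norm_le_weak_jet:
  assumes E: "weak_jet d E" and f: "AE x in lborel_pow d. x \<in> unit_cube d \<longrightarrow> f x = E 0 x"
  shows "f \<in> H1 d (unit_cube d)"
    and "H1_norm d (unit_cube d) f \<le> sqrt (\<Sum>j\<in>{..d}. LINT x|unif_cube d. (E j x)\<^sup>2)"
proof -
  have Em: "E j \<in> borel_measurable (lborel_pow d)" if "j \<le> d" for j using E that by (simp add: weak_jet_def)
  obtain B where B: "\<forall>j\<le>d. \<forall>x. \<bar>E j x\<bar> \<le> B" using E by (auto simp: weak_jet_def)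
  have Ei: "integrable (unif_cube d) (\<lambda>x. (E j x)\<^sup>2)" if "j \<le> d" for j
    unfolding power2_eq_square using that B by (intro weak_jet_product_integrable[OF E that Em[OF that]]) auto
  have L2: "u \<in> L2 d (unit_cube d)" "(LINT x:unit_cube d|leb d. (u x)\<^sup>2) = (LINT x|unif_cube d. (E j x)\<^sup>2)"
    if "j \<le> d" "AE x in lborel_pow d. x \<in> unit_cube d \<longrightarrow> u x = E j x" for j u
  proof -
    note [measurable] = Em[OF that(1)]
    have ae: "AE x in lborel_pow d. x \<in> unit_cube d \<longrightarrow> (u x)\<^sup>2 = (E j x)\<^sup>2" using that(2) by eventually_elim simp
    show "u \<in> L2 d (unit_cube d)"
      unfolding L2_def using set_integral_leb_unit_cube(1)[OF Em[OF that(1)] that(2)]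
        set_integral_leb_unit_cube(3)[OF _ ae] Ei[OF that(1)] by simp
    show "(LINT x:unit_cube d|leb d. (u x)\<^sup>2) = (LINT x|unif_cube d. (E j x)\<^sup>2)"
      by (rule set_integral_leb_unit_cube(2)[OF _ ae]) simp
  qed
  have wp: "weak_partial d (unit_cube d) i f (E (Suc i))" if i: "i < d" for i
    unfolding weak_partial_def
  proof
    fix \<phi> assume \<phi>: "\<phi> \<in> test_functions d (unit_cube d)"
    note [measurable] = test_function_regular(1)[OF \<phi>] test_function_regular(2)[OF \<phi> i] Em[of 0] Em[of "Suc i"]
    have "(LINT x:unit_cube d|leb d. f x * partial_deriv i \<phi> x) = (LINT x|unif_cube d. E 0 x * partial_deriv i \<phi> x)"
      by (rule set_integral_leb_unit_cube(2)) (measurable, use f in eventually_elim, simp)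
    also have "\<dots> = - (LINT x|unif_cube d. E (Suc i) x * \<phi> x)"
      using E i \<phi> by (simp add: weak_jet_def)
    also have "(LINT x|unif_cube d. E (Suc i) x * \<phi> x) = (LINT x:unit_cube d|leb d. E (Suc i) x * \<phi> x)"
      by (rule set_integral_leb_unit_cube(2)[symmetric]) (use i in \<open>auto intro!: borel_measurable_times\<close>)
    finally show "(LINT x:unit_cube d|leb d. f x * partial_deriv i \<phi> x) = - (LINT x:unit_cube d|leb d. E (Suc i) x * \<phi> x)" .
  qed
  have g: "(\<lambda>i. E (Suc i)) \<in> L2_weak_gradients d (unit_cube d) f"
    unfolding L2_weak_gradients_def using L2(1)[of "Suc i" "E (Suc i)" for i] wp by simp
  show "f \<in> H1 d (unit_cube d)"
    unfolding H1_def using L2(1)[of 0 f] f g by auto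
  have "H1_norm d (unit_cube d) f \<le> sqrt ((LINT x:unit_cube d|leb d. (f x)\<^sup>2) + (\<Sum>i<d. LINT x:unit_cube d|leb d. (E (Suc i) x)\<^sup>2))"
    unfolding H1_norm_def
  proof (rule cINF_lower[OF _ g])
    show "bdd_below ((\<lambda>g. sqrt ((LINT x:unit_cube d|leb d. (f x)\<^sup>2) + (\<Sum>i<d. LINT x:unit_cube d|leb d. (g i x)\<^sup>2))) ` L2_weak_gradients d (unit_cube d) f)"
      by (rule bdd_belowI[of _ 0])
         (auto intro!: real_sqrt_ge_zero add_nonneg_nonneg sum_nonneg integral_nonneg simp: set_lebesgue_integral_def)
  qed
  also have "(LINT x:unit_cube d|leb d. (f x)\<^sup>2) = (LINT x|unif_cube d. (E 0 x)\<^sup>2)" using L2(2)[of 0 f] f by simp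
  also have "(\<Sum>i<d. LINT x:unit_cube d|leb d. (E (Suc i) x)\<^sup>2) = (\<Sum>i<d. LINT x|unif_cube d. (E (Suc i) x)\<^sup>2)"
    by (intro sum.cong refl L2(2)) auto
  finally show "H1_norm d (unit_cube d) f \<le> sqrt (\<Sum>j\<in>{..d}. LINT x|unif_cube d. (E j x)\<^sup>2)"
    by (simp only: sum.atMost_shift)
qed

section \<open>Fourier inversion\<close>

text \<open>The exponential kernels have modulus 1, so this criterion covers each exchange of the
  integrals over space and frequency below.\<close>

lemma (in pair_sigma_finite) integrable_dominated_by_product:
  fixes h :: "'a \<times> 'b \<Rightarrow> 'c::{banach, second_countable_topology}" and f :: "'a \<Rightarrow> real" and g :: "'b \<Rightarrow> real"
  assumes h: "h \<in> borel_measurable (M1 \<Otimes>\<^sub>M M2)" and f: "integrable M1 f" and g: "integrable M2 g"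
    and b: "\<And>x y. x \<in> space M1 \<Longrightarrow> y \<in> space M2 \<Longrightarrow> norm (h (x, y)) \<le> f x * g y"
  shows "integrable (M1 \<Otimes>\<^sub>M M2) h"
proof -
  have [measurable]: "f \<in> borel_measurable M1" "g \<in> borel_measurable M2" using f g by auto
  have "integrable (M1 \<Otimes>\<^sub>M M2) (\<lambda>z. f (fst z) * g (snd z))"
  proof (rule Fubini_integrable)
    show "integrable M1 (\<lambda>x. LINT y|M2. norm (f (fst (x, y)) * g (snd (x, y))))"
      using f by (simp add: abs_mult)
    show "AE x in M1. integrable M2 (\<lambda>y. f (fst (x, y)) * g (snd (x, y)))"
      using g by simp
  qed measurable
  then show ?thesis
  proof (rule Bochner_Integration.integrable_bound)
    show "AE z in M1 \<Otimes>\<^sub>M M2. norm (h z) \<le> norm (f (fst z) * g (snd z))"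
    proof (rule AE_I2)
      fix z assume "z \<in> space (M1 \<Otimes>\<^sub>M M2)"
      then have "norm (h z) \<le> f (fst z) * g (snd z)" using b[of "fst z" "snd z"] by (auto simp: space_pair_measure)
      then show "norm (h z) \<le> norm (f (fst z) * g (snd z))" by simp
    qed
  qed fact
qed

text \<open>Obtained by rescaling the characteristic function of the standard normal;
  \<open>2 * pi\<close> is the share of one coordinate in the factor \<open>(2 * pi) ^ d\<close> of
  \<open>fourier\<close>.\<close>

lemma gaussian_fourier:
  assumes \<epsilon>: "\<epsilon> > 0"
  shows "has_bochner_integral lborel (\<lambda>s. complex_of_real (exp (- (\<epsilon> * s)\<^sup>2 / 2)) * iexp (s * z)) (2 * pi * normal_density 0 \<epsilon> z)"
proof -
  interpret N: real_distribution std_normal_distribution by (rule real_dist_normal_dist)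
  have "integrable std_normal_distribution (\<lambda>u. iexp (z / \<epsilon> * u))"
    by (rule N.integrable_const_bound[where B=1]) auto
  then have "has_bochner_integral std_normal_distribution (\<lambda>u. iexp (z / \<epsilon> * u)) (char std_normal_distribution (z / \<epsilon>))"
    by (simp add: has_bochner_integral_iff char_def)
  then have "has_bochner_integral lborel (\<lambda>u. std_normal_density u *\<^sub>R iexp (z / \<epsilon> * u)) (exp (- (z / \<epsilon>)\<^sup>2 / 2))"
    unfolding char_std_normal_distribution has_bochner_integral_iff
    by (subst (asm) integrable_density, simp, simp, simp, subst (asm) integral_density) auto
  from lborel_has_bochner_integral_real_affine_iff[of \<epsilon> "\<lambda>u. std_normal_density u *\<^sub>R iexp (z / \<epsilon> * u)" _ 0, THEN iffD1, OF _ this]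
  have "has_bochner_integral lborel (\<lambda>s. std_normal_density (\<epsilon> * s) *\<^sub>R iexp (z * s)) (complex_of_real (exp (- (z / \<epsilon>)\<^sup>2 / 2)) /\<^sub>R \<epsilon>)"
    using \<epsilon> by simp
  from has_bochner_integral_mult_right[of "complex_of_real (sqrt (2 * pi))", OF this]
  have "has_bochner_integral lborel (\<lambda>s. complex_of_real (sqrt (2 * pi)) * (std_normal_density (\<epsilon> * s) *\<^sub>R iexp (z * s)))
     (complex_of_real (sqrt (2 * pi)) * (complex_of_real (exp (- (z / \<epsilon>)\<^sup>2 / 2)) /\<^sub>R \<epsilon>))" by simp
  moreover have "complex_of_real (sqrt (2 * pi)) * (std_normal_density (\<epsilon> * s) *\<^sub>R iexp (z * s)) = complex_of_real (exp (- (\<epsilon> * s)\<^sup>2 / 2)) * iexp (s * z)" for s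
    by (simp add: std_normal_density_def scaleR_conv_of_real mult.commute)
  moreover have "complex_of_real (sqrt (2 * pi)) * (complex_of_real (exp (- (z / \<epsilon>)\<^sup>2 / 2)) /\<^sub>R \<epsilon>) = complex_of_real (2 * pi * normal_density 0 \<epsilon> z)"
  proof -
    have "sqrt (2 * pi) * (exp (- (z / \<epsilon>)\<^sup>2 / 2) / \<epsilon>) = 2 * pi / sqrt (2 * pi) * (exp (- (z / \<epsilon>)\<^sup>2 / 2) / \<epsilon>)"
      by (subst real_div_sqrt) auto
    also have "\<dots> = 2 * pi * normal_density 0 \<epsilon> z"
      using \<epsilon> by (simp add: normal_density_def real_sqrt_mult power_divide)
    finally have "2 * pi * normal_density 0 \<epsilon> z = sqrt (2 * pi) * (exp (- (z / \<epsilon>)\<^sup>2 / 2) / \<epsilon>)" ..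
    then show ?thesis
      by (simp only: scaleR_conv_of_real of_real_mult of_real_divide of_real_inverse divide_inverse mult_ac)
  qed
  ultimately show ?thesis by simp
qed

section \<open>Transforms of intervals and their Gaussian smoothing\<close>

definition box_ft :: "real \<Rightarrow> real \<Rightarrow> real \<Rightarrow> complex" where
  "box_ft a b s = (LINT y|lborel. indicator {a<..b} y *\<^sub>R iexp (s * y))"

definition mollified :: "real \<Rightarrow> real \<Rightarrow> real \<Rightarrow> real \<Rightarrow> real" where
  "mollified \<epsilon> a b x = (LINT y|lborel. indicator {a<..b} y * normal_density 0 \<epsilon> (y - x))"

lemma integrable_indicator_Ioc: "integrable lborel (indicator {a<..b} :: real \<Rightarrow> real)"
  by (cases "a \<le> b") (auto intro!: integrable_real_indicator)

lemma box_ft_measurable[measurable]: "box_ft a b \<in> borel_measurable borel"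
  unfolding box_ft_def by measurable

lemma box_ft_bound: "cmod (box_ft a b s) \<le> max 0 (b - a)"
proof -
  have "cmod (box_ft a b s) \<le> (LINT y|lborel. norm (indicator {a<..b} y *\<^sub>R iexp (s * y)))"
    unfolding box_ft_def by (rule integral_norm_bound)
  also have "\<dots> = (LINT y|lborel. indicator {a<..b} y)"
    by (intro Bochner_Integration.integral_cong) (auto simp: indicator_def)
  also have "\<dots> \<le> max 0 (b - a)" by (cases "a \<le> b") auto
  finally show ?thesis .
qed

text \<open>\<open>box_ft\<close> decays only like \<open>1 / s\<close>, so in general it is not
  integrable and cannot be inverted directly. The Gaussian factor restores integrability, at the
  price of replacing the interval by its smoothing.\<close>

lemma box_ft_mollified:
  assumes \<epsilon>: "\<epsilon> > 0"
  shows "integrable lborel (\<lambda>s. complex_of_real (exp (- (\<epsilon> * s)\<^sup>2 / 2)) * box_ft a b s)"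
    and "(LINT s|lborel. (complex_of_real (exp (- (\<epsilon> * s)\<^sup>2 / 2)) * box_ft a b s) * iexp (- s * x)) = 2 * pi * mollified \<epsilon> a b x"
proof -
  have ig: "integrable lborel (\<lambda>s::real. exp (- (\<epsilon> * s)\<^sup>2 / 2))"
  proof -
    have "integrable lborel (\<lambda>s. norm (complex_of_real (exp (- (\<epsilon> * s)\<^sup>2 / 2)) * iexp (s * 0)))"
      using gaussian_fourier[OF \<epsilon>, of 0] by (intro integrable_norm) (simp only: has_bochner_integral_iff)
    then show ?thesis by simp
  qed
  show "integrable lborel (\<lambda>s. complex_of_real (exp (- (\<epsilon> * s)\<^sup>2 / 2)) * box_ft a b s)"
  proof (rule Bochner_Integration.integrable_bound)
    show "integrable lborel (\<lambda>s. exp (- (\<epsilon> * s)\<^sup>2 / 2) * max 0 (b - a))" using ig by simp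
    show "AE s in lborel. norm (complex_of_real (exp (- (\<epsilon> * s)\<^sup>2 / 2)) * box_ft a b s) \<le> norm (exp (- (\<epsilon> * s)\<^sup>2 / 2) * max 0 (b - a))"
      using box_ft_bound by (intro AE_I2) (simp add: norm_mult)
  qed measurable
  let ?h = "\<lambda>s y. complex_of_real (exp (- (\<epsilon> * s)\<^sup>2 / 2)) * (indicator {a<..b} y *\<^sub>R iexp (s * y)) * iexp (- s * x)"
  have int: "integrable (lborel \<Otimes>\<^sub>M lborel) (case_prod ?h)"
    by (rule lborel_pair.integrable_dominated_by_product[OF _ ig integrable_indicator_Ioc[of a b]])
       (auto simp: norm_mult indicator_def)
  have "(LINT s|lborel. (complex_of_real (exp (- (\<epsilon> * s)\<^sup>2 / 2)) * box_ft a b s) * iexp (- s * x))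
      = (LINT s|lborel. LINT y|lborel. ?h s y)"
    unfolding box_ft_def by (simp only: integral_mult_right_zero integral_mult_left_zero)
  also have "\<dots> = (LINT y|lborel. LINT s|lborel. ?h s y)"
    using lborel_pair.Fubini_integral[OF int] by simp
  also have "\<dots> = (LINT y|lborel. complex_of_real (2 * pi * (indicator {a<..b} y * normal_density 0 \<epsilon> (y - x))))"
  proof (intro Bochner_Integration.integral_cong refl)
    fix y
    have "(LINT s|lborel. ?h s y) = (LINT s|lborel. of_real (indicator {a<..b} y) * (complex_of_real (exp (- (\<epsilon> * s)\<^sup>2 / 2)) * iexp (s * (y - x))))"
      by (intro Bochner_Integration.integral_cong refl)
         (simp add: scaleR_conv_of_real exp_add[symmetric] algebra_simps)
    also have "\<dots> = of_real (indicator {a<..b} y) * complex_of_real (2 * pi * normal_density 0 \<epsilon> (y - x))"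
      using gaussian_fourier[OF \<epsilon>, of "y - x"] by (simp only: integral_mult_right_zero has_bochner_integral_iff)
    finally show "(LINT s|lborel. ?h s y) = complex_of_real (2 * pi * (indicator {a<..b} y * normal_density 0 \<epsilon> (y - x)))"
      by simp
  qed
  also have "\<dots> = 2 * pi * mollified \<epsilon> a b x"
    unfolding integral_complex_of_real mollified_def by simp
  finally show "(LINT s|lborel. (complex_of_real (exp (- (\<epsilon> * s)\<^sup>2 / 2)) * box_ft a b s) * iexp (- s * x)) = 2 * pi * mollified \<epsilon> a b x" .
qed

lemma mollified_measurable[measurable]: "mollified \<epsilon> a b \<in> borel_measurable borel"
  unfolding mollified_def by measurable

lemma mollified_affine:
  assumes \<epsilon>: "\<epsilon> > 0"
  shows "mollified \<epsilon> a b x = (LINT z|lborel. indicator {a<..b} (x + \<epsilon> * z) * std_normal_density z)"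
proof -
  have "mollified \<epsilon> a b x = \<bar>\<epsilon>\<bar> *\<^sub>R (LINT z|lborel. indicator {a<..b} (x + \<epsilon> * z) * normal_density 0 \<epsilon> (x + \<epsilon> * z - x))"
    unfolding mollified_def using \<epsilon> by (intro lborel_integral_real_affine) simp
  also have "\<dots> = (LINT z|lborel. \<epsilon> * (indicator {a<..b} (x + \<epsilon> * z) * normal_density 0 \<epsilon> (x + \<epsilon> * z - x)))"
    using \<epsilon> by simp
  also have "\<dots> = (LINT z|lborel. indicator {a<..b} (x + \<epsilon> * z) * std_normal_density z)"
    using \<epsilon> by (intro Bochner_Integration.integral_cong)
      (auto simp: normal_density_def real_sqrt_mult power_mult_distrib indicator_def)
  finally show ?thesis .
qed

lemma mollified_bounds:
  assumes \<epsilon>: "\<epsilon> > 0"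
  shows "0 \<le> mollified \<epsilon> a b x" "mollified \<epsilon> a b x \<le> 1"
proof -
  show "0 \<le> mollified \<epsilon> a b x" unfolding mollified_def by simp
  have "mollified \<epsilon> a b x \<le> (LINT z|lborel. std_normal_density z)"
    unfolding mollified_affine[OF \<epsilon>]
  proof (rule integral_mono)
    show "integrable lborel (\<lambda>z. indicator {a<..b} (x + \<epsilon> * z) * std_normal_density z)"
      by (rule Bochner_Integration.integrable_bound[of lborel std_normal_density]) (auto simp: indicator_def)
  qed (auto simp: indicator_def)
  then show "mollified \<epsilon> a b x \<le> 1" by simp
qed

text \<open>In the rescaled variable the smoothing is an average of shifted indicators, and an
  indicator is locally constant off the end points.\<close>

lemma mollified_tendsto:
  assumes x: "x \<noteq> a" "x \<noteq> b" and \<epsilon>: "\<And>n. \<epsilon> n > 0" "\<epsilon> \<longlonglongrightarrow> 0"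
  shows "(\<lambda>n. mollified (\<epsilon> n) a b x) \<longlonglongrightarrow> indicator {a<..b} x"
proof -
  have "(\<lambda>n. LINT z|lborel. indicator {a<..b} (x + \<epsilon> n * z) * std_normal_density z) \<longlonglongrightarrow> (LINT z|lborel. indicator {a<..b} x * std_normal_density z)"
  proof (rule integral_dominated_convergence)
    show "integrable lborel std_normal_density" by simp
    show "AE z in lborel. (\<lambda>n. indicator {a<..b} (x + \<epsilon> n * z) * std_normal_density z) \<longlonglongrightarrow> indicator {a<..b} x * std_normal_density z"
    proof (rule AE_I2)
      fix z
      have t: "(\<lambda>n. x + \<epsilon> n * z) \<longlonglongrightarrow> x + 0 * z" by (intro tendsto_intros \<epsilon>)
      then have t: "(\<lambda>n. x + \<epsilon> n * z) \<longlonglongrightarrow> x" by simp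
      have e: "eventually (\<lambda>n. (a < x + \<epsilon> n * z) = (a < x)) sequentially"
        using x(1) order_tendstoD[OF t, of a] by (cases "a < x") (auto elim!: eventually_mono)
      have e': "eventually (\<lambda>n. (x + \<epsilon> n * z \<le> b) = (x \<le> b)) sequentially"
        using x(2) order_tendstoD[OF t, of b] by (cases "x < b") (auto elim!: eventually_mono)
      have "eventually (\<lambda>n. indicator {a<..b} (x + \<epsilon> n * z) * std_normal_density z = indicator {a<..b} x * std_normal_density z) sequentially"
        using e e' by eventually_elim (auto simp: indicator_def)
      then show "(\<lambda>n. indicator {a<..b} (x + \<epsilon> n * z) * std_normal_density z) \<longlonglongrightarrow> indicator {a<..b} x * std_normal_density z"
        by (rule tendsto_eventually)
    qed
    show "AE z in lborel. norm (indicator {a<..b} (x + \<epsilon> n * z) * std_normal_density z) \<le> std_normal_density z" for n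
      by (intro AE_I2) (auto simp: indicator_def)
  qed auto
  then show ?thesis using \<epsilon>(1) by (simp add: mollified_affine)
qed

lemma iexp_dot: "exp (\<i> * complex_of_real (dot d w x)) = (\<Prod>i<d. iexp (w i * x i))"
  by (simp add: dot_def sum_distrib_left exp_sum)

lemma AE_lborel_pow_coord:
  assumes "i < d"
  shows "AE x in lborel_pow d. x i \<noteq> c"
proof (rule AE_I)
  show "{x \<in> space (lborel_pow d). \<not> x i \<noteq> c} \<subseteq> (\<Pi>\<^sub>E j\<in>{..<d}. if j = i then {c} else UNIV)"
    by (auto simp: Rn_def PiE_iff extensional_def)
  have "emeasure (lborel_pow d) (\<Pi>\<^sub>E j\<in>{..<d}. if j = i then {c} else UNIV) = (\<Prod>j<d. emeasure lborel (if j = i then {c} else UNIV))"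
    by (rule lbp.emeasure_PiM) auto
  also have "\<dots> = 0" using assms by (intro prod_zero) auto
  finally show "emeasure (lborel_pow d) (\<Pi>\<^sub>E j\<in>{..<d}. if j = i then {c} else UNIV) = 0" .
  show "(\<Pi>\<^sub>E j\<in>{..<d}. if j = i then {c} else UNIV) \<in> sets (lborel_pow d)"
    by (rule sets_PiM_I_finite) auto
qed

section \<open>Boxes determine integrable functions\<close>

lemma sets_lborel_pow_boxes:
  "sets (lborel_pow d) = sigma_sets (Rn d) {(\<Pi>\<^sub>E i\<in>{..<d}. {a i<..b i}) | a b. True}" (is "_ = sigma_sets _ ?E")
proof -
  let ?J = "range (\<lambda>(a, b). {a<..b::real})"
  have cover: "\<exists>S\<subseteq>?J. countable S \<and> UNIV = \<Union>S"
  proof (intro exI conjI)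
    show "range (\<lambda>n. {- real n<..real n}) \<subseteq> ?J" by auto
    have "\<exists>n. x \<in> {- real n<..real n}" for x :: real
    proof -
      obtain n where "\<bar>x\<bar> < real n" using reals_Archimedean2 by blast
      then show ?thesis by (intro exI[of _ n]) auto
    qed
    then show "UNIV = \<Union>(range (\<lambda>n. {- real n<..real n}))" by blast
  qed auto
  have "sets (lborel_pow d) = sets (\<Pi>\<^sub>M i\<in>{..<d}. sigma UNIV ?J)"
    by (intro sets_PiM_cong refl) (simp flip: borel_sigma_sets_Ioc)
  also have "\<dots> = sets (sigma (\<Pi>\<^sub>E i\<in>{..<d}. UNIV) {{f\<in>(\<Pi>\<^sub>E i\<in>{..<d}. UNIV). \<forall>i\<in>j. f i \<in> A i} | A j. j \<in> {{..<d}} \<and> A \<in> Pi j (\<lambda>_. ?J)})"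
    by (rule sets_PiM_sigma) (use cover in auto)
  also have "{{f\<in>(\<Pi>\<^sub>E i\<in>{..<d}. UNIV). \<forall>i\<in>j. f i \<in> A i} | A j. j \<in> {{..<d}} \<and> A \<in> Pi j (\<lambda>_. ?J)} = ?E"
  proof (intro equalityI subsetI)
    fix X assume "X \<in> {{f\<in>(\<Pi>\<^sub>E i\<in>{..<d}. UNIV). \<forall>i\<in>j. f i \<in> A i} | A j. j \<in> {{..<d}} \<and> A \<in> Pi j (\<lambda>_. ?J)}"
    then obtain A where A: "X = {f\<in>(\<Pi>\<^sub>E i\<in>{..<d}. UNIV). \<forall>i\<in>{..<d}. f i \<in> A i}" "\<forall>i\<in>{..<d}. A i \<in> ?J" by auto
    then have "\<forall>i\<in>{..<d}. \<exists>a b. A i = {a<..b}" by (fastforce simp: image_iff)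
    then obtain a b where "\<forall>i\<in>{..<d}. A i = {a i<..b i}" by metis
    then have "X = (\<Pi>\<^sub>E i\<in>{..<d}. {a i<..b i})" unfolding A(1) by (intro set_eqI) (simp only: PiE_iff mem_Collect_eq UNIV_I ball_triv simp_thms, blast)
    then show "X \<in> ?E" unfolding mem_Collect_eq by (intro exI conjI TrueI)
  next
    fix X assume "X \<in> ?E"
    then obtain a b where X: "X = (\<Pi>\<^sub>E i\<in>{..<d}. {a i<..b i})" by auto
    have "X = {f\<in>(\<Pi>\<^sub>E i\<in>{..<d}. UNIV). \<forall>i\<in>{..<d}. f i \<in> {a i<..b i}}"
      unfolding X by (rule set_eqI) (simp only: PiE_iff mem_Collect_eq UNIV_I ball_triv simp_thms, blast)
    moreover have "(\<lambda>i. {a i<..b i}) \<in> Pi {..<d} (\<lambda>_. ?J)" by auto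
    ultimately show "X \<in> {{f\<in>(\<Pi>\<^sub>E i\<in>{..<d}. UNIV). \<forall>i\<in>j. f i \<in> A i} | A j. j \<in> {{..<d}} \<and> A \<in> Pi j (\<lambda>_. ?J)}"
      unfolding mem_Collect_eq by (intro exI[of _ "\<lambda>i. {a i<..b i}"] exI[of _ "{..<d}"] conjI singletonI)
  qed
  also have "sets (sigma (\<Pi>\<^sub>E i\<in>{..<d}. UNIV) ?E) = sigma_sets (Rn d) ?E"
    unfolding Rn_def by (subst sets_measure_of) auto
  finally show ?thesis .
qed

lemma indicator_box: "x \<in> Rn d \<Longrightarrow> indicator (\<Pi>\<^sub>E i\<in>{..<d}. A i) x = (\<Prod>i<d. indicator (A i) (x i) :: real)"
  by (auto simp: indicator_def Rn_def PiE_iff prod_zero_iff)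

text \<open>The positive and the negative part of \<open>u\<close> are densities of two finite
  measures that agree on boxes. Half-open boxes are closed under intersection and generate the
  measurable sets, so the measures coincide, and with them the densities.\<close>

lemma AE_zero_if_box_integrals_zero:
  fixes u :: "point \<Rightarrow> real"
  assumes u: "integrable (lborel_pow d) u"
    and z: "\<And>a b. (LINT x|lborel_pow d. u x * (\<Prod>i<d. indicator {a i<..b i} (x i))) = 0"
  shows "AE x in lborel_pow d. u x = 0"
proof -
  interpret sigma_finite_measure "lborel_pow d" by (rule lbp.sigma_finite) simp
  have [measurable]: "u \<in> borel_measurable (lborel_pow d)" using u by auto
  let ?p = "\<lambda>x. max 0 (u x)" and ?m = "\<lambda>x. max 0 (- u x)"
  let ?P = "density (lborel_pow d) (\<lambda>x. ennreal (?p x))" and ?M = "density (lborel_pow d) (\<lambda>x. ennreal (?m x))"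
  let ?E = "{(\<Pi>\<^sub>E i\<in>{..<d}. {a i<..b i}) | a b. True} :: point set set"
  have Eint: "emeasure (density (lborel_pow d) (\<lambda>x. ennreal (max 0 (v x)))) X = ennreal (LINT x|lborel_pow d. max 0 (v x) * indicator X x)"
    and Ei: "integrable (lborel_pow d) (\<lambda>x. max 0 (v x) * indicator X x)"
    if v: "integrable (lborel_pow d) v" and X[measurable]: "X \<in> sets (lborel_pow d)" for v :: "point \<Rightarrow> real" and X
  proof -
    have [measurable]: "v \<in> borel_measurable (lborel_pow d)" using v by auto
    show i: "integrable (lborel_pow d) (\<lambda>x. max 0 (v x) * indicator X x)"
      by (rule Bochner_Integration.integrable_bound[OF v]) (auto simp: indicator_def)
    have "emeasure (density (lborel_pow d) (\<lambda>x. ennreal (max 0 (v x)))) X = (\<integral>\<^sup>+x. ennreal (max 0 (v x) * indicator X x) \<partial>lborel_pow d)"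
      by (subst emeasure_density) (auto intro!: nn_integral_cong simp: indicator_def)
    also have "\<dots> = ennreal (LINT x|lborel_pow d. max 0 (v x) * indicator X x)"
      by (rule nn_integral_eq_integral[OF i]) auto
    finally show "emeasure (density (lborel_pow d) (\<lambda>x. ennreal (max 0 (v x)))) X = \<dots>" .
  qed
  have um: "integrable (lborel_pow d) (\<lambda>x. - u x)" using u by simp
  have boxes: "X \<in> sets (lborel_pow d)" if "X \<in> ?E" for X
    using that by (auto intro!: sets_PiM_I_finite)
  have "?P = ?M"
  proof (rule measure_eqI_generator_eq)
    show "Int_stable ?E"
    proof (rule Int_stableI)
      fix X Y assume "X \<in> ?E" "Y \<in> ?E"
      then obtain a b a' b' where "X = (\<Pi>\<^sub>E i\<in>{..<d}. {a i<..b i})" "Y = (\<Pi>\<^sub>E i\<in>{..<d}. {a' i<..b' i})" by auto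
      then have "X \<inter> Y = (\<Pi>\<^sub>E i\<in>{..<d}. {max (a i) (a' i)<..min (b i) (b' i)})"
        by (simp add: PiE_Int)
      then show "X \<inter> Y \<in> ?E" unfolding mem_Collect_eq by (intro exI conjI TrueI)
    qed
    show "?E \<subseteq> Pow (Rn d)" by (auto simp: Rn_def PiE_iff)
    show "sets ?P = sigma_sets (Rn d) ?E" "sets ?M = sigma_sets (Rn d) ?E" by (simp_all add: sets_lborel_pow_boxes)
    show "range (\<lambda>n. \<Pi>\<^sub>E i\<in>{..<d}. {- real n<..real n}) \<subseteq> ?E"
    proof (intro image_subsetI CollectI exI conjI TrueI)
      show "(\<Pi>\<^sub>E i\<in>{..<d}. {- real n<..real n}) = (\<Pi>\<^sub>E i\<in>{..<d}. {(\<lambda>_. - real n) i<..(\<lambda>_. real n) i})" for n by simp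
    qed
    show "(\<Union>n. \<Pi>\<^sub>E i\<in>{..<d}. {- real n<..real n}) = Rn d"
    proof (intro equalityI subsetI)
      fix x assume x: "x \<in> Rn d"
      obtain n where n: "(\<Sum>i<d. \<bar>x i\<bar>) < real n" using reals_Archimedean2 by blast
      have "x i \<in> {- real n<..real n}" if "i < d" for i
      proof -
        have "\<bar>x i\<bar> \<le> (\<Sum>i<d. \<bar>x i\<bar>)" using that by (intro member_le_sum) auto
        with n show ?thesis by auto
      qed
      with x show "x \<in> (\<Union>n. \<Pi>\<^sub>E i\<in>{..<d}. {- real n<..real n})" by (auto simp: Rn_def PiE_iff)
    qed (auto simp: Rn_def PiE_iff)
    show "emeasure ?P (\<Pi>\<^sub>E i\<in>{..<d}. {- real n<..real n}) \<noteq> \<infinity>" for n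
      by (subst Eint[OF u]) (auto intro!: sets_PiM_I_finite)
    fix X assume X: "X \<in> ?E"
    then obtain a b where Xe: "X = (\<Pi>\<^sub>E i\<in>{..<d}. {a i<..b i})" by auto
    have "(LINT x|lborel_pow d. ?p x * indicator X x) - (LINT x|lborel_pow d. ?m x * indicator X x)
       = (LINT x|lborel_pow d. ?p x * indicator X x - ?m x * indicator X x)"
      by (rule Bochner_Integration.integral_diff[OF Ei[OF u boxes[OF X]] Ei[OF um boxes[OF X]], symmetric])
    also have "\<dots> = (LINT x|lborel_pow d. u x * (\<Prod>i<d. indicator {a i<..b i} (x i)))"
      by (intro Bochner_Integration.integral_cong refl) (auto simp: Xe indicator_box left_diff_distrib[symmetric] max_def simp del: of_real_prod)
    also have "\<dots> = 0" by (rule z)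
    finally show "emeasure ?P X = emeasure ?M X"
      unfolding Eint[OF u boxes[OF X]] Eint[OF um boxes[OF X]] by simp
  qed
  then have "AE x in lborel_pow d. ennreal (?p x) = ennreal (?m x)"
    by (subst (asm) density_unique_iff) auto
  then show ?thesis by eventually_elim (auto simp: max_def split: if_splits)
qed

definition inverse_fourier :: "nat \<Rightarrow> (point \<Rightarrow> complex) \<Rightarrow> point \<Rightarrow> complex" where
  "inverse_fourier d F x = (LINT w|lborel_pow d. F w * exp (\<i> * complex_of_real (dot d w x)))"

section \<open>Inversion by integration over boxes\<close>

context
  fixes d :: nat and f :: "point \<Rightarrow> complex" and F :: "point \<Rightarrow> complex"
  assumes f: "integrable (lborel_pow d) f"
    and F_def: "\<And>w. F w = (LINT x|lborel_pow d. f x * exp (- \<i> * complex_of_real (dot d w x))) / complex_of_real ((2 * pi) ^ d)"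
    and F: "integrable (lborel_pow d) F"
begin

lemma f_measurable: "f \<in> borel_measurable (lborel_pow d)" and F_measurable: "F \<in> borel_measurable (lborel_pow d)"
  using f F by auto

lemma sigma_finite_lborel_pow: "sigma_finite_measure (lborel_pow d)"
  by (rule lbp.sigma_finite) simp

interpretation L: sigma_finite_measure "lborel_pow d" by (rule sigma_finite_lborel_pow)
interpretation LL: pair_sigma_finite "lborel_pow d" "lborel_pow d" ..

text \<open>Parseval's identity for a test function whose transform is integrable: Fubini moves the
  exponential from the test function to \<open>f\<close>. One factor \<open>2 * pi\<close> per
  coordinate cancels the denominator of \<open>F\<close>.\<close>

lemma mollified_box_integral:
  assumes \<epsilon>: "\<epsilon> > 0"
  shows "(LINT x|lborel_pow d. f x * complex_of_real (\<Prod>i<d. mollified \<epsilon> (a i) (b i) (x i)))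
       = (LINT w|lborel_pow d. F w * (\<Prod>i<d. complex_of_real (exp (- (\<epsilon> * w i)\<^sup>2 / 2)) * box_ft (a i) (b i) (w i)))"
proof -
  note [measurable] = f_measurable F_measurable
  let ?h = "\<lambda>i s. complex_of_real (exp (- (\<epsilon> * s)\<^sup>2 / 2)) * box_ft (a i) (b i) s"
  let ?H = "\<lambda>w. \<Prod>i<d. ?h i (w i)"
  have iH: "integrable (lborel_pow d) ?H"
  proof (rule lbp.product_integrable_prod)
    show "integrable lborel (?h i)" for i by (rule box_ft_mollified(1)[OF \<epsilon>])
  qed simp
  have Hm[measurable]: "?H \<in> borel_measurable (lborel_pow d)" using iH by auto
  have eq: "complex_of_real (2 * pi) ^ d * complex_of_real (\<Prod>i<d. mollified \<epsilon> (a i) (b i) (x i))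
     = (LINT w|lborel_pow d. ?H w * exp (- \<i> * complex_of_real (dot d w x)))" for x
  proof -
    have "complex_of_real (2 * pi) ^ d * complex_of_real (\<Prod>i<d. mollified \<epsilon> (a i) (b i) (x i))
       = (\<Prod>i<d. complex_of_real (2 * pi * mollified \<epsilon> (a i) (b i) (x i)))"
      by (simp add: prod.distrib)
    also have "\<dots> = (\<Prod>i<d. LINT s|lborel. ?h i s * iexp (- s * x i))"
      by (simp only: box_ft_mollified(2)[OF \<epsilon>])
    also have "\<dots> = (LINT w|lborel_pow d. (\<Prod>i<d. ?h i (w i) * iexp (- w i * x i)))"
    proof (rule lbp.product_integral_prod[symmetric])
      fix i
      show "integrable lborel (\<lambda>s. ?h i s * iexp (- s * x i))"
        by (rule Bochner_Integration.integrable_bound[OF box_ft_mollified(1)[OF \<epsilon>, of "a i" "b i"]])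
           (auto simp: norm_mult)
    qed simp
    also have "\<dots> = (LINT w|lborel_pow d. ?H w * exp (- \<i> * complex_of_real (dot d w x)))"
      using iexp_dot[of d "\<lambda>i. - _ i" x]
      by (intro Bochner_Integration.integral_cong refl)
         (simp add: prod.distrib dot_def sum_negf exp_sum sum_distrib_left)
    finally show ?thesis .
  qed
  let ?k = "\<lambda>w x. f x * ?H w * exp (- \<i> * complex_of_real (dot d w x))"
  have int: "integrable (lborel_pow d \<Otimes>\<^sub>M lborel_pow d) (case_prod ?k)"
  proof (rule LL.integrable_dominated_by_product[OF _ integrable_norm[OF iH] integrable_norm[OF f]])
    show "case_prod ?k \<in> borel_measurable (lborel_pow d \<Otimes>\<^sub>M lborel_pow d)"
      unfolding split_beta' by measurable
  qed (simp add: norm_mult)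
  have "complex_of_real (2 * pi) ^ d * (LINT x|lborel_pow d. f x * complex_of_real (\<Prod>i<d. mollified \<epsilon> (a i) (b i) (x i)))
     = (LINT x|lborel_pow d. f x * (complex_of_real (2 * pi) ^ d * complex_of_real (\<Prod>i<d. mollified \<epsilon> (a i) (b i) (x i))))"
    by (subst integral_mult_right_zero[symmetric]) (simp only: mult.left_commute)
  also have "\<dots> = (LINT x|lborel_pow d. LINT w|lborel_pow d. ?k w x)"
    unfolding eq by (simp only: integral_mult_right_zero[symmetric] mult.assoc)
  also have "\<dots> = (LINT w|lborel_pow d. LINT x|lborel_pow d. ?k w x)"
    by (rule LL.Fubini_integral[OF int])
  also have "\<dots> = (LINT w|lborel_pow d. complex_of_real (2 * pi) ^ d * (F w * ?H w))"
  proof (rule Bochner_Integration.integral_cong[OF refl])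
    fix w
    have "(LINT x|lborel_pow d. ?k w x) = ?H w * (LINT x|lborel_pow d. f x * exp (- \<i> * complex_of_real (dot d w x)))"
      by (subst integral_mult_right_zero[symmetric]) (simp only: mult_ac)
    also have "(LINT x|lborel_pow d. f x * exp (- \<i> * complex_of_real (dot d w x))) = complex_of_real (2 * pi) ^ d * F w"
      unfolding F_def by simp
    finally show "(LINT x|lborel_pow d. ?k w x) = complex_of_real (2 * pi) ^ d * (F w * ?H w)"
      by (simp only: mult_ac)
  qed
  also have "\<dots> = complex_of_real (2 * pi) ^ d * (LINT w|lborel_pow d. F w * ?H w)"
    by (rule integral_mult_right_zero)
  finally show ?thesis by simp
qed

text \<open>The width \<epsilon> tends to 0 on both sides. The dominating functions are
  \<open>norm (f x)\<close>, as smoothings lie between 0 and 1, and a multiple of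
  \<open>norm (F w)\<close>, as the transform of an interval is bounded by its length; here
  integrability of \<open>F\<close> enters.\<close>

lemma box_integral:
  "(LINT x|lborel_pow d. f x * complex_of_real (\<Prod>i<d. indicator {a i<..b i} (x i)))
     = (LINT w|lborel_pow d. F w * (\<Prod>i<d. box_ft (a i) (b i) (w i)))"
proof -
  note [measurable] = f_measurable F_measurable
  define \<epsilon> where "\<epsilon> n = inverse (real (Suc n))" for n
  have \<epsilon>: "\<epsilon> n > 0" for n by (simp add: \<epsilon>_def)
  have \<epsilon>0: "\<epsilon> \<longlonglongrightarrow> 0" unfolding \<epsilon>_def by (rule LIMSEQ_inverse_real_of_nat)
  have xm[measurable]: "(\<lambda>x. x i) \<in> borel_measurable (lborel_pow d)" if "i \<in> {..<d}" for i
    using lborel_pow_component[of i d] that by simp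
  have A: "(\<lambda>n. LINT x|lborel_pow d. f x * complex_of_real (\<Prod>i<d. mollified (\<epsilon> n) (a i) (b i) (x i)))
     \<longlonglongrightarrow> (LINT x|lborel_pow d. f x * complex_of_real (\<Prod>i<d. indicator {a i<..b i} (x i)))"
  proof (rule integral_dominated_convergence)
    show "integrable (lborel_pow d) (\<lambda>x. norm (f x))" by (rule integrable_norm[OF f])
    have "AE x in lborel_pow d. \<forall>i\<in>{..<d}. x i \<noteq> a i \<and> x i \<noteq> b i"
      using AE_lborel_pow_coord by (subst AE_finite_all) (auto simp: AE_conj_iff)
    then show "AE x in lborel_pow d. (\<lambda>n. f x * complex_of_real (\<Prod>i<d. mollified (\<epsilon> n) (a i) (b i) (x i)))
        \<longlonglongrightarrow> f x * complex_of_real (\<Prod>i<d. indicator {a i<..b i} (x i))"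
    proof eventually_elim
      fix x assume "\<forall>i\<in>{..<d}. x i \<noteq> a i \<and> x i \<noteq> b i"
      then show "(\<lambda>n. f x * complex_of_real (\<Prod>i<d. mollified (\<epsilon> n) (a i) (b i) (x i)))
        \<longlonglongrightarrow> f x * complex_of_real (\<Prod>i<d. indicator {a i<..b i} (x i))"
        by (intro tendsto_intros tendsto_prod mollified_tendsto \<epsilon> \<epsilon>0) auto
    qed
    fix n
    have "\<bar>\<Prod>i<d. mollified (\<epsilon> n) (a i) (b i) (x i)\<bar> \<le> 1" for x
      unfolding abs_prod using mollified_bounds[OF \<epsilon>[of n]] by (intro prod_le_1) auto
    then show "AE x in lborel_pow d. norm (f x * complex_of_real (\<Prod>i<d. mollified (\<epsilon> n) (a i) (b i) (x i))) \<le> norm (f x)"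
      by (intro AE_I2) (simp add: norm_mult mult_left_le del: of_real_prod)
  qed measurable
  have B: "(\<lambda>n. LINT w|lborel_pow d. F w * (\<Prod>i<d. complex_of_real (exp (- (\<epsilon> n * w i)\<^sup>2 / 2)) * box_ft (a i) (b i) (w i)))
     \<longlonglongrightarrow> (LINT w|lborel_pow d. F w * (\<Prod>i<d. box_ft (a i) (b i) (w i)))"
  proof (rule integral_dominated_convergence)
    show "integrable (lborel_pow d) (\<lambda>w. norm (F w) * (\<Prod>i<d. max 0 (b i - a i)))"
      by (intro integrable_mult_left integrable_norm F)
    show "AE w in lborel_pow d. (\<lambda>n. F w * (\<Prod>i<d. complex_of_real (exp (- (\<epsilon> n * w i)\<^sup>2 / 2)) * box_ft (a i) (b i) (w i)))
       \<longlonglongrightarrow> F w * (\<Prod>i<d. box_ft (a i) (b i) (w i))"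
    proof (rule AE_I2)
      fix w :: point
      have "(\<lambda>n. complex_of_real (exp (- (\<epsilon> n * w i)\<^sup>2 / 2))) \<longlonglongrightarrow> complex_of_real (exp (- (0 * w i)\<^sup>2 / 2))" for i
        by (intro tendsto_intros \<epsilon>0) auto
      then have "(\<lambda>n. F w * (\<Prod>i<d. complex_of_real (exp (- (\<epsilon> n * w i)\<^sup>2 / 2)) * box_ft (a i) (b i) (w i)))
         \<longlonglongrightarrow> F w * (\<Prod>i<d. complex_of_real (exp (- (0 * w i)\<^sup>2 / 2)) * box_ft (a i) (b i) (w i))"
        by (intro tendsto_mult tendsto_prod tendsto_const) auto
      then show "(\<lambda>n. F w * (\<Prod>i<d. complex_of_real (exp (- (\<epsilon> n * w i)\<^sup>2 / 2)) * box_ft (a i) (b i) (w i)))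
         \<longlonglongrightarrow> F w * (\<Prod>i<d. box_ft (a i) (b i) (w i))" by simp
    qed
    fix n
    have "cmod (\<Prod>i<d. complex_of_real (exp (- (\<epsilon> n * w i)\<^sup>2 / 2)) * box_ft (a i) (b i) (w i)) \<le> (\<Prod>i<d. max 0 (b i - a i))" for w :: point
      unfolding prod_norm[symmetric]
    proof (intro prod_mono conjI)
      fix i
      have "cmod (complex_of_real (exp (- (\<epsilon> n * w i)\<^sup>2 / 2)) * box_ft (a i) (b i) (w i)) \<le> 1 * max 0 (b i - a i)"
        unfolding norm_mult by (intro mult_mono box_ft_bound) auto
      then show "cmod (complex_of_real (exp (- (\<epsilon> n * w i)\<^sup>2 / 2)) * box_ft (a i) (b i) (w i)) \<le> max 0 (b i - a i)" by simp
    qed simp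
    then show "AE w in lborel_pow d. norm (F w * (\<Prod>i<d. complex_of_real (exp (- (\<epsilon> n * w i)\<^sup>2 / 2)) * box_ft (a i) (b i) (w i)))
        \<le> norm (F w) * (\<Prod>i<d. max 0 (b i - a i))"
      by (intro AE_I2) (auto simp only: norm_mult intro!: mult_left_mono norm_ge_zero)
  qed measurable
  show ?thesis
    using LIMSEQ_unique[OF A[unfolded mollified_box_integral[OF \<epsilon>]] B] .
qed

lemma inverse_fourier_measurable: "inverse_fourier d F \<in> borel_measurable (lborel_pow d)"
  unfolding inverse_fourier_def
proof (rule L.borel_measurable_lebesgue_integral)
  note [measurable] = F_measurable
  have [measurable]: "(\<lambda>(x, w). dot d w x) \<in> borel_measurable (lborel_pow d \<Otimes>\<^sub>M lborel_pow d)"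
    unfolding dot_def split_beta' by measurable
  show "(\<lambda>(x, w). F w * exp (\<i> * complex_of_real (dot d w x))) \<in> borel_measurable (lborel_pow d \<Otimes>\<^sub>M lborel_pow d)"
    by measurable
qed

lemma inverse_fourier_box_integral:
  "(LINT x|lborel_pow d. f x * complex_of_real (\<Prod>i<d. indicator {a i<..b i} (x i)))
     = (LINT x|lborel_pow d. inverse_fourier d F x * complex_of_real (\<Prod>i<d. indicator {a i<..b i} (x i)))"
proof -
  note [measurable] = F_measurable
  let ?I = "\<lambda>x. \<Prod>i<d. indicator {a i<..b i} (x i) :: real"
  have xm[measurable]: "(\<lambda>x. x i) \<in> borel_measurable (lborel_pow d)" if "i \<in> {..<d}" for i
    using lborel_pow_component[of i d] that by simp
  have iI: "integrable (lborel_pow d) ?I"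
    by (rule lbp.product_integrable_prod) (auto intro: integrable_indicator_Ioc)
  let ?k = "\<lambda>w x. F w * (complex_of_real (?I x) * exp (\<i> * complex_of_real (dot d w x)))"
  have int: "integrable (lborel_pow d \<Otimes>\<^sub>M lborel_pow d) (case_prod ?k)"
  proof (rule LL.integrable_dominated_by_product[OF _ integrable_norm[OF F] integrable_norm[OF iI]])
    have [measurable]: "?I \<in> borel_measurable (lborel_pow d)" using iI by auto
    show "case_prod ?k \<in> borel_measurable (lborel_pow d \<Otimes>\<^sub>M lborel_pow d)"
      unfolding split_beta' by measurable
  qed (simp add: norm_mult del: of_real_prod)
  have "(\<Prod>i<d. box_ft (a i) (b i) (w i)) = (LINT x|lborel_pow d. complex_of_real (?I x) * exp (\<i> * complex_of_real (dot d w x)))" for w :: point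
  proof -
    have "(\<Prod>i<d. box_ft (a i) (b i) (w i)) = (LINT x|lborel_pow d. (\<Prod>i<d. indicator {a i<..b i} (x i) *\<^sub>R iexp (w i * x i)))"
      unfolding box_ft_def
    proof (rule lbp.product_integral_prod[symmetric])
      show "integrable lborel (\<lambda>y. indicator {a i<..b i} y *\<^sub>R iexp (w i * y))" for i
        by (rule Bochner_Integration.integrable_bound[OF integrable_indicator_Ioc[of "a i" "b i"]]) auto
    qed simp
    then show ?thesis by (simp add: scaleR_conv_of_real prod.distrib iexp_dot)
  qed
  then have "(LINT x|lborel_pow d. f x * complex_of_real (?I x)) = (LINT w|lborel_pow d. LINT x|lborel_pow d. ?k w x)"
    unfolding box_integral by (simp only: integral_mult_right_zero)
  also have "\<dots> = (LINT x|lborel_pow d. LINT w|lborel_pow d. ?k w x)"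
    using LL.Fubini_integral[OF int] by simp
  also have "\<dots> = (LINT x|lborel_pow d. inverse_fourier d F x * complex_of_real (?I x))"
  proof (rule Bochner_Integration.integral_cong[OF refl])
    fix x
    show "(LINT w|lborel_pow d. ?k w x) = inverse_fourier d F x * complex_of_real (?I x)"
      unfolding inverse_fourier_def by (subst integral_mult_left_zero[symmetric]) (simp only: mult_ac)
  qed
  finally show ?thesis .
qed

lemma fourier_inversion:
  "AE x in lborel_pow d. x \<in> unit_cube d \<longrightarrow> Re (f x) = Re (LINT w|lborel_pow d. F w * exp (\<i> * complex_of_real (dot d w x)))"
proof -
  note [measurable] = f_measurable F_measurable inverse_fourier_measurable
  have xm[measurable]: "(\<lambda>x. x i) \<in> borel_measurable (lborel_pow d)" if "i \<in> {..<d}" for i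
    using lborel_pow_component[of i d] that by simp
  let ?D = "\<lambda>x. \<Prod>i<d. indicator {0<..1} (x i) :: real"
  have iD: "integrable (lborel_pow d) ?D"
    by (rule lbp.product_integrable_prod) (auto intro: integrable_indicator_Ioc)
  have Dm[measurable]: "?D \<in> borel_measurable (lborel_pow d)" using iD by auto
  \<comment> \<open>The inverse transform is bounded but perhaps not integrable. Cutting off to a
    half-open cube around \<open>unit_cube d\<close> makes the difference integrable, and
    multiplying by the indicator of a box again gives the indicator of a box.\<close>
  define u where "u x = Re (f x - inverse_fourier d F x) * ?D x" for x
  have FiB: "cmod (inverse_fourier d F x) \<le> (LINT w|lborel_pow d. cmod (F w))" for x
  proof -
    have "cmod (inverse_fourier d F x) \<le> (LINT w|lborel_pow d. cmod (F w * exp (\<i> * complex_of_real (dot d w x))))"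
      unfolding inverse_fourier_def by (rule integral_norm_bound)
    then show ?thesis by (simp add: norm_mult)
  qed
  have ifD: "integrable (lborel_pow d) (\<lambda>x. f x * complex_of_real (\<Prod>i<d. indicator {a i<..b i} (x i)))" for a b
  proof (rule Bochner_Integration.integrable_bound[OF f])
    show "AE x in lborel_pow d. norm (f x * complex_of_real (\<Prod>i<d. indicator {a i<..b i} (x i))) \<le> norm (f x)"
    proof (rule AE_I2)
      fix x
      have "\<bar>\<Prod>i<d. indicator {a i<..b i} (x i) :: real\<bar> \<le> 1" unfolding abs_prod by (intro prod_le_1) (auto simp: indicator_def)
      then show "norm (f x * complex_of_real (\<Prod>i<d. indicator {a i<..b i} (x i))) \<le> norm (f x)"
        by (simp add: norm_mult mult_left_le del: of_real_prod)
    qed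
  qed measurable
  have iFD: "integrable (lborel_pow d) (\<lambda>x. inverse_fourier d F x * complex_of_real (\<Prod>i<d. indicator {a i<..b i} (x i)))" for a b
  proof (rule Bochner_Integration.integrable_bound)
    show "integrable (lborel_pow d) (\<lambda>x. (LINT w|lborel_pow d. cmod (F w)) * (\<Prod>i<d. indicator {a i<..b i} (x i) :: real))"
      by (intro integrable_mult_right lbp.product_integrable_prod) (auto intro: integrable_indicator_Ioc)
    show "AE x in lborel_pow d. norm (inverse_fourier d F x * complex_of_real (\<Prod>i<d. indicator {a i<..b i} (x i)))
        \<le> norm ((LINT w|lborel_pow d. cmod (F w)) * (\<Prod>i<d. indicator {a i<..b i} (x i) :: real))"
      using FiB by (intro AE_I2) (auto simp: norm_mult abs_mult simp del: of_real_prod intro!: mult_right_mono order_trans[OF FiB abs_ge_self])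
  qed measurable
  have "AE x in lborel_pow d. u x = 0"
  proof (rule AE_zero_if_box_integrals_zero)
    have eq: "Re (f x * complex_of_real (?D x) - inverse_fourier d F x * complex_of_real (?D x)) = u x" for x
      by (simp add: u_def left_diff_distrib del: of_real_prod)
    have "integrable (lborel_pow d) (\<lambda>x. Re (f x * complex_of_real (?D x) - inverse_fourier d F x * complex_of_real (?D x)))"
      by (intro integrable_Re Bochner_Integration.integrable_diff ifD iFD)
    then show "integrable (lborel_pow d) u" by (simp only: eq)
    fix a b :: "nat \<Rightarrow> real"
    let ?B = "\<lambda>x. \<Prod>i<d. indicator {max 0 (a i)<..min 1 (b i)} (x i) :: real"
    have B: "?D x * (\<Prod>i<d. indicator {a i<..b i} (x i)) = ?B x" for x
      by (subst prod.distrib[symmetric], intro prod.cong) (auto simp: indicator_def)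
    have "(LINT x|lborel_pow d. u x * (\<Prod>i<d. indicator {a i<..b i} (x i)))
        = (LINT x|lborel_pow d. Re (f x * complex_of_real (?B x) - inverse_fourier d F x * complex_of_real (?B x)))"
      unfolding B[symmetric] by (intro Bochner_Integration.integral_cong refl) (simp add: u_def algebra_simps del: of_real_prod)
    also have "\<dots> = Re (LINT x|lborel_pow d. f x * complex_of_real (?B x) - inverse_fourier d F x * complex_of_real (?B x))"
      by (rule integral_Re) (intro Bochner_Integration.integrable_diff ifD iFD)
    also have "\<dots> = 0"
      using inverse_fourier_box_integral[of "\<lambda>i. max 0 (a i)" "\<lambda>i. min 1 (b i)"] ifD iFD by (subst Bochner_Integration.integral_diff) auto
    finally show "(LINT x|lborel_pow d. u x * (\<Prod>i<d. indicator {a i<..b i} (x i))) = 0" .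
  qed
  then show ?thesis
  proof eventually_elim
    fix x assume u: "u x = 0"
    show "x \<in> unit_cube d \<longrightarrow> Re (f x) = Re (LINT w|lborel_pow d. F w * exp (\<i> * complex_of_real (dot d w x)))"
    proof
      assume "x \<in> unit_cube d"
      then have "?D x = 1" by (intro prod.neutral) (force simp: unit_cube_def PiE_iff indicator_def)
      then show "Re (f x) = Re (LINT w|lborel_pow d. F w * exp (\<i> * complex_of_real (dot d w x)))"
        using u by (simp add: u_def inverse_fourier_def)
    qed
  qed
qed

end

section \<open>Representation by ReLU units\<close>

definition axis :: "nat \<Rightarrow> point" where
  "axis d = (\<lambda>i\<in>{..<d}. if i = 0 then 1 else 0)"

text \<open>The sign of the Taylor variable \<open>s\<close> selects \<open>w\<close> or its
  negative, so one family of units serves both halves of the remainder. At \<open>w = 0\<close> an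
  arbitrary unit vector stands in.\<close>

definition direction :: "nat \<Rightarrow> point \<Rightarrow> real \<Rightarrow> point" where
  "direction d w s = (if norm1 d w = 0 then axis d else (\<lambda>i\<in>{..<d}. (if s < 0 then - 1 else 1) * (w i / norm1 d w)))"

text \<open>The offset is clamped at -1 so that every parameter yields a valid unit; the density
  used later vanishes for \<open>\<bar>s\<bar> > 1\<close>.\<close>

definition unit_param :: "nat \<Rightarrow> point \<times> real \<Rightarrow> point \<times> real" where
  "unit_param d \<theta> = (direction d (fst \<theta>) (snd \<theta>), - min 1 \<bar>snd \<theta>\<bar>)"

lemma norm1_nonneg: "0 \<le> norm1 d w" by (simp add: norm1_def sum_nonneg)

lemma norm1_axis: "d \<ge> 1 \<Longrightarrow> norm1 d (axis d) = 1"
proof -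
  assume "d \<ge> 1"
  have "norm1 d (axis d) = (\<Sum>i<d. if i = 0 then 1 else 0)"
    unfolding norm1_def by (intro sum.cong) (auto simp: axis_def)
  with \<open>d \<ge> 1\<close> show ?thesis by simp
qed

lemma axis_Rn: "axis d \<in> Rn d" by (simp add: axis_def Rn_def)

lemma dot_axis: "d \<ge> 1 \<Longrightarrow> dot d (axis d) x = x 0"
proof -
  assume "d \<ge> 1"
  have "dot d (axis d) x = (\<Sum>i<d. if i = 0 then x 0 else 0)"
    unfolding dot_def by (intro sum.cong) (auto simp: axis_def)
  with \<open>d \<ge> 1\<close> show ?thesis by simp
qed

lemma direction_norm1: "d \<ge> 1 \<Longrightarrow> norm1 d (direction d w s) = 1"
proof (cases "norm1 d w = 0")
  case False
  have "norm1 d (direction d w s) = (\<Sum>i<d. \<bar>w i\<bar> / norm1 d w)"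
    using False norm1_nonneg[of d w] unfolding norm1_def[of d "direction d w s"]
    by (intro sum.cong) (auto simp: direction_def abs_mult)
  also have "\<dots> = 1" using False by (simp add: sum_divide_distrib[symmetric] norm1_def)
  finally show ?thesis .
qed (simp add: direction_def norm1_axis)

lemma direction_Rn: "direction d w s \<in> Rn d"
  using axis_Rn by (simp add: direction_def Rn_def)

lemma dot_direction: "norm1 d w \<noteq> 0 \<Longrightarrow> dot d (direction d w s) x = (if s < 0 then - 1 else 1) * (dot d w x / norm1 d w)"
  by (auto simp: dot_def direction_def sum_divide_distrib sum_negf[symmetric] intro!: sum.cong)

lemma norm1_measurable[measurable]: "norm1 d \<in> borel_measurable (lborel_pow d)"
  unfolding norm1_def by measurable

lemma direction_measurable[measurable]:
  "(\<lambda>z. direction d (fst z) (snd z)) \<in> measurable (lborel_pow d \<Otimes>\<^sub>M borel) (lborel_pow d)"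
proof (rule measurable_PiM_single')
  fix i assume i: "i \<in> {..<d}"
  have [measurable]: "(\<lambda>w. w i) \<in> borel_measurable (lborel_pow d)"
    using lborel_pow_component[of i d] i by simp
  have "direction d (fst z) (snd z) i = (if norm1 d (fst z) = 0 then (if i = 0 then 1 else 0)
      else (if snd z < 0 then - 1 else 1) * (fst z i / norm1 d (fst z)))" for z
    using i by (simp add: direction_def axis_def)
  then show "(\<lambda>z. direction d (fst z) (snd z) i) \<in> measurable (lborel_pow d \<Otimes>\<^sub>M borel) lborel"
    by simp
qed (use direction_Rn in \<open>auto simp: Rn_def\<close>)

lemma unit_param_measurable[measurable]:
  "unit_param d \<in> measurable (lborel_pow d \<Otimes>\<^sub>M borel) (lborel_pow d \<Otimes>\<^sub>M borel)"
  unfolding unit_param_def by measurable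

text \<open>The kernel vanishes unless \<open>s\<close> lies between \<open>0\<close> and \<open>z\<close>, so that one integral covers both signs
  of \<open>z\<close>.\<close>

lemma taylor_relu:
  fixes g :: "real \<Rightarrow> real"
  assumes g: "\<And>t. (g has_real_derivative g' t) (at t)" "\<And>t. (g' has_real_derivative g'' t) (at t)"
    and g'': "continuous_on UNIV g''" and z: "\<bar>z\<bar> \<le> 1"
  shows "g z = g 0 + g' 0 * z + (LINT s|lborel. indicator {-1..1} s * g'' s * relu ((if s < 0 then - 1 else 1) * z - \<bar>s\<bar>))"
proof (cases "z \<ge> 0")
  case True
  have "(LINT s|lborel. indicator {-1..1} s * g'' s * relu ((if s < 0 then - 1 else 1) * z - \<bar>s\<bar>))
      = (LINT s|lborel. ((z - s) * g'' s) * indicator {0..z} s)"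
    using True z by (intro Bochner_Integration.integral_cong) (auto simp: indicator_def relu_def max_def)
  also have "\<dots> = ((z - z) * g' z + g z) - ((z - 0) * g' 0 + g 0)"
  proof (rule integral_FTC_Icc_real[OF True])
    fix s
    show "((\<lambda>s. (z - s) * g' s + g s) has_real_derivative (z - s) * g'' s) (at s)"
      by (rule derivative_eq_intros g refl | simp)+
    show "isCont (\<lambda>s. (z - s) * g'' s) s"
      using g'' by (intro continuous_intros) (simp add: continuous_on_eq_continuous_at)
  qed
  finally show ?thesis by (simp add: algebra_simps)
next
  case False
  have m[measurable]: "g'' \<in> borel_measurable borel" using g'' by (rule borel_measurable_continuous_onI)
  have "(LINT s|lborel. indicator {-1..1} s * g'' s * relu ((if s < 0 then - 1 else 1) * z - \<bar>s\<bar>))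
      = (LINT s|lborel. ((s - z) * g'' s) * indicator {z..0} s)"
  proof (rule integral_cong_AE)
    show "AE s in lborel. indicator {-1..1} s * g'' s * relu ((if s < 0 then - 1 else 1) * z - \<bar>s\<bar>) = ((s - z) * g'' s) * indicator {z..0} s"
      using AE_lborel_singleton[of 0]
      by eventually_elim (use False z in \<open>auto simp: indicator_def relu_def max_def\<close>)
  qed measurable
  also have "\<dots> = ((0 - z) * g' 0 - g 0) - ((z - z) * g' z - g z)"
  proof (rule integral_FTC_Icc_real)
    show "z \<le> 0" using False by simp
    fix s
    show "((\<lambda>s. (s - z) * g' s - g s) has_real_derivative (s - z) * g'' s) (at s)"
      by (rule derivative_eq_intros g refl | simp)+
    show "isCont (\<lambda>s. (s - z) * g'' s) s"
      using g'' by (intro continuous_intros) (simp add: continuous_on_eq_continuous_at)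
  qed
  finally show ?thesis by (simp add: algebra_simps)
qed

lemma Re_iexp: "Re (c * iexp y) = Re c * cos y - Im c * sin y"
  by (simp add: Re_exp Im_exp)

text \<open>The second derivative brings out the square of the frequency \<open>L\<close>; with
  \<open>L = norm1 d w\<close> this is where the weight of order 2 in the Barron norm is
  spent.\<close>

lemma Re_iexp_relu:
  fixes c :: complex
  assumes z: "\<bar>z\<bar> \<le> 1"
  shows "Re (c * iexp (L * z)) = Re c - Im c * L * z
     + (LINT s|lborel. indicator {-1..1} s * (- (L\<^sup>2 * Re (c * iexp (L * s)))) * relu ((if s < 0 then - 1 else 1) * z - \<bar>s\<bar>))"
  unfolding Re_iexp
  by (subst taylor_relu[where g="\<lambda>t. Re c * cos (L * t) - Im c * sin (L * t)"
        and g'="\<lambda>t. - (L * (Re c * sin (L * t) + Im c * cos (L * t)))"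
        and g''="\<lambda>t. - (L\<^sup>2 * (Re c * cos (L * t) - Im c * sin (L * t)))", OF _ _ _ z])
     (auto intro!: derivative_eq_intros continuous_intros simp: algebra_simps power2_eq_square)

lemma unit_jet_0: "x \<in> unit_cube d \<Longrightarrow> unit_jet d 0 (w, t) x = relu (dot d w x + t)"
  by (simp add: unit_jet_def)

lemma relu_linear: "relu y - relu (- y) = y" by (simp add: relu_def)

section \<open>Admissible units and mixtures of them\<close>

definition valid_unit :: "nat \<Rightarrow> point \<times> real \<Rightarrow> bool" where
  "valid_unit d q \<longleftrightarrow> fst q \<in> Rn d \<and> norm1 d (fst q) = 1 \<and> -1 \<le> snd q \<and> snd q < 1"

lemma unit_param_valid: "d \<ge> 1 \<Longrightarrow> valid_unit d (unit_param d \<theta>)"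
  by (auto simp: valid_unit_def unit_param_def direction_norm1 direction_Rn)

lemma valid_unit_bound: "valid_unit d q \<Longrightarrow> j \<le> d \<Longrightarrow> \<bar>unit_jet d j q x\<bar> \<le> 2"
  using unit_jet_bound[of d "fst q" "snd q" j x] by (auto simp: valid_unit_def)

text \<open>A linear form is \<open>relu y - relu (- y)\<close> after its vector has been
  normalized. A constant is a difference of two units along the first axis, both of them active
  because \<open>x 0 > 0\<close> on the cube.\<close>

lemma affine_four_units:
  assumes d: "d \<ge> 1" and v: "v \<in> Rn d"
  shows "\<exists>c q. (\<forall>k<4. valid_unit d (q k)) \<and> (\<Sum>k<4::nat. \<bar>c k\<bar>) = 4 * \<bar>a\<bar> + 2 * norm1 d v \<and>
     (\<forall>x\<in>unit_cube d. a + dot d v x = (\<Sum>k<4::nat. c k * unit_jet d 0 (q k) x))"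
proof -
  define u where "u s = direction d v s" for s
  \<comment> \<open>Offsets 1/2 and 0 with weights \<open>2 * a\<close> and \<open>- 2 * a\<close>
    yield \<open>a\<close>. A gap of 1 is excluded: offsets stay below 1, and a negative one could
    switch its unit off.\<close>
  define c :: "nat \<Rightarrow> real" where "c = (!) [2 * a, - 2 * a, norm1 d v, - norm1 d v]"
  define q where "q = (!) [(axis d, 1/2), (axis d, 0), (u 1, 0), (u (- 1), 0 :: real)]"
  have s4: "(\<Sum>k<4::nat. f k) = f 0 + f 1 + f 2 + f 3" for f :: "nat \<Rightarrow> real"
    by (simp add: eval_nat_numeral)
  have "\<forall>k<4. valid_unit d (q k)"
  proof (intro allI impI)
    fix k :: nat assume "k < 4"
    then have "k \<in> {0, 1, 2, 3}" by auto
    then show "valid_unit d (q k)"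
      using d by (auto simp: q_def u_def valid_unit_def norm1_axis axis_Rn direction_norm1 direction_Rn)
  qed
  moreover have "(\<Sum>k<4::nat. \<bar>c k\<bar>) = 4 * \<bar>a\<bar> + 2 * norm1 d v"
    unfolding s4 using norm1_nonneg[of d v] by (simp add: c_def abs_mult eval_nat_numeral)
  moreover have "a + dot d v x = (\<Sum>k<4::nat. c k * unit_jet d 0 (q k) x)" if x: "x \<in> unit_cube d" for x
  proof -
    have x0: "x 0 > 0" using x d by (auto simp: unit_cube_def PiE_iff)
    have "norm1 d v * relu (dot d (u 1) x) - norm1 d v * relu (dot d (u (- 1)) x) = dot d v x"
    proof (cases "norm1 d v = 0")
      case True
      then have "\<forall>i<d. v i = 0" by (simp add: norm1_def sum_nonneg_eq_0_iff)
      then show ?thesis using True by (simp add: dot_def)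
    next
      case False
      have "norm1 d v * relu (dot d (u 1) x) - norm1 d v * relu (dot d (u (- 1)) x)
         = norm1 d v * (relu (dot d v x / norm1 d v) - relu (- (dot d v x / norm1 d v)))"
        using False by (simp add: u_def dot_direction right_diff_distrib)
      also have "\<dots> = dot d v x" using False by (simp add: relu_linear)
      finally show ?thesis .
    qed
    moreover have "2 * a * relu (dot d (axis d) x + 1/2) - 2 * a * relu (dot d (axis d) x) = a"
      using x0 d by (simp add: dot_axis relu_def algebra_simps)
    ultimately show ?thesis
      unfolding s4 using x by (simp add: c_def q_def unit_jet_0 eval_nat_numeral)
  qed
  ultimately show ?thesis by blast
qed

text \<open>The four units \<open>q k\<close> carry the affine part; \<open>sg\<close> is the sign of the density, \<open>\<nu>\<close> being a
  positive measure.\<close>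

definition relu_mixture ::
    "nat \<Rightarrow> real \<Rightarrow> (point \<Rightarrow> real) \<Rightarrow> (nat \<Rightarrow> real) \<Rightarrow> (nat \<Rightarrow> point \<times> real) \<Rightarrow> 't measure \<Rightarrow>
     ('t \<Rightarrow> real) \<Rightarrow> ('t \<Rightarrow> point \<times> real) \<Rightarrow> bool" where
  "relu_mixture d B f c q \<nu> sg p \<longleftrightarrow>
     finite_measure \<nu> \<and> sg \<in> borel_measurable \<nu> \<and> (\<forall>\<theta>. sg \<theta> \<in> {-1, 0, 1}) \<and>
     p \<in> measurable \<nu> (lborel_pow d \<Otimes>\<^sub>M borel) \<and>
     (\<forall>\<theta>. valid_unit d (p \<theta>) \<and> snd (p \<theta>) \<le> 0) \<and> (\<forall>k<4. valid_unit d (q k)) \<and>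
     (\<Sum>k<4. \<bar>c k\<bar>) + measure \<nu> (space \<nu>) \<le> B \<and>
     (AE x in lborel_pow d. x \<in> unit_cube d \<longrightarrow>
        f x = (\<Sum>k<4. c k * unit_jet d 0 (q k) x) + (LINT \<theta>|\<nu>. sg \<theta> * unit_jet d 0 (p \<theta>) x))"

lemma relu_mixtureD:
  assumes "relu_mixture d B f c q \<nu> sg p"
  shows "finite_measure \<nu>" "sg \<in> borel_measurable \<nu>" "\<forall>\<theta>. sg \<theta> \<in> {-1, 0, 1}"
    "p \<in> measurable \<nu> (lborel_pow d \<Otimes>\<^sub>M borel)"
    "\<forall>\<theta>. valid_unit d (p \<theta>) \<and> snd (p \<theta>) \<le> 0" "\<forall>k<4. valid_unit d (q k)"
    "(\<Sum>k<4. \<bar>c k\<bar>) + measure \<nu> (space \<nu>) \<le> B"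
    "AE x in lborel_pow d. x \<in> unit_cube d \<longrightarrow>
        f x = (\<Sum>k<4. c k * unit_jet d 0 (q k) x) + (LINT \<theta>|\<nu>. sg \<theta> * unit_jet d 0 (p \<theta>) x)"
  using assms unfolding relu_mixture_def by - (elim conjE, assumption)+

lemma relu_mixture_cong:
  assumes "relu_mixture d B f c q \<nu> sg p" and "B \<le> B'" and "AE x in lborel_pow d. x \<in> unit_cube d \<longrightarrow> g x = f x"
  shows "relu_mixture d B' g c q \<nu> sg p"
proof -
  note R = relu_mixtureD[OF assms(1)]
  have "AE x in lborel_pow d. x \<in> unit_cube d \<longrightarrow>
        g x = (\<Sum>k<4. c k * unit_jet d 0 (q k) x) + (LINT \<theta>|\<nu>. sg \<theta> * unit_jet d 0 (p \<theta>) x)"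
    using assms(3) R(8) by eventually_elim simp
  moreover have "(\<Sum>k<4. \<bar>c k\<bar>) + measure \<nu> (space \<nu>) \<le> B'" using R(7) assms(2) by linarith
  ultimately show ?thesis unfolding relu_mixture_def by (intro conjI R(1-6))
qed

text \<open>Per frequency, the affine part costs at most \<open>4 + 2 * norm1 d w\<close> and the
  remainder \<open>2 * (norm1 d w)\<^sup>2\<close>, the Taylor variable ranging over an interval of
  length 2. The sum is at most \<open>4 * (1 + norm1 d w)\<^sup>2\<close>, whence the constant
  4.\<close>

lemma relu_representation:
  fixes F :: "point \<Rightarrow> complex"
  assumes d: "d \<ge> 1" and Fm[measurable]: "F \<in> borel_measurable (lborel_pow d)"
    and iV: "integrable (lborel_pow d) (\<lambda>w. (1 + norm1 d w)\<^sup>2 * cmod (F w))"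
  defines "V \<equiv> LINT w|lborel_pow d. (1 + norm1 d w)\<^sup>2 * cmod (F w)"
  shows "\<exists>c q (\<nu> :: (point \<times> real) measure) sg p. relu_mixture d (4 * V)
     (\<lambda>x. Re (LINT w|lborel_pow d. F w * exp (\<i> * complex_of_real (dot d w x)))) c q \<nu> sg p"
proof -
  let ?L = "norm1 d"
  interpret L: sigma_finite_measure "lborel_pow d" by (rule lbp.sigma_finite) simp
  interpret LB: pair_sigma_finite "lborel_pow d" "lborel :: real measure" ..
  have wm[measurable]: "(\<lambda>w. w i) \<in> borel_measurable (lborel_pow d)" if "i \<in> {..<d}" for i
    using lborel_pow_component[of i d] that by simp
  have sq: "1 \<le> (1 + ?L w)\<^sup>2" "?L w \<le> (1 + ?L w)\<^sup>2" "(?L w)\<^sup>2 \<le> (1 + ?L w)\<^sup>2"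
     "4 + 2 * ?L w + 2 * (?L w)\<^sup>2 \<le> 4 * (1 + ?L w)\<^sup>2" for w
    using norm1_nonneg[of d w] by (simp_all add: power2_eq_square algebra_simps)
  have iF0: "integrable (lborel_pow d) (\<lambda>w. cmod (F w))"
  proof (rule Bochner_Integration.integrable_bound[OF iV])
    show "AE w in lborel_pow d. norm (cmod (F w)) \<le> norm ((1 + ?L w)\<^sup>2 * cmod (F w))"
    proof (rule AE_I2)
      fix w show "norm (cmod (F w)) \<le> norm ((1 + ?L w)\<^sup>2 * cmod (F w))"
        using mult_right_mono[OF sq(1)[of w] norm_ge_zero[of "F w"]] norm1_nonneg[of d w] by (simp add: abs_mult)
    qed
  qed simp
  have iF1: "integrable (lborel_pow d) (\<lambda>w. ?L w * cmod (F w))"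
  proof (rule Bochner_Integration.integrable_bound[OF iV])
    show "AE w in lborel_pow d. norm (?L w * cmod (F w)) \<le> norm ((1 + ?L w)\<^sup>2 * cmod (F w))"
    proof (rule AE_I2)
      fix w show "norm (?L w * cmod (F w)) \<le> norm ((1 + ?L w)\<^sup>2 * cmod (F w))"
        using mult_right_mono[OF sq(2)[of w] norm_ge_zero[of "F w"]] norm1_nonneg[of d w] by (simp add: abs_mult)
    qed
  qed simp
  have iF2: "integrable (lborel_pow d) (\<lambda>w. (?L w)\<^sup>2 * cmod (F w))"
  proof (rule Bochner_Integration.integrable_bound[OF iV])
    show "AE w in lborel_pow d. norm ((?L w)\<^sup>2 * cmod (F w)) \<le> norm ((1 + ?L w)\<^sup>2 * cmod (F w))"
    proof (rule AE_I2)
      fix w show "norm ((?L w)\<^sup>2 * cmod (F w)) \<le> norm ((1 + ?L w)\<^sup>2 * cmod (F w))"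
        using mult_right_mono[OF sq(3)[of w] norm_ge_zero[of "F w"]] norm1_nonneg[of d w] by (simp add: abs_mult)
    qed
  qed simp
  have iF: "integrable (lborel_pow d) F" using iF0 by (simp add: integrable_norm_iff)
  have wi: "\<bar>w i\<bar> \<le> ?L w" if "i < d" for w i
    unfolding norm1_def using that by (intro member_le_sum) auto
  have iI: "integrable (lborel_pow d) (\<lambda>w. Im (F w) * w i)" if i: "i < d" for i
  proof (rule Bochner_Integration.integrable_bound[OF iF1])
    show "(\<lambda>w. Im (F w) * w i) \<in> borel_measurable (lborel_pow d)" using i by simp
    show "AE w in lborel_pow d. norm (Im (F w) * w i) \<le> norm (?L w * cmod (F w))"
      using wi[OF i] abs_Im_le_cmod norm1_nonneg
      by (intro AE_I2) (auto simp: abs_mult mult.commute[of "\<bar>Im _\<bar>"] intro!: mult_mono)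
  qed
  \<comment> \<open>\<open>a + dot d v x\<close> is the first-order Taylor polynomial at the origin
    of the plane waves, integrated over the frequencies.\<close>
  define a where "a = (LINT w|lborel_pow d. Re (F w))"
  define v where "v = (\<lambda>i\<in>{..<d}. - (LINT w|lborel_pow d. Im (F w) * w i))"
  have v: "v \<in> Rn d" by (simp add: v_def Rn_def)
  obtain c q where cq: "\<forall>k<4. valid_unit d (q k)" "(\<Sum>k<4::nat. \<bar>c k\<bar>) = 4 * \<bar>a\<bar> + 2 * norm1 d v"
     "\<forall>x\<in>unit_cube d. a + dot d v x = (\<Sum>k<4::nat. c k * unit_jet d 0 (q k) x)"
    using affine_four_units[OF d v, of a] by (elim exE conjE)
  have aB: "\<bar>a\<bar> \<le> (LINT w|lborel_pow d. cmod (F w))"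
    unfolding a_def using iF iF0 abs_Re_le_cmod
    by (intro order_trans[OF integral_abs_bound] integral_mono integrable_abs integrable_Re) auto
  have vB: "norm1 d v \<le> (LINT w|lborel_pow d. ?L w * cmod (F w))"
  proof -
    have "norm1 d v = (\<Sum>i<d. \<bar>LINT w|lborel_pow d. Im (F w) * w i\<bar>)"
      unfolding norm1_def by (intro sum.cong) (auto simp: v_def)
    also have "\<dots> \<le> (\<Sum>i<d. LINT w|lborel_pow d. \<bar>Im (F w) * w i\<bar>)"
      by (intro sum_mono integral_abs_bound)
    also have "\<dots> = (LINT w|lborel_pow d. (\<Sum>i<d. \<bar>Im (F w) * w i\<bar>))"
      using iI by (intro Bochner_Integration.integral_sum[symmetric]) auto
    also have "\<dots> \<le> (LINT w|lborel_pow d. ?L w * cmod (F w))"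
    proof (rule integral_mono[OF _ iF1])
      show "integrable (lborel_pow d) (\<lambda>w. \<Sum>i<d. \<bar>Im (F w) * w i\<bar>)"
        using iI by (intro Bochner_Integration.integrable_sum integrable_abs) auto
      fix w
      have "(\<Sum>i<d. \<bar>Im (F w) * w i\<bar>) = \<bar>Im (F w)\<bar> * ?L w" by (simp add: abs_mult norm1_def sum_distrib_left)
      also have "\<dots> \<le> cmod (F w) * ?L w" using norm1_nonneg abs_Im_le_cmod by (intro mult_right_mono) auto
      finally show "(\<Sum>i<d. \<bar>Im (F w) * w i\<bar>) \<le> ?L w * cmod (F w)" by (simp add: mult.commute)
    qed
    finally show ?thesis .
  qed
  let ?T = "lborel_pow d \<Otimes>\<^sub>M (lborel :: real measure)"
  \<comment> \<open>The signed density of the remainder: the second derivative, at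
    \<open>snd \<theta>\<close>, of the wave of frequency \<open>fst \<theta>\<close> along the
    normalized direction. Its modulus becomes the density of \<nu> and its sign becomes
    \<open>sg\<close>.\<close>
  define \<rho> where "\<rho> \<theta> = indicator {-1..1} (snd \<theta>) * (- ((?L (fst \<theta>))\<^sup>2 * Re (F (fst \<theta>) * iexp (?L (fst \<theta>) * snd \<theta>))))" for \<theta> :: "point \<times> real"
  have \<rho>m[measurable]: "\<rho> \<in> borel_measurable ?T" unfolding \<rho>_def by measurable
  have \<rho>B: "\<bar>\<rho> (w, s)\<bar> \<le> ((?L w)\<^sup>2 * cmod (F w)) * indicator {-1..1} s" for w s
  proof -
    have "\<bar>Re (F w * iexp (?L w * s))\<bar> \<le> cmod (F w)"
      using abs_Re_le_cmod[of "F w * iexp (?L w * s)"] by (simp add: norm_mult)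
    then show ?thesis by (auto simp: \<rho>_def abs_mult indicator_def intro!: mult_left_mono)
  qed
  have i1: "integrable lborel (indicator {-1..1} :: real \<Rightarrow> real)" by (rule integrable_real_indicator) auto
  have i\<rho>: "integrable ?T \<rho>"
    by (rule LB.integrable_dominated_by_product[OF \<rho>m iF2 i1]) (use \<rho>B in simp)
  define \<nu> where "\<nu> = density ?T (\<lambda>\<theta>. ennreal \<bar>\<rho> \<theta>\<bar>)"
  have \<nu>s[measurable_cong]: "sets \<nu> = sets ?T" by (simp add: \<nu>_def)
  have e\<nu>: "emeasure \<nu> (space \<nu>) = ennreal (LINT \<theta>|?T. \<bar>\<rho> \<theta>\<bar>)"
  proof -
    have "emeasure \<nu> (space \<nu>) = emeasure \<nu> (space ?T)" by (simp add: \<nu>_def)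
    also have "\<dots> = (\<integral>\<^sup>+\<theta>. ennreal \<bar>\<rho> \<theta>\<bar> \<partial>?T)"
      unfolding \<nu>_def by (subst emeasure_density[OF _ sets.top]) (auto intro!: nn_integral_cong)
    also have "\<dots> = ennreal (LINT \<theta>|?T. \<bar>\<rho> \<theta>\<bar>)"
      using i\<rho> by (intro nn_integral_eq_integral) auto
    finally show ?thesis .
  qed
  have fin: "finite_measure \<nu>" by (rule finite_measureI) (simp add: e\<nu>)
  have mass: "measure \<nu> (space \<nu>) \<le> 2 * (LINT w|lborel_pow d. (?L w)\<^sup>2 * cmod (F w))"
  proof -
    have "measure \<nu> (space \<nu>) = (LINT \<theta>|?T. \<bar>\<rho> \<theta>\<bar>)" using e\<nu> by (simp add: measure_def)
    also have "\<dots> = (LINT w|lborel_pow d. LINT s|lborel. \<bar>\<rho> (w, s)\<bar>)"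
      using LB.integral_fst'[of "\<lambda>\<theta>. \<bar>\<rho> \<theta>\<bar>"] i\<rho> by simp
    also have "\<dots> \<le> (LINT w|lborel_pow d. 2 * ((?L w)\<^sup>2 * cmod (F w)))"
    proof (rule integral_mono_AE)
      show "integrable (lborel_pow d) (\<lambda>w. LINT s|lborel. \<bar>\<rho> (w, s)\<bar>)"
        using LB.integrable_fst'[of "\<lambda>\<theta>. \<bar>\<rho> \<theta>\<bar>"] i\<rho> by simp
      show "integrable (lborel_pow d) (\<lambda>w. 2 * ((?L w)\<^sup>2 * cmod (F w)))" using iF2 by simp
      have "AE w in lborel_pow d. integrable lborel (\<lambda>s. \<rho> (w, s))" by (rule LB.AE_integrable_fst'[OF i\<rho>])
      then show "AE w in lborel_pow d. (LINT s|lborel. \<bar>\<rho> (w, s)\<bar>) \<le> 2 * ((?L w)\<^sup>2 * cmod (F w))"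
      proof eventually_elim
        fix w assume i: "integrable lborel (\<lambda>s. \<rho> (w, s))"
        have "(LINT s|lborel. \<bar>\<rho> (w, s)\<bar>) \<le> (LINT s|lborel. ((?L w)\<^sup>2 * cmod (F w)) * indicator {-1..1::real} s)"
        proof (rule integral_mono)
          show "integrable lborel (\<lambda>s. \<bar>\<rho> (w, s)\<bar>)" using i by simp
          show "integrable lborel (\<lambda>s. ((?L w)\<^sup>2 * cmod (F w)) * indicator {-1..1::real} s)" using i1 by simp
        qed (rule \<rho>B)
        then show "(LINT s|lborel. \<bar>\<rho> (w, s)\<bar>) \<le> 2 * ((?L w)\<^sup>2 * cmod (F w))" by simp
      qed
    qed
    finally show ?thesis using iF2 by simp
  qed
  have total: "(\<Sum>k<4::nat. \<bar>c k\<bar>) + measure \<nu> (space \<nu>) \<le> 4 * V"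
  proof -
    have "(\<Sum>k<4::nat. \<bar>c k\<bar>) + measure \<nu> (space \<nu>)
       \<le> 4 * (LINT w|lborel_pow d. cmod (F w)) + 2 * (LINT w|lborel_pow d. ?L w * cmod (F w)) + 2 * (LINT w|lborel_pow d. (?L w)\<^sup>2 * cmod (F w))"
      unfolding cq(2) using aB vB mass by linarith
    also have "\<dots> = (LINT w|lborel_pow d. 4 * cmod (F w) + 2 * (?L w * cmod (F w)) + 2 * ((?L w)\<^sup>2 * cmod (F w)))"
      using iF0 iF1 iF2 by simp
    also have "\<dots> \<le> (LINT w|lborel_pow d. 4 * ((1 + ?L w)\<^sup>2 * cmod (F w)))"
    proof (rule integral_mono)
      fix w
      show "4 * cmod (F w) + 2 * (?L w * cmod (F w)) + 2 * ((?L w)\<^sup>2 * cmod (F w)) \<le> 4 * ((1 + ?L w)\<^sup>2 * cmod (F w))"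
        using mult_right_mono[OF sq(4)[of w] norm_ge_zero[of "F w"]] by (simp add: algebra_simps)
    qed (use iF0 iF1 iF2 iV in auto)
    also have "\<dots> = 4 * V" by (simp add: V_def)
    finally show ?thesis .
  qed
  define sg where "sg \<theta> = sgn (\<rho> \<theta>)" for \<theta>
  have pm: "unit_param d \<in> measurable \<nu> (lborel_pow d \<Otimes>\<^sub>M borel)"
    using unit_param_measurable[of d] by measurable
  have rep: "Re (LINT w|lborel_pow d. F w * exp (\<i> * complex_of_real (dot d w x)))
        = a + dot d v x + (LINT \<theta>|\<nu>. sg \<theta> * unit_jet d 0 (unit_param d \<theta>) x)" if x: "x \<in> unit_cube d" for x
  proof -
    have xs: "x \<in> space (lborel_pow d)" using x unit_cube_subset_Rn by auto
    have Um[measurable]: "(\<lambda>\<theta>. unit_jet d 0 (unit_param d \<theta>) x) \<in> borel_measurable ?T"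
    proof -
      have "(\<lambda>q. unit_jet d 0 q x) \<in> borel_measurable (lborel_pow d \<Otimes>\<^sub>M borel)"
        using measurable_compose[OF measurable_Pair2'[OF xs] unit_jet_measurable[of 0 d]] by simp
      from measurable_compose[OF unit_param_measurable this] show ?thesis by simp
    qed
    have UB: "\<bar>unit_jet d 0 (unit_param d \<theta>) x\<bar> \<le> 2" for \<theta>
      using valid_unit_bound[OF unit_param_valid[OF d], of 0] by simp
    have i\<rho>U: "integrable ?T (\<lambda>\<theta>. \<rho> \<theta> * unit_jet d 0 (unit_param d \<theta>) x)"
    proof (rule Bochner_Integration.integrable_bound)
      show "integrable ?T (\<lambda>\<theta>. 2 * \<rho> \<theta>)" using i\<rho> by simp
      show "AE \<theta> in ?T. norm (\<rho> \<theta> * unit_jet d 0 (unit_param d \<theta>) x) \<le> norm (2 * \<rho> \<theta>)"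
        using UB by (intro AE_I2) (auto simp: abs_mult mult.commute[of 2] intro!: mult_left_mono)
    qed measurable
    have "(LINT \<theta>|\<nu>. sg \<theta> * unit_jet d 0 (unit_param d \<theta>) x) = (LINT \<theta>|?T. \<rho> \<theta> * unit_jet d 0 (unit_param d \<theta>) x)"
    proof -
      have "(LINT \<theta>|\<nu>. sg \<theta> * unit_jet d 0 (unit_param d \<theta>) x) = (LINT \<theta>|?T. \<bar>\<rho> \<theta>\<bar> *\<^sub>R (sg \<theta> * unit_jet d 0 (unit_param d \<theta>) x))"
        unfolding \<nu>_def sg_def by (rule integral_density) auto
      also have "\<dots> = (LINT \<theta>|?T. \<rho> \<theta> * unit_jet d 0 (unit_param d \<theta>) x)"
        by (intro Bochner_Integration.integral_cong refl) (simp add: sg_def abs_mult_sgn mult.assoc[symmetric])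
      finally show ?thesis .
    qed
    also have "\<dots> = (LINT w|lborel_pow d. LINT s|lborel. \<rho> (w, s) * unit_jet d 0 (unit_param d (w, s)) x)"
      using LB.integral_fst'[OF i\<rho>U] by simp
    finally have mix: "(LINT \<theta>|\<nu>. sg \<theta> * unit_jet d 0 (unit_param d \<theta>) x) = \<dots>" .
    \<comment> \<open>Taylor's formula is applied at \<open>dot d w x / norm1 d w\<close>, which has
      modulus at most 1 on the cube; the zero frequency carries no remainder.\<close>
    have pt: "Re (F w * exp (\<i> * complex_of_real (dot d w x)))
       = Re (F w) - Im (F w) * dot d w x + (LINT s|lborel. \<rho> (w, s) * unit_jet d 0 (unit_param d (w, s)) x)" for w
    proof (cases "?L w = 0")
      case True
      then have "\<forall>i<d. w i = 0" by (simp add: norm1_def sum_nonneg_eq_0_iff)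
      then show ?thesis using True by (simp add: dot_def \<rho>_def)
    next
      case False
      then have Lp: "?L w > 0" using norm1_nonneg[of d w] by simp
      define z where "z = dot d w x / ?L w"
      have z: "\<bar>z\<bar> \<le> 1" using abs_dot_le[OF x, of w] Lp by (simp add: z_def)
      have Lz: "?L w * z = dot d w x" using Lp by (simp add: z_def)
      have "\<rho> (w, s) * unit_jet d 0 (unit_param d (w, s)) x
         = indicator {-1..1} s * (- ((?L w)\<^sup>2 * Re (F w * iexp (?L w * s)))) * relu ((if s < 0 then - 1 else 1) * z - \<bar>s\<bar>)" for s
        using False by (auto simp: \<rho>_def unit_param_def unit_jet_0[OF x] dot_direction z_def indicator_def min_def)
      then have "(LINT s|lborel. \<rho> (w, s) * unit_jet d 0 (unit_param d (w, s)) x)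
         = (LINT s|lborel. indicator {-1..1} s * (- ((?L w)\<^sup>2 * Re (F w * iexp (?L w * s)))) * relu ((if s < 0 then - 1 else 1) * z - \<bar>s\<bar>))"
        by (simp only:)
      with Re_iexp_relu[OF z, of "F w" "?L w"] show ?thesis
        by (simp only: Lz mult.assoc of_real_mult[symmetric])
    qed
    have iE: "integrable (lborel_pow d) (\<lambda>w. F w * exp (\<i> * complex_of_real (dot d w x)))"
    proof (rule Bochner_Integration.integrable_bound[OF iF])
      have [measurable]: "(\<lambda>w. dot d w x) \<in> borel_measurable (lborel_pow d)" unfolding dot_def by measurable
      show "(\<lambda>w. F w * exp (\<i> * complex_of_real (dot d w x))) \<in> borel_measurable (lborel_pow d)" by measurable
    qed (simp add: norm_mult)
    have iM: "integrable (lborel_pow d) (\<lambda>w. LINT s|lborel. \<rho> (w, s) * unit_jet d 0 (unit_param d (w, s)) x)"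
      using LB.integrable_fst'[OF i\<rho>U] by simp
    have iD: "integrable (lborel_pow d) (\<lambda>w. Im (F w) * dot d w x)"
      unfolding dot_def sum_distrib_left mult.assoc[symmetric]
      using iI by (intro Bochner_Integration.integrable_sum integrable_mult_left) auto
    have eD: "(LINT w|lborel_pow d. Im (F w) * dot d w x) = - dot d v x"
    proof -
      have "(LINT w|lborel_pow d. Im (F w) * dot d w x) = (\<Sum>i<d. (LINT w|lborel_pow d. Im (F w) * w i) * x i)"
        unfolding dot_def sum_distrib_left mult.assoc[symmetric]
        using iI by (subst Bochner_Integration.integral_sum) (auto intro!: integrable_mult_left)
      also have "\<dots> = - dot d v x" by (simp add: dot_def v_def sum_negf)
      finally show ?thesis .
    qed
    have "Re (LINT w|lborel_pow d. F w * exp (\<i> * complex_of_real (dot d w x)))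
       = (LINT w|lborel_pow d. Re (F w * exp (\<i> * complex_of_real (dot d w x))))"
      by (rule integral_Re[OF iE, symmetric])
    also have "\<dots> = a - (LINT w|lborel_pow d. Im (F w) * dot d w x) + (LINT w|lborel_pow d. LINT s|lborel. \<rho> (w, s) * unit_jet d 0 (unit_param d (w, s)) x)"
      unfolding pt a_def using iF iD iM by (simp add: integrable_Re)
    finally show ?thesis unfolding eD mix by simp
  qed
  have rep': "AE x in lborel_pow d. x \<in> unit_cube d \<longrightarrow> Re (LINT w|lborel_pow d. F w * exp (\<i> * complex_of_real (dot d w x)))
        = (\<Sum>k<4::nat. c k * unit_jet d 0 (q k) x) + (LINT \<theta>|\<nu>. sg \<theta> * unit_jet d 0 (unit_param d \<theta>) x)"
    using rep cq(3) by simp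
  have sgm: "sg \<in> borel_measurable \<nu>" unfolding sg_def by measurable
  have vp: "\<forall>\<theta>. valid_unit d (unit_param d \<theta>) \<and> snd (unit_param d \<theta>) \<le> 0"
    using unit_param_valid[OF d] by (simp add: unit_param_def)
  have sg1: "\<forall>\<theta>. sg \<theta> \<in> {-1, 0, 1}" by (auto simp: sg_def sgn_if)
  show ?thesis
    unfolding relu_mixture_def
    by (intro exI[of _ c] exI[of _ q] exI[of _ \<nu>] exI[of _ sg] exI[of _ "unit_param d"] conjI fin sgm sg1 pm vp cq(1) total rep')
qed

section \<open>The rate of approximation\<close>

lemma gradient_sum_le:
  assumes "valid_unit d q"
  shows "(\<Sum>i<d. \<bar>unit_jet d (Suc i) q x\<bar>) \<le> 1"
proof -
  have "(\<Sum>i<d. \<bar>unit_jet d (Suc i) q x\<bar>) \<le> (\<Sum>i<d. \<bar>fst q i\<bar>)"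
    by (intro sum_mono) (auto simp: unit_jet_def indicator_def)
  then show ?thesis using assms by (simp add: valid_unit_def norm1_def)
qed

lemma sum_squares_le_square_sum:
  fixes a :: "'i \<Rightarrow> real"
  assumes "finite I"
  shows "(\<Sum>i\<in>I. (a i)\<^sup>2) \<le> (\<Sum>i\<in>I. \<bar>a i\<bar>)\<^sup>2"
  using L2_set_le_sum_abs[of a I] by (simp add: L2_set_def sqrt_le_D sum_nonneg)

lemma integral_unif_cube_le:
  fixes g :: "point \<Rightarrow> real"
  assumes "\<And>x. x \<in> unit_cube d \<Longrightarrow> g x \<le> B" "0 \<le> B"
  shows "(LINT x|unif_cube d. g x) \<le> B"
proof (cases "integrable (unif_cube d) g")
  case True
  then show ?thesis
    using AE_unif_cube[of d] assms by (intro unif_cube.integral_le_const) (auto elim!: eventually_mono)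
qed (use assms in \<open>simp add: not_integrable_integral_eq\<close>)

text \<open>The gradient is controlled in the sum norm, which dominates the Euclidean one; a bound
  per component would bring in a factor \<open>d\<close>. The constant is 4 + 1.\<close>

lemma weak_jet_squares_le:
  assumes E: "weak_jet d E" and b0: "\<And>x. \<bar>E 0 x\<bar> \<le> 2 * W" and b1: "\<And>x. (\<Sum>i<d. \<bar>E (Suc i) x\<bar>) \<le> W" and W: "0 \<le> W"
  shows "(\<Sum>j\<in>{..d}. LINT x|unif_cube d. (E j x)\<^sup>2) \<le> 5 * W\<^sup>2"
proof -
  have Em: "E j \<in> borel_measurable (lborel_pow d)" if "j \<le> d" for j using E that by (simp add: weak_jet_def)
  obtain B where B: "\<forall>j\<le>d. \<forall>x. \<bar>E j x\<bar> \<le> B" using E by (auto simp: weak_jet_def)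
  have Ei: "integrable (unif_cube d) (\<lambda>x. (E j x)\<^sup>2)" if "j \<le> d" for j
    unfolding power2_eq_square using that B by (intro weak_jet_product_integrable[OF E that Em[OF that]]) auto
  have "(\<Sum>j\<in>{..d}. LINT x|unif_cube d. (E j x)\<^sup>2) = (LINT x|unif_cube d. (\<Sum>j\<in>{..d}. (E j x)\<^sup>2))"
    using Ei by (intro Bochner_Integration.integral_sum[symmetric]) auto
  also have "\<dots> \<le> 5 * W\<^sup>2"
  proof (rule integral_unif_cube_le)
    fix x
    have "(\<Sum>j\<in>{..d}. (E j x)\<^sup>2) = (E 0 x)\<^sup>2 + (\<Sum>i<d. (E (Suc i) x)\<^sup>2)" by (rule sum.atMost_shift)
    also have "\<dots> \<le> (2 * W)\<^sup>2 + W\<^sup>2"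
    proof (rule add_mono)
      show "(E 0 x)\<^sup>2 \<le> (2 * W)\<^sup>2" using power_mono[OF b0[of x], of 2] by simp
      have "(\<Sum>i<d. (E (Suc i) x)\<^sup>2) \<le> (\<Sum>i<d. \<bar>E (Suc i) x\<bar>)\<^sup>2" by (rule sum_squares_le_square_sum) simp
      also have "\<dots> \<le> W\<^sup>2" using b1[of x] by (intro power_mono sum_nonneg) auto
      finally show "(\<Sum>i<d. (E (Suc i) x)\<^sup>2) \<le> W\<^sup>2" .
    qed
    finally show "(\<Sum>j\<in>{..d}. (E j x)\<^sup>2) \<le> 5 * W\<^sup>2" by (simp add: power_mult_distrib)
  qed (use W in simp)
  finally show ?thesis .
qed

lemma valid_unit_weak_jet: "valid_unit d q \<Longrightarrow> weak_jet d (\<lambda>j. unit_jet d j q)"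
  using weak_jet_unit[of d "fst q" "snd q"] by (auto simp: valid_unit_def)

lemma signed_unit_dist:
  assumes d: "d \<ge> 1" and q: "valid_unit d q" "valid_unit d q'" and s: "s \<in> {-1, 0, 1::real}"
  shows "(\<Sum>j\<in>{..d}. LINT x|unif_cube d. (s * unit_jet d j q x - s * unit_jet d j q' x)\<^sup>2) \<le> 20"
    and "0 < \<delta> \<Longrightarrow> \<delta> \<le> 1 \<Longrightarrow> cell_key d \<delta> q = cell_key d \<delta> q' \<Longrightarrow>
      (\<Sum>j\<in>{..d}. LINT x|unif_cube d. (s * unit_jet d j q x - s * unit_jet d j q' x)\<^sup>2) \<le> 60 * \<delta> powr (2/3)"
proof -
  have sd: "(s * a - s * b)\<^sup>2 = s\<^sup>2 * (a - b)\<^sup>2" for a b by (simp add: power_mult_distrib[symmetric] right_diff_distrib)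
  have s2: "0 \<le> s\<^sup>2" "s\<^sup>2 \<le> 1" using s by auto
  have wj: "weak_jet d (\<lambda>j x. unit_jet d j q x + - 1 * unit_jet d j q' x)"
    by (intro weak_jet_add weak_jet_cmult valid_unit_weak_jet q)
  have 20: "(\<Sum>j\<in>{..d}. LINT x|unif_cube d. (unit_jet d j q x + - 1 * unit_jet d j q' x)\<^sup>2) \<le> 5 * 2\<^sup>2"
  proof (rule weak_jet_squares_le[OF wj])
    fix x
    show "\<bar>unit_jet d 0 q x + - 1 * unit_jet d 0 q' x\<bar> \<le> 2 * 2"
      using valid_unit_bound[OF q(1), of 0 x] valid_unit_bound[OF q(2), of 0 x] by simp
    have "(\<Sum>i<d. \<bar>unit_jet d (Suc i) q x + - 1 * unit_jet d (Suc i) q' x\<bar>) \<le> (\<Sum>i<d. \<bar>unit_jet d (Suc i) q x\<bar> + \<bar>unit_jet d (Suc i) q' x\<bar>)"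
      by (intro sum_mono) linarith
    then show "(\<Sum>i<d. \<bar>unit_jet d (Suc i) q x + - 1 * unit_jet d (Suc i) q' x\<bar>) \<le> 2"
      using gradient_sum_le[OF q(1), of x] gradient_sum_le[OF q(2), of x] by (simp add: sum.distrib)
  qed simp
  have nn: "0 \<le> (\<Sum>j\<in>{..d}. LINT x|unif_cube d. (unit_jet d j q x - unit_jet d j q' x)\<^sup>2)"
    by (intro sum_nonneg) simp
  have sc: "(\<Sum>j\<in>{..d}. LINT x|unif_cube d. (s * unit_jet d j q x - s * unit_jet d j q' x)\<^sup>2)
     \<le> (\<Sum>j\<in>{..d}. LINT x|unif_cube d. (unit_jet d j q x - unit_jet d j q' x)\<^sup>2)"
    unfolding sd using mult_right_mono[OF s2(2) nn] by (simp add: sum_distrib_left)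
  then show "(\<Sum>j\<in>{..d}. LINT x|unif_cube d. (s * unit_jet d j q x - s * unit_jet d j q' x)\<^sup>2) \<le> 20"
    using 20 by simp
  assume \<delta>: "0 < \<delta>" "\<delta> \<le> 1" and key: "cell_key d \<delta> q = cell_key d \<delta> q'"
  obtain w t w' t' where qq: "q = (w, t)" "q' = (w', t')" by (cases q, cases q') auto
  have n: "norm1 d w = 1" "norm1 d w' = 1" using q by (auto simp: valid_unit_def qq)
  have "(\<Sum>j\<in>{..d}. LINT x|unif_cube d. (unit_jet d j (w, t) x - unit_jet d j (w', t') x)\<^sup>2) \<le> 60 * \<delta> powr (2/3)"
    using cell_key_close[OF \<delta>(1) d n key[unfolded qq]] by (intro unit_jet_dist d \<delta> n) auto
  with sc show "(\<Sum>j\<in>{..d}. LINT x|unif_cube d. (s * unit_jet d j q x - s * unit_jet d j q' x)\<^sup>2) \<le> 60 * \<delta> powr (2/3)"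
    unfolding qq by linarith
qed

text \<open>The sign of the density joins the cell key, so signed units of one cell differ no more
  than unsigned ones; the three signs account for 144 = 3 * 48. For \<open>\<delta> > 1\<close>,
  which occurs when \<open>d\<close> is large compared with \<open>ln m\<close>, one cell is enough,
  since any two signed units have squared distance at most 20.\<close>

lemma cells_exist:
  assumes d: "d \<ge> 1" and \<delta>: "0 < \<delta>"
    and sg[measurable]: "sg \<in> borel_measurable \<nu>" and sg1: "\<And>\<theta>. sg \<theta> \<in> {-1, 0, 1::real}"
    and p: "p \<in> measurable \<nu> (lborel_pow d \<Otimes>\<^sub>M borel)" and v: "\<And>\<theta>. valid_unit d (p \<theta>) \<and> snd (p \<theta>) \<le> 0"
  shows "\<exists>(C :: (real \<times> nat set \<times> nat set \<times> int) set) A. finite C \<and> real (card C) \<le> max 1 ((144 / \<delta>) ^ d) \<and>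
     (\<forall>c\<in>C. A c \<in> sets \<nu>) \<and> disjoint_family_on A C \<and> (\<Union>c\<in>C. A c) = space \<nu> \<and>
     (\<forall>c\<in>C. \<forall>\<theta>\<in>A c. \<forall>\<theta>'\<in>A c. (\<Sum>j\<in>{..d}. LINT x|unif_cube d. (sg \<theta> * unit_jet d j (p \<theta>) x - sg \<theta>' * unit_jet d j (p \<theta>') x)\<^sup>2)
        \<le> 60 * \<delta> powr (2/3))"
proof (cases "\<delta> \<le> 1")
  case True
  obtain G where G: "finite G" "real (card G) \<le> (48 / \<delta>) ^ d"
     "\<forall>w t. norm1 d w = 1 \<longrightarrow> - 1 \<le> t \<longrightarrow> t \<le> 0 \<longrightarrow> cell_key d \<delta> (w, t) \<in> G"
    using cell_keys_finite[OF d \<delta> True] by (elim exE conjE)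
  define C where "C = {-1, 0, 1::real} \<times> G"
  define A where "A c = {\<theta>\<in>space \<nu>. sg \<theta> = fst c \<and> cell_key d \<delta> (p \<theta>) = snd c}" for c
  have "real (card C) = 3 * real (card G)" by (simp add: C_def card_cartesian_product)
  also have "\<dots> \<le> 3 ^ d * (48 / \<delta>) ^ d"
    using G(2) d self_le_power[of "3::real" d] \<delta> by (intro mult_mono) auto
  also have "\<dots> = (144 / \<delta>) ^ d" by (simp flip: power_mult_distrib)
  finally have cC: "real (card C) \<le> max 1 ((144 / \<delta>) ^ d)" by simp
  have Am: "A c \<in> sets \<nu>" for c
  proof -
    have "{\<theta>\<in>space \<nu>. cell_key d \<delta> (p \<theta>) = snd c} = p -` {q\<in>space (lborel_pow d \<Otimes>\<^sub>M borel). cell_key d \<delta> q = snd c} \<inter> space \<nu>"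
      using measurable_space[OF p] by auto
    also have "\<dots> \<in> sets \<nu>" by (rule measurable_sets[OF p cell_measurable])
    finally have "{\<theta>\<in>space \<nu>. cell_key d \<delta> (p \<theta>) = snd c} \<in> sets \<nu>" .
    moreover have "{\<theta>\<in>space \<nu>. sg \<theta> = fst c} \<in> sets \<nu>" by measurable
    moreover have "A c = {\<theta>\<in>space \<nu>. sg \<theta> = fst c} \<inter> {\<theta>\<in>space \<nu>. cell_key d \<delta> (p \<theta>) = snd c}" by (auto simp: A_def)
    ultimately show ?thesis by auto
  qed
  have cov: "(\<Union>c\<in>C. A c) = space \<nu>"
  proof (intro equalityI subsetI)
    fix \<theta> assume \<theta>: "\<theta> \<in> space \<nu>"
    have "cell_key d \<delta> (p \<theta>) \<in> G"
      using G(3) v[of \<theta>] by (cases "p \<theta>") (auto simp: valid_unit_def)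
    then have "(sg \<theta>, cell_key d \<delta> (p \<theta>)) \<in> C" unfolding C_def using sg1[of \<theta>] by auto
    moreover have "\<theta> \<in> A (sg \<theta>, cell_key d \<delta> (p \<theta>))" using \<theta> by (simp add: A_def)
    ultimately show "\<theta> \<in> (\<Union>c\<in>C. A c)" by blast
  qed (auto simp: A_def)
  show ?thesis
  proof (intro exI[of _ C] exI[of _ A] conjI ballI)
    show "disjoint_family_on A C" by (auto simp: disjoint_family_on_def A_def prod_eq_iff)
    fix c \<theta> \<theta>' assume "\<theta> \<in> A c" "\<theta>' \<in> A c"
    then have "sg \<theta>' = sg \<theta>" "cell_key d \<delta> (p \<theta>) = cell_key d \<delta> (p \<theta>')" by (auto simp: A_def)
    then show "(\<Sum>j\<in>{..d}. LINT x|unif_cube d. (sg \<theta> * unit_jet d j (p \<theta>) x - sg \<theta>' * unit_jet d j (p \<theta>') x)\<^sup>2) \<le> 60 * \<delta> powr (2/3)"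
      using signed_unit_dist(2)[OF d _ _ sg1 \<delta> True, of "p \<theta>" "p \<theta>'" \<theta>] v by simp
  qed (use G(1) cC Am cov in \<open>auto simp: C_def\<close>)
next
  case False
  have "1 \<le> \<delta> powr (2/3)" using False by (intro ge_one_powr_ge_zero) auto
  then have 60: "20 \<le> 60 * \<delta> powr (2/3)" by simp
  have sq2: "(a - b)\<^sup>2 \<le> 2 * a\<^sup>2 + 2 * b\<^sup>2" for a b :: real
    using sum_squares_bound[of a "- b"] by (simp add: power2_diff)
  have wj: "weak_jet d (\<lambda>j x. sg \<theta> * unit_jet d j (p \<theta>) x + - sg \<theta>' * unit_jet d j (p \<theta>') x)" for \<theta> \<theta>'
    using v by (intro weak_jet_add weak_jet_cmult valid_unit_weak_jet) auto
  have sga: "\<bar>sg \<theta>\<bar> \<le> 1" for \<theta> using sg1[of \<theta>] by auto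
  have B: "(\<Sum>j\<in>{..d}. LINT x|unif_cube d. (sg \<theta> * unit_jet d j (p \<theta>) x + - sg \<theta>' * unit_jet d j (p \<theta>') x)\<^sup>2) \<le> 5 * 2\<^sup>2" for \<theta> \<theta>'
  proof (rule weak_jet_squares_le[OF wj])
    fix x
    have le: "\<bar>sg \<theta> * y\<bar> \<le> \<bar>y\<bar>" for \<theta> y using mult_right_mono[OF sga[of \<theta>], of "\<bar>y\<bar>"] by (simp add: abs_mult)
    have tri: "\<bar>sg \<theta> * y + - sg \<theta>' * y'\<bar> \<le> \<bar>y\<bar> + \<bar>y'\<bar>" for y y'
      using le[of \<theta> y] le[of \<theta>' y'] by (simp add: abs_le_iff)
    show "\<bar>sg \<theta> * unit_jet d 0 (p \<theta>) x + - sg \<theta>' * unit_jet d 0 (p \<theta>') x\<bar> \<le> 2 * 2"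
      using tri[of "unit_jet d 0 (p \<theta>) x" "unit_jet d 0 (p \<theta>') x"] valid_unit_bound[of d "p \<theta>" 0 x] valid_unit_bound[of d "p \<theta>'" 0 x] v
      by (smt (verit) le0)
    have "(\<Sum>i<d. \<bar>sg \<theta> * unit_jet d (Suc i) (p \<theta>) x + - sg \<theta>' * unit_jet d (Suc i) (p \<theta>') x\<bar>) \<le> (\<Sum>i<d. \<bar>unit_jet d (Suc i) (p \<theta>) x\<bar> + \<bar>unit_jet d (Suc i) (p \<theta>') x\<bar>)"
      by (intro sum_mono tri)
    then show "(\<Sum>i<d. \<bar>sg \<theta> * unit_jet d (Suc i) (p \<theta>) x + - sg \<theta>' * unit_jet d (Suc i) (p \<theta>') x\<bar>) \<le> 2"
      using gradient_sum_le[of d "p \<theta>" x] gradient_sum_le[of d "p \<theta>'" x] v by (simp add: sum.distrib)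
  qed simp
  have "(\<Sum>j\<in>{..d}. LINT x|unif_cube d. (sg \<theta> * unit_jet d j (p \<theta>) x - sg \<theta>' * unit_jet d j (p \<theta>') x)\<^sup>2) \<le> 60 * \<delta> powr (2/3)" for \<theta> \<theta>'
    using B[of \<theta> \<theta>'] 60 by simp
  then show ?thesis
    by (intro exI[of _ "{(0, {}, {}, 0)}"] exI[of _ "\<lambda>_. space \<nu>"]) (auto simp: disjoint_family_on_def)
qed

text \<open>The strict inequality is what makes an extension with weighted integral below
  \<open>V\<close> available. That extension is measurable only for the completed measure, so an
  almost everywhere equal Borel function replaces it before Fubini is used; its transform is the
  same.\<close>

lemma barron_relu_representation:
  fixes f :: "point \<Rightarrow> real"
  assumes d: "d \<ge> 1" and V: "barron_norm d 2 (unit_cube d) (\<lambda>x. complex_of_real (f x)) < ennreal V"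
  shows "\<exists>c q (\<nu> :: (point \<times> real) measure) sg p. relu_mixture d (4 * V) f c q \<nu> sg p"
proof -
  interpret L: sigma_finite_measure "lborel_pow d" by (rule lbp.sigma_finite) simp
  obtain fe where fe: "fe \<in> L1_extensions d (unit_cube d) (\<lambda>x. complex_of_real (f x))"
     and feV: "(\<integral>\<^sup>+ w. ennreal ((1 + norm1 d w) powr 2 * cmod (fourier d fe w)) \<partial>leb d) < ennreal V"
    using V unfolding barron_norm_def INF_less_iff by blast
  have ife: "integrable (leb d) fe" and fef: "\<And>x. x \<in> unit_cube d \<Longrightarrow> fe x = complex_of_real (f x)"
    using fe by (auto simp: L1_extensions_def)
  have fem: "fe \<in> borel_measurable (completion (lborel_pow d))" using ife by (auto simp: leb_def)
  obtain gr where gr[measurable]: "gr \<in> borel_measurable (lborel_pow d)" "AE x in lborel_pow d. Re (fe x) = gr x"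
    using completion_ex_borel_measurable_real[of "\<lambda>x. Re (fe x)" "lborel_pow d"] fem by auto
  obtain gi where gi[measurable]: "gi \<in> borel_measurable (lborel_pow d)" "AE x in lborel_pow d. Im (fe x) = gi x"
    using completion_ex_borel_measurable_real[of "\<lambda>x. Im (fe x)" "lborel_pow d"] fem by auto
  define g where "g x = complex_of_real (gr x) + \<i> * complex_of_real (gi x)" for x
  have gm[measurable]: "g \<in> borel_measurable (lborel_pow d)" unfolding g_def by measurable
  have ae: "AE x in lborel_pow d. fe x = g x"
    using gr(2) gi(2) by eventually_elim (simp add: g_def complex_eq_iff)
  have aec: "AE x in leb d. fe x = g x" unfolding leb_def using ae by (rule AE_completion)
  have gc: "g \<in> borel_measurable (leb d)" unfolding leb_def by (rule measurable_completion[OF gm])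
  have "integrable (leb d) g"
    using ife integrable_cong_AE[OF borel_measurable_integrable[OF ife] gc aec] by simp
  then have ig: "integrable (lborel_pow d) g" unfolding leb_def using integrable_completion[OF gm] by simp
  define F where "F = fourier d fe"
  have F: "F w = (LINT x|lborel_pow d. g x * exp (- \<i> * complex_of_real (dot d w x))) / complex_of_real ((2 * pi) ^ d)" for w
  proof -
    have em[measurable]: "(\<lambda>x. exp (- \<i> * complex_of_real (dot d w x))) \<in> borel_measurable (lborel_pow d)"
      by measurable
    have emc: "(\<lambda>x. exp (- \<i> * complex_of_real (dot d w x))) \<in> borel_measurable (leb d)"
      unfolding leb_def by (rule measurable_completion[OF em])
    have "(LINT x|leb d. fe x * exp (- \<i> * complex_of_real (dot d w x))) = (LINT x|leb d. g x * exp (- \<i> * complex_of_real (dot d w x)))"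
    proof (rule integral_cong_AE)
      show "AE x in leb d. fe x * exp (- \<i> * complex_of_real (dot d w x)) = g x * exp (- \<i> * complex_of_real (dot d w x))"
        using aec by eventually_elim simp
    qed (intro borel_measurable_times emc gc borel_measurable_integrable[OF ife])+
    also have "\<dots> = (LINT x|lborel_pow d. g x * exp (- \<i> * complex_of_real (dot d w x)))"
      unfolding leb_def by (rule integral_completion) measurable
    finally show ?thesis by (simp add: F_def fourier_def)
  qed
  have Fm[measurable]: "F \<in> borel_measurable (lborel_pow d)"
  proof -
    have [measurable]: "(\<lambda>(w, x). dot d w x) \<in> borel_measurable (lborel_pow d \<Otimes>\<^sub>M lborel_pow d)"
      by measurable
    have "(\<lambda>w. LINT x|lborel_pow d. g x * exp (- \<i> * complex_of_real (dot d w x))) \<in> borel_measurable (lborel_pow d)"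
      by (rule L.borel_measurable_lebesgue_integral) measurable
    then have "(\<lambda>w. (LINT x|lborel_pow d. g x * exp (- \<i> * complex_of_real (dot d w x))) / complex_of_real ((2 * pi) ^ d)) \<in> borel_measurable (lborel_pow d)"
      by measurable
    then show ?thesis by (simp only: F[abs_def, symmetric])
  qed
  have p2: "(1 + norm1 d w) powr 2 = (1 + norm1 d w)\<^sup>2" for w
    using norm1_nonneg[of d w] by simp
  have nn: "(\<integral>\<^sup>+ w. ennreal ((1 + norm1 d w)\<^sup>2 * cmod (F w)) \<partial>lborel_pow d) < ennreal V"
    using feV unfolding leb_def nn_integral_completion F_def[symmetric] p2 .
  have iV: "integrable (lborel_pow d) (\<lambda>w. (1 + norm1 d w)\<^sup>2 * cmod (F w))"
  proof (rule integrableI_nonneg)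
    show "(\<integral>\<^sup>+ w. ennreal ((1 + norm1 d w)\<^sup>2 * cmod (F w)) \<partial>lborel_pow d) < \<infinity>"
      using nn by (rule order_less_trans) simp
  qed auto
  have VV: "(LINT w|lborel_pow d. (1 + norm1 d w)\<^sup>2 * cmod (F w)) \<le> V"
  proof -
    have "ennreal (LINT w|lborel_pow d. (1 + norm1 d w)\<^sup>2 * cmod (F w)) < ennreal V"
      using nn nn_integral_eq_integral[OF iV] by simp
    then show ?thesis by (simp add: ennreal_less_iff)
  qed
  have iF: "integrable (lborel_pow d) F"
  proof (rule Bochner_Integration.integrable_bound[OF iV Fm])
    show "AE w in lborel_pow d. norm (F w) \<le> norm ((1 + norm1 d w)\<^sup>2 * cmod (F w))"
    proof (rule AE_I2)
      fix w
      have "1 \<le> (1 + norm1 d w)\<^sup>2" using norm1_nonneg[of d w] by (simp add: power2_eq_square algebra_simps)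
      from mult_right_mono[OF this norm_ge_zero[of "F w"]]
      show "norm (F w) \<le> norm ((1 + norm1 d w)\<^sup>2 * cmod (F w))" by (simp add: abs_mult)
    qed
  qed
  have "AE x in lborel_pow d. x \<in> unit_cube d \<longrightarrow> Re (g x) = Re (LINT w|lborel_pow d. F w * exp (\<i> * complex_of_real (dot d w x)))"
    by (rule fourier_inversion[OF ig F iF])
  with ae have "AE x in lborel_pow d. x \<in> unit_cube d \<longrightarrow> f x = Re (LINT w|lborel_pow d. F w * exp (\<i> * complex_of_real (dot d w x)))"
    by eventually_elim (use fef in \<open>metis Re_complex_of_real\<close>)
  then show ?thesis
    using relu_representation[OF d Fm iV] relu_mixture_cong[OF _ mult_left_mono[OF VV zero_le_numeral]] by blast
qed

lemma signed_unit_measurable: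
  assumes sg[measurable]: "sg \<in> borel_measurable \<nu>" and p[measurable]: "p \<in> measurable \<nu> (lborel_pow d \<Otimes>\<^sub>M borel)" and j: "j \<le> d"
  shows "(\<lambda>(\<theta>, x). sg \<theta> * unit_jet d j (p \<theta>) x) \<in> borel_measurable (\<nu> \<Otimes>\<^sub>M lborel_pow d)"
proof -
  have "(\<lambda>z. (p (fst z), snd z)) \<in> measurable (\<nu> \<Otimes>\<^sub>M lborel_pow d) ((lborel_pow d \<Otimes>\<^sub>M borel) \<Otimes>\<^sub>M lborel_pow d)"
    by measurable
  from measurable_compose[OF this unit_jet_measurable[OF j]]
  have [measurable]: "(\<lambda>z. unit_jet d j (p (fst z)) (snd z)) \<in> borel_measurable (\<nu> \<Otimes>\<^sub>M lborel_pow d)" by simp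
  show ?thesis unfolding split_beta' by measurable
qed

lemma mixture_weak_jet:
  assumes "finite_measure \<nu>" "sg \<in> borel_measurable \<nu>" and sg1: "\<forall>\<theta>. sg \<theta> \<in> {-1, 0, 1::real}"
    and "p \<in> measurable \<nu> (lborel_pow d \<Otimes>\<^sub>M borel)" and v: "\<forall>\<theta>. valid_unit d (p \<theta>)"
  shows "weak_jet d (\<lambda>j x. LINT \<theta>|\<nu>. sg \<theta> * unit_jet d j (p \<theta>) x)"
    and "\<And>j x. j \<le> d \<Longrightarrow> \<bar>LINT \<theta>|\<nu>. sg \<theta> * unit_jet d j (p \<theta>) x\<bar> \<le> 2 * measure \<nu> (space \<nu>)"
    and "\<And>x. (\<Sum>i<d. \<bar>LINT \<theta>|\<nu>. sg \<theta> * unit_jet d (Suc i) (p \<theta>) x\<bar>) \<le> measure \<nu> (space \<nu>)"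
proof -
  interpret finite_measure \<nu> by fact
  have sga: "\<bar>sg \<theta> * y\<bar> \<le> \<bar>y\<bar>" for \<theta> y using sg1[rule_format, of \<theta>] by (auto simp: abs_mult)
  have b: "\<bar>sg \<theta> * unit_jet d j (p \<theta>) x\<bar> \<le> 2" if "j \<le> d" for j \<theta> x
    using order_trans[OF sga valid_unit_bound[OF v[rule_format] that]] .
  show "weak_jet d (\<lambda>j x. LINT \<theta>|\<nu>. sg \<theta> * unit_jet d j (p \<theta>) x)"
    by (rule weak_jet_integral[OF assms(1) signed_unit_measurable[OF assms(2,4)] b])
       (use v valid_unit_weak_jet weak_jet_cmult in auto)
  show "\<bar>LINT \<theta>|\<nu>. sg \<theta> * unit_jet d j (p \<theta>) x\<bar> \<le> 2 * measure \<nu> (space \<nu>)" if j: "j \<le> d" for j x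
  proof (cases "integrable \<nu> (\<lambda>\<theta>. sg \<theta> * unit_jet d j (p \<theta>) x)")
    case True
    have "\<bar>LINT \<theta>|\<nu>. sg \<theta> * unit_jet d j (p \<theta>) x\<bar> \<le> (LINT \<theta>|\<nu>. \<bar>sg \<theta> * unit_jet d j (p \<theta>) x\<bar>)" by (rule integral_abs_bound)
    also have "\<dots> \<le> (LINT \<theta>|\<nu>. 2)" using True b[OF j] by (intro integral_mono integrable_abs) auto
    finally show ?thesis by (simp add: mult.commute)
  qed (simp add: not_integrable_integral_eq)
  show "(\<Sum>i<d. \<bar>LINT \<theta>|\<nu>. sg \<theta> * unit_jet d (Suc i) (p \<theta>) x\<bar>) \<le> measure \<nu> (space \<nu>)" for x
  proof (cases "x \<in> unit_cube d")
    case True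
    then have xs: "x \<in> space (lborel_pow d)" using unit_cube_subset_Rn by auto
    have i: "integrable \<nu> (\<lambda>\<theta>. sg \<theta> * unit_jet d j (p \<theta>) x)" if "j \<le> d" for j
      using measurable_compose[OF measurable_Pair2'[OF xs] signed_unit_measurable[OF assms(2,4) that]] b[OF that]
      by (intro integrable_const_bound[where B=2]) auto
    have "(\<Sum>i<d. \<bar>LINT \<theta>|\<nu>. sg \<theta> * unit_jet d (Suc i) (p \<theta>) x\<bar>) \<le> (\<Sum>i<d. LINT \<theta>|\<nu>. \<bar>sg \<theta> * unit_jet d (Suc i) (p \<theta>) x\<bar>)"
      by (intro sum_mono integral_abs_bound)
    also have "\<dots> = (LINT \<theta>|\<nu>. (\<Sum>i<d. \<bar>sg \<theta> * unit_jet d (Suc i) (p \<theta>) x\<bar>))"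
      using i by (intro Bochner_Integration.integral_sum[symmetric]) auto
    also have "\<dots> \<le> (LINT \<theta>|\<nu>. 1)"
    proof (rule integral_mono)
      show "integrable \<nu> (\<lambda>\<theta>. \<Sum>i<d. \<bar>sg \<theta> * unit_jet d (Suc i) (p \<theta>) x\<bar>)"
        using i by (intro Bochner_Integration.integrable_sum integrable_abs) auto
      fix \<theta>
      show "(\<Sum>i<d. \<bar>sg \<theta> * unit_jet d (Suc i) (p \<theta>) x\<bar>) \<le> 1"
        using order_trans[OF sum_mono[OF sga] gradient_sum_le[OF v[rule_format]]] .
    qed simp
    finally show ?thesis by simp
  qed (simp add: unit_jet_def)
qed

text \<open>This settles small \<open>m\<close>, with the zero network. The total weight of the
  mixture is at most \<open>4 * V\<close>, so the squared norm is at most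
  \<open>80 * V\<^sup>2\<close>, just below \<open>(9 * V)\<^sup>2\<close>.\<close>

lemma H1_norm_le_barron:
  fixes f :: "point \<Rightarrow> real"
  assumes d: "d \<ge> 1" and V: "barron_norm d 2 (unit_cube d) (\<lambda>x. complex_of_real (f x)) < ennreal V"
  shows "f \<in> H1 d (unit_cube d)" "H1_norm d (unit_cube d) f \<le> 9 * V"
proof -
  obtain c q \<nu> sg p where "relu_mixture d (4 * V) f c q (\<nu> :: (point \<times> real) measure) sg p"
    using barron_relu_representation[OF d V] by blast
  note R = relu_mixtureD[OF this]
  have v: "\<forall>\<theta>. valid_unit d (p \<theta>)" using R(5) by simp
  note mx = mixture_weak_jet[OF R(1-4) v]
  let ?E = "\<lambda>j x. (\<Sum>k<4::nat. c k * unit_jet d j (q k) x) + (LINT \<theta>|\<nu>. sg \<theta> * unit_jet d j (p \<theta>) x)"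
  have E: "weak_jet d ?E"
    using R(6) by (intro weak_jet_add mx(1) weak_jet_sum valid_unit_weak_jet) auto
  have W: "0 \<le> 4 * V" using R(7) by (smt (verit) measure_nonneg sum_nonneg abs_ge_zero)
  have "(\<Sum>j\<in>{..d}. LINT x|unif_cube d. (?E j x)\<^sup>2) \<le> 5 * (4 * V)\<^sup>2"
  proof (rule weak_jet_squares_le[OF E _ _ W])
    fix x
    have "\<bar>\<Sum>k<4::nat. c k * unit_jet d 0 (q k) x\<bar> \<le> (\<Sum>k<4::nat. \<bar>c k\<bar> * 2)"
      unfolding abs_mult[symmetric] using R(6)
      by (intro order_trans[OF sum_abs] sum_mono) (auto simp: abs_mult intro!: mult_left_mono valid_unit_bound)
    then show "\<bar>?E 0 x\<bar> \<le> 2 * (4 * V)"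
      using mx(2)[of 0 x] R(7) by (simp add: sum_distrib_right[symmetric])
    have "(\<Sum>i<d. \<bar>?E (Suc i) x\<bar>) \<le> (\<Sum>i<d. (\<Sum>k<4::nat. \<bar>c k\<bar> * \<bar>unit_jet d (Suc i) (q k) x\<bar>) + \<bar>LINT \<theta>|\<nu>. sg \<theta> * unit_jet d (Suc i) (p \<theta>) x\<bar>)"
      by (intro sum_mono order_trans[OF abs_triangle_ineq] add_mono order_trans[OF sum_abs]) (auto simp: abs_mult)
    also have "\<dots> = (\<Sum>k<4::nat. \<bar>c k\<bar> * (\<Sum>i<d. \<bar>unit_jet d (Suc i) (q k) x\<bar>)) + (\<Sum>i<d. \<bar>LINT \<theta>|\<nu>. sg \<theta> * unit_jet d (Suc i) (p \<theta>) x\<bar>)"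
      unfolding sum.distrib sum_distrib_left by (subst sum.swap) simp
    also have "\<dots> \<le> (\<Sum>k<4::nat. \<bar>c k\<bar> * 1) + measure \<nu> (space \<nu>)"
      using R(6) by (intro add_mono sum_mono mult_left_mono gradient_sum_le mx(3)) auto
    finally show "(\<Sum>i<d. \<bar>?E (Suc i) x\<bar>) \<le> 4 * V" using R(7) by simp
  qed
  also have "\<dots> \<le> (9 * V)\<^sup>2" by (simp add: power_mult_distrib)
  finally have "sqrt (\<Sum>j\<in>{..d}. LINT x|unif_cube d. (?E j x)\<^sup>2) \<le> 9 * V"
    using W by (intro real_le_lsqrt) (auto intro: sum_nonneg)
  then show "f \<in> H1 d (unit_cube d)" "H1_norm d (unit_cube d) f \<le> 9 * V"
    using H1_norm_le_weak_jet[OF E R(8)] by auto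
qed

text \<open>A network has exactly \<open>m\<close> units, so the free places are filled with weight
  0; the filler must still be an admissible unit, hence \<open>axis d\<close>.\<close>

lemma relu_networks_memI:
  assumes d: "d \<ge> 1" and N: "N + 4 \<le> m" and v: "\<forall>k<N. valid_unit d (u k)" "\<forall>k<4. valid_unit d (q k)"
    and B: "(\<Sum>k<N. \<bar>\<gamma> k\<bar>) + (\<Sum>k<4::nat. \<bar>c k\<bar>) \<le> B"
  shows "(\<lambda>x. (\<Sum>k<N. \<gamma> k * relu (dot d (fst (u k)) x + snd (u k)))
       + (\<Sum>k<4::nat. c k * relu (dot d (fst (q k)) x + snd (q k)))) \<in> relu_networks d m B"
proof -
  define G where "G k = (if k < N then \<gamma> k else if k < N + 4 then c (k - N) else 0)" for k
  define Q where "Q k = (if k < N then u k else if k < N + 4 then q (k - N) else (axis d, 0))" for k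
  have split: "(\<Sum>k<m. h k) = (\<Sum>k<N. h k) + (\<Sum>k<4::nat. h (N + k))" if "\<And>k. N + 4 \<le> k \<Longrightarrow> h k = 0" for h :: "nat \<Rightarrow> real"
  proof -
    have "(\<Sum>k<m. h k) = (\<Sum>k<N + 4. h k)"
      using N that by (intro sum.mono_neutral_right) auto
    also have "\<dots> = (\<Sum>k<N. h k) + (\<Sum>k<4::nat. h (N + k))"
      by (simp add: eval_nat_numeral)
    finally show ?thesis .
  qed
  have "(\<lambda>x. (\<Sum>k<N. \<gamma> k * relu (dot d (fst (u k)) x + snd (u k)))
       + (\<Sum>k<4::nat. c k * relu (dot d (fst (q k)) x + snd (q k))))
      = (\<lambda>x. \<Sum>k<m. G k * relu (dot d (fst (Q k)) x + snd (Q k)))"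
    by (rule ext, subst split) (auto simp: G_def Q_def)
  moreover have "\<forall>k<m. fst (Q k) \<in> Rn d \<and> norm1 d (fst (Q k)) = 1 \<and> snd (Q k) \<in> {-1..<1}"
    using v d by (auto simp: Q_def valid_unit_def norm1_axis axis_Rn)
  moreover have "(\<Sum>k<m. \<bar>G k\<bar>) \<le> B"
    using B by (subst split) (auto simp: G_def)
  ultimately show ?thesis unfolding relu_networks_def mem_Collect_eq
    by (intro exI[of _ G] exI[of _ "\<lambda>k. fst (Q k)"] exI[of _ "\<lambda>k. snd (Q k)"] conjI)
qed

text \<open>The constant: \<open>144 powr (2/3) \<le> 144\<close> and
  \<open>4 powr (2 / (3 * d)) \<le> 4\<close> give 576, and \<open>m div 2 \<ge> m / 3\<close>; then
  25 * 60 * 576 * 3 = 2592000 is below the square of 2000.\<close>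

lemma rate_arithmetic:
  assumes d: "d \<ge> 1" and m: "m \<ge> (16::nat)" and W: "0 \<le> W" "W \<le> 5 * N"
    and e: "e \<le> W\<^sup>2 * (60 * (144 * (4 / real m) powr (1 / real d)) powr (2/3)) / real (m div 2)"
  shows "sqrt e \<le> 2000 * N * real m powr (- (1/2 + 1 / (3 * real d)))"
proof -
  define M where "M = real m"
  have M: "M \<ge> 16" using m by (simp add: M_def)
  have d0: "real d \<ge> 1" using d by simp
  define r where "r = M powr (- (1/2 + 1 / (3 * real d)))"
  have N: "0 \<le> N" using W by linarith
  have h: "real (m div 2) \<ge> M / 3" using m by (simp add: M_def)
  have "(144 * (4 / M) powr (1 / real d)) powr (2/3) = 144 powr (2/3) * 4 powr (2 / (3 * real d)) * M powr (- (2 / (3 * real d)))"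
    using M by (simp add: powr_mult powr_powr powr_divide powr_minus_divide mult.commute)
  also have "\<dots> \<le> 144 powr 1 * 4 powr 1 * M powr (- (2 / (3 * real d)))"
    using d0 by (intro mult_right_mono mult_mono powr_mono) (auto simp: field_simps)
  finally have p: "(144 * (4 / M) powr (1 / real d)) powr (2/3) \<le> 576 * M powr (- (2 / (3 * real d)))" by simp
  have "e \<le> W\<^sup>2 * (60 * (144 * (4 / M) powr (1 / real d)) powr (2/3)) / real (m div 2)"
    using e by (simp add: M_def)
  also have "\<dots> \<le> (5 * N)\<^sup>2 * (60 * (576 * M powr (- (2 / (3 * real d))))) / (M / 3)"
    using W p h M by (intro frac_le mult_mono power_mono mult_left_mono) auto
  also have "\<dots> = 2592000 * N\<^sup>2 * (M powr (- (2 / (3 * real d))) / M)"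
    by (simp add: power_mult_distrib)
  also have "M powr (- (2 / (3 * real d))) / M = r\<^sup>2"
  proof -
    have "r\<^sup>2 = M powr (- (1/2 + 1 / (3 * real d)) + - (1/2 + 1 / (3 * real d)))"
      unfolding r_def power2_eq_square by (rule powr_add[symmetric])
    also have "- (1/2 + 1 / (3 * real d)) + - (1/2 + 1 / (3 * real d)) = - (2 / (3 * real d)) - 1"
      using d0 by (simp add: field_simps)
    also have "M powr (- (2 / (3 * real d)) - 1) = M powr (- (2 / (3 * real d))) / M"
      using M by (subst powr_diff) simp
    finally show ?thesis ..
  qed
  also have "2592000 * N\<^sup>2 * r\<^sup>2 \<le> (2000 * N * r)\<^sup>2"
    by (simp add: power_mult_distrib mult_right_mono)
  finally show ?thesis
    unfolding r_def[symmetric] M_def[symmetric] using N by (intro real_le_lsqrt) (auto simp: r_def M_def)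
qed

theorem proposition2p2:
  "\<exists>c>0. \<forall>d\<ge>1. \<forall>f :: (nat \<Rightarrow> real) \<Rightarrow> real. \<forall>m\<ge>1.
     (\<lambda>x. complex_of_real (f x)) \<in> barron_space d 2 (unit_cube d) \<longrightarrow>
     (let N = enn2real (barron_norm d 2 (unit_cube d) (\<lambda>x. complex_of_real (f x))) in
      \<exists>fm\<in>relu_networks d m (5 * N).
        (\<lambda>x. f x - fm x) \<in> H1 d (unit_cube d) \<and>
        H1_norm d (unit_cube d) (\<lambda>x. f x - fm x)
          \<le> c * N * real m powr (- (1 / 2 + 1 / (3 * real d))))"
proof (intro exI[of _ 2000] conjI allI impI)
  fix d :: nat and f :: "point \<Rightarrow> real" and m :: nat
  assume d: "d \<ge> 1" and m: "m \<ge> 1" and f: "(\<lambda>x. complex_of_real (f x)) \<in> barron_space d 2 (unit_cube d)"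
  define N where "N = enn2real (barron_norm d 2 (unit_cube d) (\<lambda>x. complex_of_real (f x)))"
  have N0: "N \<ge> 0" by (simp add: N_def)
  have bN: "barron_norm d 2 (unit_cube d) (\<lambda>x. complex_of_real (f x)) = ennreal N"
    using f by (simp add: N_def barron_space_def ennreal_enn2real)
  have V: "barron_norm d 2 (unit_cube d) (\<lambda>x. complex_of_real (f x)) < ennreal V" if "V > N" for V
    unfolding bN using that N0 by (simp add: ennreal_lessI)
  have "\<exists>fm\<in>relu_networks d m (5 * N). (\<lambda>x. f x - fm x) \<in> H1 d (unit_cube d) \<and>
        H1_norm d (unit_cube d) (\<lambda>x. f x - fm x) \<le> 2000 * N * real m powr (- (1 / 2 + 1 / (3 * real d)))"
  \<comment> \<open>From 16 on, \<open>m div 2\<close> samples, at most \<open>m / 4\<close> more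
    for the cells and the 4 affine units fit into \<open>m\<close>. The case \<open>N = 0\<close> is
    separate because the factor 5/4 must leave room above \<open>N\<close>.\<close>
  proof (cases "N = 0 \<or> m < 16")
    case True
    have z: "(\<lambda>x. 0) \<in> relu_networks d m (5 * N)"
      unfolding relu_networks_def mem_Collect_eq
      by (intro exI[of _ "\<lambda>_. 0"] exI[of _ "\<lambda>_. axis d"] conjI) (use N0 d axis_Rn norm1_axis in auto)
    have h1: "f \<in> H1 d (unit_cube d)" using H1_norm_le_barron(1)[OF d V[of "N + 1"]] by simp
    \<comment> \<open>The bound holds for every \<open>V > N\<close> and passes to the limit; for
      \<open>N = 0\<close> it makes the norm of \<open>f\<close> vanish.\<close>
    have "H1_norm d (unit_cube d) f / 9 \<le> N"
    proof (rule dense_ge)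
      fix V assume "N < V"
      then show "H1_norm d (unit_cube d) f / 9 \<le> V" using H1_norm_le_barron(2)[OF d V[OF \<open>N < V\<close>]] by simp
    qed
    then have "H1_norm d (unit_cube d) f \<le> 9 * N" by simp
    also have "\<dots> \<le> 2000 * N * real m powr (- (1 / 2 + 1 / (3 * real d)))"
    proof (cases "N = 0")
      case False
      then have m16: "m < 16" using True by simp
      have "1 / 16 \<le> 1 / real m" using m m16 by (intro divide_left_mono) auto
      also have "\<dots> = real m powr (- 1)" using m by (simp add: powr_minus_divide)
      \<comment> \<open>\<open>1/2 + 1 / (3 * d)\<close> is at most 5/6, so the exponent -1 gives
        the smaller power.\<close>
      also have "\<dots> \<le> real m powr (- (1 / 2 + 1 / (3 * real d)))"
        using m d by (intro powr_mono) (auto simp: field_simps)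
      finally have "9 \<le> 2000 * real m powr (- (1 / 2 + 1 / (3 * real d)))" by simp
      from mult_left_mono[OF this N0] show ?thesis by (simp add: mult_ac)
    qed simp
    finally show ?thesis using z h1 by (intro bexI[of _ "\<lambda>x. 0"]) auto
  next
    case False
    then have Np: "N > 0" and m16: "m \<ge> 16" using N0 by auto
    \<comment> \<open>The bound \<open>4 * (5/4 * N)\<close> on the weights is exactly the budget of
      the network class.\<close>
    obtain c q \<nu> sg p where "relu_mixture d (4 * (5/4 * N)) f c q (\<nu> :: (point \<times> real) measure) sg p"
      using barron_relu_representation[OF d V[of "5/4 * N"]] Np by auto
    note R = relu_mixtureD[OF this]
    have v: "\<forall>\<theta>. valid_unit d (p \<theta>)" using R(5) by simp
    define W where "W = measure \<nu> (space \<nu>)"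
    \<comment> \<open>Chosen so that the bound \<open>(144 / \<delta>) ^ d\<close> on the number of
      cells equals \<open>m / 4\<close>.\<close>
    define \<delta> where "\<delta> = 144 * (4 / real m) powr (1 / real d)"
    have \<delta>: "\<delta> > 0" using m by (simp add: \<delta>_def)
    have \<delta>d: "(144 / \<delta>) ^ d = real m / 4"
    proof -
      have "((4 / real m) powr (1 / real d)) ^ d = 4 / real m"
        using m d by (simp add: powr_realpow[symmetric] powr_powr)
      then show ?thesis unfolding \<delta>_def by (simp add: power_divide)
    qed
    obtain C A where C: "finite (C :: (real \<times> nat set \<times> nat set \<times> int) set)" "real (card C) \<le> max 1 ((144 / \<delta>) ^ d)"
       "\<forall>c\<in>C. A c \<in> sets \<nu>" "disjoint_family_on A C" "(\<Union>c\<in>C. A c) = space \<nu>"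
       "\<forall>c\<in>C. \<forall>\<theta>\<in>A c. \<forall>\<theta>'\<in>A c. (\<Sum>j\<in>{..d}. LINT x|unif_cube d. (sg \<theta> * unit_jet d j (p \<theta>) x - sg \<theta>' * unit_jet d j (p \<theta>') x)\<^sup>2)
        \<le> 60 * \<delta> powr (2/3)"
      using cells_exist[OF d \<delta> R(2) R(3)[rule_format] R(4) R(5)[rule_format]] by (elim exE conjE)
    have cC: "m div 2 + card C + 4 \<le> m"
    proof -
      have "real (card C) \<le> real m / 4" using C(2) m16 unfolding \<delta>d by simp
      then show ?thesis using m16 by linarith
    qed
    \<comment> \<open>\<open>stratified_maurey\<close> asks for measurability and a bound at every
      index, and beyond \<open>d\<close> the components of a unit are uncontrolled.\<close>
    define K where "K j \<theta> x = (if j \<le> d then sg \<theta> * unit_jet d j (p \<theta>) x else 0)" for j \<theta> x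
    have Km: "(\<lambda>(\<theta>, x). K j \<theta> x) \<in> borel_measurable (\<nu> \<Otimes>\<^sub>M unif_cube d)" for j
      using signed_unit_measurable[OF R(2,4), of j] by (cases "j \<le> d") (simp_all add: K_def)
    have Kb: "\<bar>K j \<theta> x\<bar> \<le> 2" for j \<theta> x
      using valid_unit_bound[of d "p \<theta>" j x] v R(3)[rule_format, of \<theta>] by (auto simp: K_def abs_mult)
    have Kd: "(\<Sum>j\<in>{..d}. LINT x|unif_cube d. (K j \<theta> x - K j \<theta>' x)\<^sup>2) \<le> 60 * \<delta> powr (2/3)"
      if "c \<in> C" "\<theta> \<in> A c" "\<theta>' \<in> A c" for c \<theta> \<theta>'
      using C(6) that by (simp add: K_def)
    have "\<exists>n \<theta> w. n \<le> m div 2 + card C \<and> (\<forall>k<n. w k \<ge> 0 \<and> \<theta> k \<in> space \<nu>) \<and> (\<Sum>k<n. w k) = measure \<nu> (space \<nu>) \<and>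
       (\<Sum>j\<in>{..d}. LINT x|unif_cube d. ((LINT \<theta>|\<nu>. K j \<theta> x) - (\<Sum>k<n. w k * K j (\<theta> k) x))\<^sup>2)
         \<le> (measure \<nu> (space \<nu>))\<^sup>2 * (60 * \<delta> powr (2/3)) / real (m div 2)"
      by (rule stratified_maurey[where A=A and B=2, OF R(1) _ _ Km Kb C(1) _ C(4,5) Kd])
         (use C(3) m16 in \<open>auto intro: unif_cube.finite_measure_axioms\<close>)
    then obtain n \<theta> w where S: "n \<le> m div 2 + card C" "\<forall>k<n. w k \<ge> 0 \<and> \<theta> k \<in> space \<nu>" "(\<Sum>k<n. w k) = W"
       "(\<Sum>j\<in>{..d}. LINT x|unif_cube d. ((LINT \<theta>|\<nu>. K j \<theta> x) - (\<Sum>k<n. w k * K j (\<theta> k) x))\<^sup>2) \<le> W\<^sup>2 * (60 * \<delta> powr (2/3)) / real (m div 2)"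
      unfolding W_def by (elim exE conjE)
    define \<gamma> where "\<gamma> k = w k * sg (\<theta> k)" for k
    define fm where "fm x = (\<Sum>k<n. \<gamma> k * relu (dot d (fst (p (\<theta> k))) x + snd (p (\<theta> k))))
       + (\<Sum>k<4::nat. c k * relu (dot d (fst (q k)) x + snd (q k)))" for x
    have "fm \<in> relu_networks d m (5 * N)"
      unfolding fm_def
    proof (rule relu_networks_memI[OF d])
      have "(\<Sum>k<n. \<bar>\<gamma> k\<bar>) \<le> (\<Sum>k<n. w k)"
      proof (rule sum_mono)
        fix k assume "k \<in> {..<n}"
        then show "\<bar>\<gamma> k\<bar> \<le> w k" using S(2) R(3)[rule_format, of "\<theta> k"] by (auto simp: \<gamma>_def abs_mult)
      qed
      then show "(\<Sum>k<n. \<bar>\<gamma> k\<bar>) + (\<Sum>k<4::nat. \<bar>c k\<bar>) \<le> 5 * N" using S(3) R(7) by (simp add: W_def)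
      show "n + 4 \<le> m" using S(1) cC by linarith
      show "\<forall>k<n. valid_unit d (p (\<theta> k))" by (intro allI impI v[rule_format])
      show "\<forall>k<4. valid_unit d (q k)" by (rule R(6))
    qed
    \<comment> \<open>The jet of the error: the affine units occur in \<open>f\<close> and in
      \<open>fm\<close> alike and cancel, so only the mixture and its sample remain.\<close>
    define E where "E j x = (LINT \<theta>|\<nu>. sg \<theta> * unit_jet d j (p \<theta>) x) + (\<Sum>k<n. (- \<gamma> k) * unit_jet d j (p (\<theta> k)) x)" for j x
    have wE: "weak_jet d E"
      unfolding E_def by (intro weak_jet_add mixture_weak_jet(1)[OF R(1-4) v] weak_jet_sum valid_unit_weak_jet v[rule_format])
    have fE: "AE x in lborel_pow d. x \<in> unit_cube d \<longrightarrow> f x - fm x = E 0 x"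
      using R(8)
    proof eventually_elim
      fix x assume fx: "x \<in> unit_cube d \<longrightarrow>
          f x = (\<Sum>k<4::nat. c k * unit_jet d 0 (q k) x) + (LINT \<theta>|\<nu>. sg \<theta> * unit_jet d 0 (p \<theta>) x)"
      have "unit_jet d 0 u x = relu (dot d (fst u) x + snd u)" if "x \<in> unit_cube d" for u
        using unit_jet_0[OF that, of "fst u" "snd u"] by simp
      then show "x \<in> unit_cube d \<longrightarrow> f x - fm x = E 0 x"
        using fx by (simp add: fm_def E_def sum_negf)
    qed
    have "(\<Sum>j\<in>{..d}. LINT x|unif_cube d. (E j x)\<^sup>2)
       = (\<Sum>j\<in>{..d}. LINT x|unif_cube d. ((LINT \<theta>|\<nu>. K j \<theta> x) - (\<Sum>k<n. w k * K j (\<theta> k) x))\<^sup>2)"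
      by (intro sum.cong refl) (simp add: E_def K_def \<gamma>_def sum_negf mult.assoc)
    with S(4) have e: "(\<Sum>j\<in>{..d}. LINT x|unif_cube d. (E j x)\<^sup>2) \<le> W\<^sup>2 * (60 * \<delta> powr (2/3)) / real (m div 2)" by simp
    have "sqrt (\<Sum>j\<in>{..d}. LINT x|unif_cube d. (E j x)\<^sup>2) \<le> 2000 * N * real m powr (- (1/2 + 1 / (3 * real d)))"
    proof (rule rate_arithmetic[OF d m16])
      show "0 \<le> W" by (simp add: W_def)
      have "0 \<le> (\<Sum>k<4::nat. \<bar>c k\<bar>)" by (intro sum_nonneg) simp
      then show "W \<le> 5 * N" using R(7) unfolding W_def by linarith
    qed (rule e[unfolded \<delta>_def])
    then show ?thesis
      using \<open>fm \<in> _\<close> H1_norm_le_weak_jet[OF wE fE] by (intro bexI[of _ fm]) auto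
  qed
  then show "let N = enn2real (barron_norm d 2 (unit_cube d) (\<lambda>x. complex_of_real (f x))) in
      \<exists>fm\<in>relu_networks d m (5 * N).
        (\<lambda>x. f x - fm x) \<in> H1 d (unit_cube d) \<and>
        H1_norm d (unit_cube d) (\<lambda>x. f x - fm x)
          \<le> 2000 * N * real m powr (- (1 / 2 + 1 / (3 * real d)))"
    unfolding N_def Let_def .
qed simp

end
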